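(* Let $(G,S)$ be a Cayley graph of a group of polynomial growth with homogeneous dimension $N$. Assume that $N\ge 2$, $0<\alpha<N$, $p>\frac{N+\alpha}{N}$, and that the nonnegative potential $a:G\to[0,\infty)$ satisfies: ($A_1$) the potential well $\Omega=\{x\in G: a(x)=0\}$ is a nonempty, connected and bounded domain in $G$; ($A_2$) there exists $M>0$ such that the set $\{x\in G: a(x)\le M\}$ is finite and nonempty. Then there exists $\lambda_0>0$ such that for any $\lambda\ge\lambda_0$ the equation $$\Delta^{2}u-\Delta u+(1+\lambda a(x))u=(R_{\alpha}\ast|u|^{p})|u|^{p-2}u\quad\text{on } G$$ has a ground state solution $u_\lambda\in E_\lambda$. Moreover, there exists a nontrivial solution pair $(u_\lambda,v_\lambda)=(u_\lambda,R_\alpha\ast|u_\lambda|^p)$ of the system $$\begin{cases}\Delta^{2}u-\Delta u+(1+\lambda a(x))u=v|u|^{p-2}u,\\ (-\Delta)^{\frac{\alpha}{2}}v=|u|^{p}.\end{cases}$$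
   Context: Setting. $G$ is a finitely generated group with finite symmetric generating set $S=S^{-1}$; $(G,S)$ is the graph with vertex set $G$ and $x\sim y$ iff $x^{-1}y\in S$; $d^S$ is the word metric (graph distance), $B^S_r(x)=\{y: d^S(x,y)\le r\}$, $e$ is the unit of $G$. $G$ has polynomial growth with homogeneous dimension $N\in\mathbb N$: there are $C_1,C_2>0$ with $C_1r^N\le |B^S_r(e)|\le C_2r^N$ for all $r\ge1$. $\mu$ is the counting measure, $\int_A u\,d\mu=\sum_{x\in A}u(x)$. Functions are real-valued; $C_c(G)$ is the set of finitely supported functions. Operators. $\Delta u(x)=\sum_{y\sim x}(u(y)-u(x))$; $\nabla u\nabla v(x)=\frac12\sum_{y\sim x}(u(y)-u(x))(v(y)-v(x))$, $|\nabla u|^2=\nabla u\nabla u$. $\Delta^2u$ is defined in the distributional sense by $\int_G(\Delta^2u)\phi\,d\mu=\int_G\Delta u\,\Delta\phi\,d\mu$ for $\phi\in C_c(G)$. The fractional Laplacian on $G$ is defined by $(-\Delta)^{\frac\alpha2}u=\frac{1}{|\Gamma(-\frac\alpha2)|}\int_0^{+\infty}(e^{t\Delta}u-u)t^{-1-\frac\alpha2}\,dt$, where $e^{t\Delta}$ is the semigroup of $\Delta$ and $\Gamma$ is the Gamma function. Kernel. Let $k_t(x,y)$ be the heat kernel of $\Delta$ on $G$. The corresponding Green's function of the fractional Laplacian is $R_\alpha(x,y)=\frac{1}{|\Gamma(\frac\alpha2)|}\int_0^{+\infty} k_t(x,y)t^{-1+\frac\alpha2}\,dt$, $x,y\in G$.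 The convolution term is understood with the diagonal omitted: $\int_G(R_\alpha\ast u)(x)v(x)\,d\mu:=\sum_{x,y\in G,\,x\ne y}R_\alpha(x,y)u(y)v(x)$, i.e. $(R_\alpha\ast f)(x)=\sum_{y\in G,\,y\neq x}R_\alpha(x,y)f(y)$. Spaces. $W^{2,2}(G)$ is the completion of $C_c(G)$ in the norm $\|u\|_{W^{2,2}}=(\int_G(|\Delta u|^2+|\nabla u|^2+u^2)\,d\mu)^{1/2}$. For $\lambda>0$, $E_\lambda=\{u\in W^{2,2}(G):\int_G\lambda a u^2\,d\mu<+\infty\}$ with norm $\|u\|_{E_\lambda}=(\int_G(|\Delta u|^2+|\nabla u|^2+(1+\lambda a)u^2)\,d\mu)^{1/2}$. Solutions. $J_\lambda:E_\lambda\to\mathbb R$, $J_\lambda(u)=\frac12\|u\|_{E_\lambda}^2-\frac1{2p}\int_G(R_\alpha\ast|u|^p)|u|^p\,d\mu$, is $C^1$ with $(J_\lambda'(u),v)=\int_G(\Delta u\Delta v+\nabla u\nabla v+(1+\lambda a)uv)\,d\mu-\int_G(R_\alpha\ast|u|^p)|u|^{p-2}uv\,d\mu$. A solution of the equation is $u\in E_\lambda$ with $J_\lambda'(u)=0$. The Nehari manifold is $N_\lambda=\{u\in E_\lambda\setminus\{0\}:(J_\lambda'(u),u)=0\}$ and $m_\lambda=\inf_{N_\lambda}J_\lambda$. A ground state solution is a nontrivial critical point $u$ of $J_\lambda$ with the least energy, $J_\lambda(u)=m_\lambda>0$.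
   Formalization: The second equation, false as printed, is stated for v plus the omitted diagonal term R_α(x,x)|u|^p; the fractional Laplacian is normalised by 1/Γ(-α/2), not 1/|Γ(-α/2)|, and for α≥2 integer powers of -Δ are split off. *)

theory Defs
  imports "HOL-Analysis.Analysis"
begin

text \<open>The group is a type of class \<^class>\<open>group_add\<close>, which is not assumed commutative and only
  writes the group law additively: the paper's \<open>x\<^sup>-\<^sup>1y\<close> is \<open>- x + y\<close> and the unit \<open>e\<close> is \<open>0\<close>.
  The integral over \<open>G\<close> against the counting measure is \<^const>\<open>infsum\<close> over \<^const>\<open>UNIV\<close>.\<close>

definition generating_set :: "'a::group_add set \<Rightarrow> bool" where
  "generating_set S \<longleftrightarrow>
     finite S \<and> uminus ` S = S \<and> (\<forall>x. \<exists>xs. set xs \<subseteq> S \<and> sum_list xs = x)"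

definition adj :: "'a::group_add set \<Rightarrow> 'a \<Rightarrow> 'a \<Rightarrow> bool" where
  "adj S x y \<longleftrightarrow> - x + y \<in> S"

definition word_dist :: "'a::group_add set \<Rightarrow> 'a \<Rightarrow> 'a \<Rightarrow> nat" where
  "word_dist S x y = (LEAST n. (x, y) \<in> {(z, w). adj S z w} ^^ n)"

definition word_ball :: "'a::group_add set \<Rightarrow> 'a \<Rightarrow> real \<Rightarrow> 'a set" where
  "word_ball S x r = {y. real (word_dist S x y) \<le> r}"

definition homogeneous_dim :: "'a::group_add set \<Rightarrow> nat \<Rightarrow> bool" where
  "homogeneous_dim S N \<longleftrightarrow>
     (\<exists>C\<^sub>1 > 0. \<exists>C\<^sub>2 > 0. \<forall>r::real. r \<ge> 1 \<longrightarrow>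
        C\<^sub>1 * r ^ N \<le> real (card (word_ball S 0 r)) \<and> real (card (word_ball S 0 r)) \<le> C\<^sub>2 * r ^ N)"

definition connected_in :: "'a::group_add set \<Rightarrow> 'a set \<Rightarrow> bool" where
  "connected_in S A \<longleftrightarrow>
     (\<forall>x\<in>A. \<forall>y\<in>A. (x, y) \<in> {(z, w). z \<in> A \<and> w \<in> A \<and> adj S z w}\<^sup>*)"

definition bounded_in :: "'a::group_add set \<Rightarrow> 'a set \<Rightarrow> bool" where
  "bounded_in S A \<longleftrightarrow> (\<exists>r. A \<subseteq> word_ball S 0 r)"

definition Cc :: "('a \<Rightarrow> real) set" where
  "Cc = {\<phi>. finite {x. \<phi> x \<noteq> 0}}"

definition lap :: "'a::group_add set \<Rightarrow> ('a \<Rightarrow> real) \<Rightarrow> 'a \<Rightarrow> real" where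
  "lap S u x = (\<Sum>y | adj S x y. u y - u x)"

definition grad_prod :: "'a::group_add set \<Rightarrow> ('a \<Rightarrow> real) \<Rightarrow> ('a \<Rightarrow> real) \<Rightarrow> 'a \<Rightarrow> real" where
  "grad_prod S u v x = 1 / 2 * (\<Sum>y | adj S x y. (u y - u x) * (v y - v x))"

definition bilap :: "'a::group_add set \<Rightarrow> ('a \<Rightarrow> real) \<Rightarrow> 'a \<Rightarrow> real" where
  "bilap S u = (THE f. \<forall>\<phi>\<in>Cc. (\<Sum>\<^sub>\<infinity>x. f x * \<phi> x) = (\<Sum>\<^sub>\<infinity>x. lap S u x * lap S \<phi> x))"

text \<open>The Laplacian of a finite-degree Cayley graph is a bounded operator on every \<open>\<ell>\<^sup>q\<close>, so its
  semigroup is the exponential series. The heat kernel is its action on unit masses, the counting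
  measure having weight one.\<close>

definition heat :: "'a::group_add set \<Rightarrow> real \<Rightarrow> ('a \<Rightarrow> real) \<Rightarrow> 'a \<Rightarrow> real" where
  "heat S t u x = (\<Sum>n. t ^ n / fact n * (lap S ^^ n) u x)"

definition heat_kernel :: "'a::group_add set \<Rightarrow> real \<Rightarrow> 'a \<Rightarrow> 'a \<Rightarrow> real" where
  "heat_kernel S t x y = heat S t (\<lambda>z. if z = y then 1 else 0) x"

definition green :: "'a::group_add set \<Rightarrow> real \<Rightarrow> 'a \<Rightarrow> 'a \<Rightarrow> real" where
  "green S \<alpha> x y =
     1 / \<bar>Gamma (\<alpha> / 2)\<bar> * (LINT t:{0<..}|lborel. heat_kernel S t x y * t powr (- 1 + \<alpha> / 2))"

definition green_conv :: "'a::group_add set \<Rightarrow> real \<Rightarrow> ('a \<Rightarrow> real) \<Rightarrow> 'a \<Rightarrow> real" where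
  "green_conv S \<alpha> f x = (\<Sum>\<^sub>\<infinity>y\<in>- {x}. green S \<alpha> x y * f y)"

text \<open>The power \<open>(-\<Delta>)\<^sup>s\<close>, \<open>0 < s < 1\<close>, by the heat semigroup formula. Since \<open>\<Gamma>(-s) < 0\<close> and
  \<open>e\<^sup>t\<^sup>\<Delta> - 1\<close> is a nonpositive operator, the normalisation that gives the positive
  operator \<open>(-\<Delta>)\<^sup>s\<close> is \<open>1 / \<Gamma>(-s)\<close>; with \<open>1 / |\<Gamma>(-s)|\<close> the result would be \<open>-(-\<Delta>)\<^sup>s\<close>.\<close>

definition frac_lap_below_one :: "'a::group_add set \<Rightarrow> real \<Rightarrow> ('a \<Rightarrow> real) \<Rightarrow> 'a \<Rightarrow> real" where
  "frac_lap_below_one S s u x =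
     1 / Gamma (- s) * (LINT t:{0<..}|lborel. (heat S t u x - u x) * t powr (- 1 - s))"

text \<open>The semigroup formula diverges at \<open>t = 0\<close> (or has \<open>\<Gamma>\<close> at a pole) once \<open>\<alpha> \<ge> 2\<close>; as usual, the
  integer part of the exponent \<open>\<alpha> / 2\<close> is then split off. For \<open>0 < \<alpha> < 2\<close> this is the formula
  itself.\<close>

definition frac_lap :: "'a::group_add set \<Rightarrow> real \<Rightarrow> ('a \<Rightarrow> real) \<Rightarrow> 'a \<Rightarrow> real" where
  "frac_lap S \<alpha> u =
     (let w = ((\<lambda>f x. - lap S f x) ^^ nat \<lfloor>\<alpha> / 2\<rfloor>) u
      in if frac (\<alpha> / 2) = 0 then w else frac_lap_below_one S (frac (\<alpha> / 2)) w)"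

text \<open>The completion of \<^const>\<open>Cc\<close>, realised as a space of functions: the norm dominates the
  \<open>\<ell>\<^sup>2\<close> norm, so it is the closure of \<^const>\<open>Cc\<close> among the functions of finite norm.\<close>

definition W22_norm :: "'a::group_add set \<Rightarrow> ('a \<Rightarrow> real) \<Rightarrow> real" where
  "W22_norm S u = sqrt (\<Sum>\<^sub>\<infinity>x. (lap S u x)\<^sup>2 + grad_prod S u u x + (u x)\<^sup>2)"

definition W22 :: "'a::group_add set \<Rightarrow> ('a \<Rightarrow> real) set" where
  "W22 S = {u. (\<lambda>x. (lap S u x)\<^sup>2 + grad_prod S u u x + (u x)\<^sup>2) summable_on UNIV \<and>
     (\<exists>\<phi>. (\<forall>n. \<phi> n \<in> Cc) \<and> (\<lambda>n. W22_norm S (\<lambda>x. u x - \<phi> n x)) \<longlonglongrightarrow> 0)}"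

definition E_space :: "'a::group_add set \<Rightarrow> ('a \<Rightarrow> real) \<Rightarrow> real \<Rightarrow> ('a \<Rightarrow> real) set" where
  "E_space S a l = {u \<in> W22 S. (\<lambda>x. l * a x * (u x)\<^sup>2) summable_on UNIV}"

definition E_norm :: "'a::group_add set \<Rightarrow> ('a \<Rightarrow> real) \<Rightarrow> real \<Rightarrow> ('a \<Rightarrow> real) \<Rightarrow> real" where
  "E_norm S a l u =
     sqrt (\<Sum>\<^sub>\<infinity>x. (lap S u x)\<^sup>2 + grad_prod S u u x + (1 + l * a x) * (u x)\<^sup>2)"

text \<open>In \<open>|u|\<^sup>p\<^sup>-\<^sup>2u\<close> at a zero of \<open>u\<close>, \<^term>\<open>0 powr (p - 2) = (0::real)\<close> gives the intended value \<open>0\<close>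
  also when \<open>p < 2\<close>.\<close>

definition J :: "'a::group_add set \<Rightarrow> ('a \<Rightarrow> real) \<Rightarrow> real \<Rightarrow> real \<Rightarrow> real \<Rightarrow> ('a \<Rightarrow> real) \<Rightarrow> real" where
  "J S a \<alpha> p l u = 1 / 2 * (E_norm S a l u)\<^sup>2
     - 1 / (2 * p) * (\<Sum>\<^sub>\<infinity>x. green_conv S \<alpha> (\<lambda>y. \<bar>u y\<bar> powr p) x * \<bar>u x\<bar> powr p)"

definition dJ :: "'a::group_add set \<Rightarrow> ('a \<Rightarrow> real) \<Rightarrow> real \<Rightarrow> real \<Rightarrow> real
    \<Rightarrow> ('a \<Rightarrow> real) \<Rightarrow> ('a \<Rightarrow> real) \<Rightarrow> real" where
  "dJ S a \<alpha> p l u v =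
     (\<Sum>\<^sub>\<infinity>x. lap S u x * lap S v x + grad_prod S u v x + (1 + l * a x) * u x * v x)
     - (\<Sum>\<^sub>\<infinity>x. green_conv S \<alpha> (\<lambda>y. \<bar>u y\<bar> powr p) x * \<bar>u x\<bar> powr (p - 2) * u x * v x)"

definition critical_point :: "'a::group_add set \<Rightarrow> ('a \<Rightarrow> real) \<Rightarrow> real \<Rightarrow> real \<Rightarrow> real
    \<Rightarrow> ('a \<Rightarrow> real) \<Rightarrow> bool" where
  "critical_point S a \<alpha> p l u \<longleftrightarrow>
     u \<in> E_space S a l \<and> (\<forall>v\<in>E_space S a l. dJ S a \<alpha> p l u v = 0)"

definition Nehari :: "'a::group_add set \<Rightarrow> ('a \<Rightarrow> real) \<Rightarrow> real \<Rightarrow> real \<Rightarrow> real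
    \<Rightarrow> ('a \<Rightarrow> real) set" where
  "Nehari S a \<alpha> p l = {u \<in> E_space S a l. u \<noteq> (\<lambda>_. 0) \<and> dJ S a \<alpha> p l u u = 0}"

definition ground_level :: "'a::group_add set \<Rightarrow> ('a \<Rightarrow> real) \<Rightarrow> real \<Rightarrow> real \<Rightarrow> real \<Rightarrow> real" where
  "ground_level S a \<alpha> p l = (INF u\<in>Nehari S a \<alpha> p l. J S a \<alpha> p l u)"

definition ground_state :: "'a::group_add set \<Rightarrow> ('a \<Rightarrow> real) \<Rightarrow> real \<Rightarrow> real \<Rightarrow> real
    \<Rightarrow> ('a \<Rightarrow> real) \<Rightarrow> bool" where
  "ground_state S a \<alpha> p l u \<longleftrightarrow>
     critical_point S a \<alpha> p l u \<and> u \<noteq> (\<lambda>_. 0) \<and>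
     J S a \<alpha> p l u = ground_level S a \<alpha> p l \<and> ground_level S a \<alpha> p l > 0"

text \<open>A solution pair \<open>(u, v)\<close> of the system, for \<open>v\<close> the diagonal-free convolution
  \<open>R\<^sub>\<alpha> * |u|\<^sup>p\<close>. The kernel \<^const>\<open>green\<close> inverts the fractional Laplacian only with its diagonal
  included. Therefore the second equation is read for the Green potential of \<open>|u|\<^sup>p\<close> that \<open>v\<close>
  stands for, which is \<open>v\<close> plus the omitted diagonal term \<open>R\<^sub>\<alpha>(x,x)|u(x)|\<^sup>p\<close>. For \<open>v\<close> itself
  the equation would force \<open>(-\<Delta>)\<^sup>\<alpha>\<^sup>/\<^sup>2|u|\<^sup>p = 0\<close>, hence \<open>u = 0\<close>.\<close>

definition solves_system :: "'a::group_add set \<Rightarrow> ('a \<Rightarrow> real) \<Rightarrow> real \<Rightarrow> real \<Rightarrow> real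
    \<Rightarrow> ('a \<Rightarrow> real) \<Rightarrow> ('a \<Rightarrow> real) \<Rightarrow> bool" where
  "solves_system S a \<alpha> p l u v \<longleftrightarrow>
     (\<forall>x. bilap S u x - lap S u x + (1 + l * a x) * u x = v x * \<bar>u x\<bar> powr (p - 2) * u x) \<and>
     (\<forall>x. frac_lap S \<alpha> (\<lambda>y. v y + green S \<alpha> y y * \<bar>u y\<bar> powr p) x = \<bar>u x\<bar> powr p)"

end

theory Submission
  imports Defs "HOL-Complex_Analysis.Great_Picard"
begin

text \<open>Write \<open>R\<close> for the Green kernel of order \<open>\<alpha>\<close> and
\<open>D(u) = \<Sum>\<^bsub>x \<noteq> y\<^esub> R(x,y) |u(x)|\<^sup>p |u(y)|\<^sup>p\<close>. The functional \<open>J\<close> is half the squared norm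
minus \<open>D(u) / (2p)\<close>, and \<open>D\<close> is homogeneous of degree \<open>2p > 2\<close>. So every half-line from the origin on
which \<open>D > 0\<close> meets the Nehari manifold exactly once, and the least energy there belongs to the
direction that maximises \<open>D\<close> on the unit sphere. A ground state is thus a rescaled maximiser of
\<open>D\<close> (\<open>ground_state_from_maximizer\<close>), and three things remain: \<open>D\<close> is finite, the maximum is attained
for large \<open>\<lambda>\<close>, and the convolution with \<open>R\<close> inverts the fractional Laplacian.

Finiteness. Comparing \<open>k\<^sub>t(0,0)\<close> with its average over a ball of radius about \<open>\<surd>t\<close> turns the volume
growth into a differential inequality whose solutions decay like \<open>t\<^bsup>-N/2\<^esup>\<close> (\<open>diag_decay\<close>). Together
with \<open>\<Sum>\<^sub>y k\<^sub>t(x,y) \<le> 1\<close> this gives \<open>\<langle>e\<^bsup>t\<Delta>\<^esup>f, g\<rangle> = O(t\<^bsup>-(N/q - N/2)\<^esup>)\<close> for \<open>f, g \<in> \<ell>\<^sup>q\<close> with \<open>1 < q < 2\<close>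
(\<open>heat_pairing_decay\<close>), which is integrable against \<open>t\<^bsup>\<alpha>/2-1\<^esup>\<close> as soon as \<open>\<alpha>/2 < N/q - N/2\<close>.
Some such \<open>q\<close> satisfies \<open>pq > 2\<close> exactly when \<open>p > (N + \<alpha>)/N\<close> (\<open>exponent_exists\<close>); then
\<open>|u|\<^sup>p \<in> \<ell>\<^sup>q\<close> for \<open>u \<in> \<ell>\<^sup>2\<close>, and \<open>D(u) \<le> K |u|\<^bsup>2p\<^esup>\<close> in the \<open>\<ell>\<^sup>2\<close> norm. The strict inequality for \<open>p\<close> leaves
room for \<open>q\<close>, so that the endpoint Hardy-Littlewood-Sobolev inequality can be avoided.

Attainment. Let \<open>m\<close> be the supremum of \<open>D\<close> on the unit ball. A maximising sequence has a pointwise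
limit \<open>u\<close>; let \<open>\<theta> \<le> 1\<close> be its squared norm. The squared norm is a sum over the vertices of a nonnegative
density. On finite sets both the density and \<open>D\<close> converge. Off a large finite set \<open>a > M\<close>, so the
\<open>\<ell>\<^sup>2\<close> norm is small there and \<open>D\<close> is at most \<open>\<kappa> = K(1 + \<lambda>M)\<^bsup>-p\<^esup>\<close> times the escaping squared norm; the
mixed part is negligible because \<open>R(x,-)\<close> decays (\<open>green_tail\<close>). Hence \<open>m \<le> D(u) + \<kappa>(1 - \<theta>)\<close>, while
\<open>D(u) \<le> m\<theta>\<^sup>p \<le> m\<theta>\<close>. If \<open>\<kappa> < m\<close>, both together force \<open>\<theta> = 1\<close> (\<open>best_attained\<close>). Finally, a test function
with value \<open>1\<close> at a zero of \<open>a\<close> and \<open>\<lambda>\<^bsup>-1/2\<^esup>\<close> at a neighbour of it shows \<open>m \<ge> c\<lambda>\<^bsup>-p/2\<^esup>\<close>, which exceeds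
\<open>\<kappa> = O(\<lambda>\<^bsup>-p\<^esup>)\<close> for large \<open>\<lambda>\<close> (\<open>best_lower_bound\<close>). Two sites are needed since \<open>D\<close> omits the diagonal.

The Euler-Lagrange equation is a one-variable computation. Since the diagonal is omitted, changing \<open>u\<close>
at a single site \<open>z\<close> changes \<open>D\<close> by exactly \<open>2(|u(z) + s|\<^sup>p - |u(z)|\<^sup>p) (R * |u|\<^sup>p)(z)\<close>, which is
differentiable in \<open>s\<close>. This yields the equation at every site, and summation by parts
extends it to all test functions.

The system. For \<open>f = |u|\<^sup>p\<close> the Green potential at \<open>x\<close> is a Mellin transform in time of \<open>e\<^bsup>t\<Delta>\<^esup>f(x)\<close>. By
polarisation that function of \<open>t\<close> is a difference of two quadratic forms \<open>\<langle>e\<^bsup>t\<Delta>\<^esup>g, g\<rangle>\<close>, each nonnegative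
and decreasing in \<open>t\<close>. For such profiles Tonelli's theorem and the Beta integral
\<open>\<Gamma>(\<sigma>)\<Gamma>(1 - \<sigma>)\<close> show that integer and fractional powers of \<open>-\<Delta>\<close> lower the order of the Mellin
transform down to \<open>f(x)\<close> itself (\<open>frac_lap_inverts_pot\<close>).\<close>

section \<open>Square-summable functions\<close>

definition l2 :: "('a \<Rightarrow> real) set" where
  "l2 = {u. (\<lambda>x. (u x)\<^sup>2) summable_on UNIV}"

definition ip :: "('a \<Rightarrow> real) \<Rightarrow> ('a \<Rightarrow> real) \<Rightarrow> real" where
  "ip u v = (\<Sum>\<^sub>\<infinity>x. u x * v x)"

definition single :: "'a \<Rightarrow> 'a \<Rightarrow> real" where
  "single y = (\<lambda>z. if z = y then 1 else 0)"

lemma summable_on_abs_comparison: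
  fixes f g :: "'b \<Rightarrow> real"
  assumes "f summable_on A" "\<And>x. x \<in> A \<Longrightarrow> \<bar>g x\<bar> \<le> f x"
  shows "g summable_on A"
proof -
  have "(\<lambda>x. \<bar>g x\<bar>) summable_on A"
    by (rule summable_on_comparison_test[OF assms(1)]) (use assms in auto)
  then show ?thesis
    by (subst summable_on_iff_abs_summable_on_real) simp
qed

lemma summable_on_bounded_sums:
  fixes f :: "'b \<Rightarrow> real"
  assumes "\<And>F. finite F \<Longrightarrow> F \<subseteq> A \<Longrightarrow> sum f F \<le> B" "\<And>x. x \<in> A \<Longrightarrow> 0 \<le> f x"
  shows "f summable_on A" "infsum f A \<le> B"
proof -
  show s: "f summable_on A"
    using assms by (intro nonneg_bdd_above_summable_on bdd_aboveI2) auto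
  show "infsum f A \<le> B"
    using s assms by (intro infsum_le_finite_sums) auto
qed

lemma summable_on_sum:
  fixes f :: "'i \<Rightarrow> 'b \<Rightarrow> real"
  assumes "finite I" "\<And>i. i \<in> I \<Longrightarrow> f i summable_on A"
  shows "(\<lambda>x. \<Sum>i\<in>I. f i x) summable_on A" "infsum (\<lambda>x. \<Sum>i\<in>I. f i x) A = (\<Sum>i\<in>I. infsum (f i) A)"
proof -
  have "((\<lambda>x. \<Sum>i\<in>I. f i x) has_sum (\<Sum>i\<in>I. infsum (f i) A)) A"
    using assms
  proof (induction I)
    case (insert i I)
    then show ?case by (auto intro!: has_sum_add has_sum_infsum)
  qed auto
  then show "(\<lambda>x. \<Sum>i\<in>I. f i x) summable_on A" "infsum (\<lambda>x. \<Sum>i\<in>I. f i x) A = (\<Sum>i\<in>I. infsum (f i) A)"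
    by (auto simp: has_sum_imp_summable infsumI)
qed

lemma l2_mult_summable: "u \<in> l2 \<Longrightarrow> v \<in> l2 \<Longrightarrow> (\<lambda>x. u x * v x) summable_on UNIV"
proof -
  assume "u \<in> l2" "v \<in> l2"
  then have "(\<lambda>x. (u x)\<^sup>2 + (v x)\<^sup>2) summable_on UNIV"
    by (auto simp: l2_def intro: summable_on_add)
  then show ?thesis
  proof (rule summable_on_abs_comparison)
    fix x
    have "2 * \<bar>u x\<bar> * \<bar>v x\<bar> \<le> \<bar>u x\<bar>\<^sup>2 + \<bar>v x\<bar>\<^sup>2" by (rule sum_squares_bound)
    then show "\<bar>u x * v x\<bar> \<le> (u x)\<^sup>2 + (v x)\<^sup>2"
      using mult_nonneg_nonneg[OF abs_ge_zero abs_ge_zero, of "u x" "v x"]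
      unfolding abs_mult power2_abs by linarith
  qed
qed

lemma l2_square_summable: "u \<in> l2 \<Longrightarrow> (\<lambda>x. (u x)\<^sup>2) summable_on UNIV"
  by (simp add: l2_def)

lemma ip_self: "ip u u = (\<Sum>\<^sub>\<infinity>x. (u x)\<^sup>2)"
  by (simp add: ip_def power2_eq_square)

lemma ip_sym: "ip u v = ip v u"
  by (simp add: ip_def mult.commute)

lemma ip_nonneg: "0 \<le> ip u u"
  by (simp add: ip_self infsum_nonneg)

lemma l2_cmult: "u \<in> l2 \<Longrightarrow> (\<lambda>x. c * u x) \<in> l2"
  by (simp add: l2_def power_mult_distrib summable_on_cmult_right)

lemma l2_comparison: "u \<in> l2 \<Longrightarrow> (\<And>x. \<bar>v x\<bar> \<le> \<bar>u x\<bar>) \<Longrightarrow> v \<in> l2"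
  unfolding l2_def mem_Collect_eq
  by (erule summable_on_abs_comparison) (metis abs_le_square_iff abs_power2)

lemma l2_add: "u \<in> l2 \<Longrightarrow> v \<in> l2 \<Longrightarrow> (\<lambda>x. u x + v x) \<in> l2"
proof -
  assume a: "u \<in> l2" "v \<in> l2"
  have "(\<lambda>x. ((u x)\<^sup>2 + (v x)\<^sup>2) + 2 * (u x * v x)) summable_on UNIV"
    using a by (intro summable_on_add summable_on_cmult_right l2_mult_summable l2_square_summable) auto
  then show ?thesis by (simp add: l2_def power2_sum mult.assoc)
qed

lemma l2_diff: "u \<in> l2 \<Longrightarrow> v \<in> l2 \<Longrightarrow> (\<lambda>x. u x - v x) \<in> l2"
  using l2_add[OF _ l2_cmult[of v "-1"], of u] by simp

lemma l2_minus: "u \<in> l2 \<Longrightarrow> (\<lambda>x. - u x) \<in> l2"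
  using l2_cmult[of u "-1"] by simp

lemma l2_abs: "u \<in> l2 \<Longrightarrow> (\<lambda>x. \<bar>u x\<bar>) \<in> l2"
  by (erule l2_comparison) simp

lemma l2_finite_support: "finite {x. u x \<noteq> 0} \<Longrightarrow> u \<in> l2"
proof -
  assume "finite {x. u x \<noteq> 0}"
  then have "finite {x. (u x)\<^sup>2 \<noteq> 0}" by simp
  then show ?thesis unfolding l2_def
    by (auto intro: finite_nonzero_values_imp_summable_on)
qed

lemma l2_zero: "(\<lambda>x. 0) \<in> l2" by (simp add: l2_finite_support)

lemma l2_single [simp]: "single y \<in> l2"
  by (rule l2_finite_support) (simp add: single_def)

lemma l2_sum: "finite I \<Longrightarrow> (\<And>i. i \<in> I \<Longrightarrow> f i \<in> l2) \<Longrightarrow> (\<lambda>x. \<Sum>i\<in>I. f i x) \<in> l2"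
  by (induction I rule: finite_induct) (auto simp: l2_zero intro: l2_add)

lemma ip_add: "u \<in> l2 \<Longrightarrow> v \<in> l2 \<Longrightarrow> w \<in> l2 \<Longrightarrow> ip (\<lambda>x. u x + v x) w = ip u w + ip v w"
  unfolding ip_def by (simp add: distrib_right infsum_add l2_mult_summable)

lemma ip_add2: "u \<in> l2 \<Longrightarrow> v \<in> l2 \<Longrightarrow> w \<in> l2 \<Longrightarrow> ip w (\<lambda>x. u x + v x) = ip w u + ip w v"
  unfolding ip_def by (simp add: distrib_left infsum_add l2_mult_summable)

lemma ip_cmult: "ip (\<lambda>x. c * u x) w = c * ip u w"
  unfolding ip_def by (simp add: mult.assoc infsum_cmult_right')

lemma ip_cmult2: "ip w (\<lambda>x. c * u x) = c * ip w u"
  unfolding ip_def by (simp add: mult.left_commute infsum_cmult_right')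

lemma ip_minus: "ip (\<lambda>x. - u x) w = - ip u w"
  using ip_cmult[of "-1"] by simp

lemma ip_diff: "u \<in> l2 \<Longrightarrow> v \<in> l2 \<Longrightarrow> w \<in> l2 \<Longrightarrow> ip (\<lambda>x. u x - v x) w = ip u w - ip v w"
  using ip_add[of u "\<lambda>x. - v x" w] l2_minus[of v] by (simp add: ip_minus)

lemma ip_diff2: "u \<in> l2 \<Longrightarrow> v \<in> l2 \<Longrightarrow> w \<in> l2 \<Longrightarrow> ip w (\<lambda>x. u x - v x) = ip w u - ip w v"
  using ip_add2[of u "\<lambda>x. - v x" w] ip_cmult2[of w "-1" v] l2_minus[of v] by simp

lemma ip_sum:
  "finite I \<Longrightarrow> (\<And>i. i \<in> I \<Longrightarrow> f i \<in> l2) \<Longrightarrow> w \<in> l2 \<Longrightarrow> ip (\<lambda>x. \<Sum>i\<in>I. f i x) w = (\<Sum>i\<in>I. ip (f i) w)"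
proof (induction I rule: finite_induct)
  case empty
  then show ?case by (simp add: ip_def)
next
  case (insert i I)
  then show ?case using ip_add[of "f i" "\<lambda>x. \<Sum>i\<in>I. f i x" w] by (simp add: l2_sum)
qed

lemma ip_single [simp]: "ip u (single y) = u y"
proof -
  have "ip u (single y) = (\<Sum>\<^sub>\<infinity>x\<in>{y}. u x * single y x)"
    unfolding ip_def by (rule infsum_cong_neutral) (auto simp: single_def)
  then show ?thesis by (simp add: single_def)
qed

text \<open>The Cauchy-Schwarz inequality in additive form: optimising \<open>c\<close> would give the usual one. The free weight
avoids square roots and is chosen differently in each use.\<close>

lemma ip_scaled_bound:
  assumes "u \<in> l2" "v \<in> l2" "c > 0"
  shows "\<bar>ip u v\<bar> \<le> (c * ip u u + ip v v / c) / 2"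
proof -
  have e: "ip (\<lambda>x. c * u x + s * v x) (\<lambda>x. c * u x + s * v x) = c\<^sup>2 * ip u u + 2 * c * s * ip u v + s\<^sup>2 * ip v v" for s
    using assms
    by (simp add: ip_add ip_add2 l2_cmult ip_cmult ip_cmult2 l2_add ip_sym[of v u] power2_eq_square algebra_simps)
  have "0 \<le> c\<^sup>2 * ip u u + 2 * c * ip u v + ip v v" "0 \<le> c\<^sup>2 * ip u u - 2 * c * ip u v + ip v v"
    using e[of 1] e[of "-1"] ip_nonneg[of "\<lambda>x. c * u x + 1 * v x"] ip_nonneg[of "\<lambda>x. c * u x + (-1) * v x"]
    by auto
  then have "2 * c * \<bar>ip u v\<bar> \<le> c\<^sup>2 * ip u u + ip v v" by (auto simp: abs_if)
  then show ?thesis using \<open>c > 0\<close> by (simp add: field_simps power2_eq_square)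
qed

lemma l2_shift: "(u :: 'a::group_add \<Rightarrow> real) \<in> l2 \<Longrightarrow> (\<lambda>x. u (x + y)) \<in> l2"
proof -
  assume "u \<in> l2"
  have b: "bij_betw (\<lambda>x. x + y) UNIV UNIV"
    by (rule bij_betwI[where g = "\<lambda>x. x - y"]) auto
  show ?thesis using \<open>u \<in> l2\<close> summable_on_reindex_bij_betw[OF b, of "\<lambda>x. (u x)\<^sup>2"] by (simp add: l2_def)
qed

lemma ip_shift: "ip (\<lambda>x. u (x + y)) (\<lambda>x. v (x + y)) = ip u v" for y :: "'a::group_add"
proof -
  have b: "bij_betw (\<lambda>x. x + y) UNIV UNIV"
    by (rule bij_betwI[where g = "\<lambda>x. x - y"]) auto
  show ?thesis using infsum_reindex_bij_betw[OF b, of "\<lambda>x. u x * v x"] by (simp add: ip_def)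
qed

lemma ip_shift_left: "ip (\<lambda>x. u (x + y)) v = ip u (\<lambda>x. v (x - y))" for y :: "'a::group_add"
  using ip_shift[of u y "\<lambda>x. v (x - y)"] by simp

lemma l2_sq_le: "u \<in> l2 \<Longrightarrow> (u x)\<^sup>2 \<le> ip u u"
  unfolding ip_self using finite_sum_le_infsum[of "\<lambda>x. (u x)\<^sup>2" UNIV "{x}"] by (simp add: l2_def)

section \<open>The Laplacian of a Cayley graph\<close>

locale cayley =
  fixes S :: "'a::group_add set"
  assumes finite_S: "finite S" and sym_S: "uminus ` S = S"
begin

lemma neighbours: "{y. adj S x y} = (\<lambda>s. x + s) ` S"
proof -
  have "y \<in> (\<lambda>s. x + s) ` S" if "- x + y \<in> S" for y
    using that by (intro image_eqI[where x = "- x + y"]) (auto simp: add.assoc[symmetric])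
  then show ?thesis by (auto simp: adj_def add.assoc[symmetric])
qed

lemma sum_neighbours: "(\<Sum>y | adj S x y. f y) = (\<Sum>s\<in>S. f (x + s))"
  unfolding neighbours by (subst sum.reindex) (auto simp: inj_on_def)

lemma lap_eq: "lap S u x = (\<Sum>s\<in>S. u (x + s) - u x)"
  unfolding lap_def sum_neighbours ..

lemma lap_eq': "lap S u = (\<lambda>x. (\<Sum>s\<in>S. u (x + s)) - real (card S) * u x)"
  by (rule ext) (simp add: lap_eq sum_subtractf)

lemma grad_prod_eq: "grad_prod S u v x = 1/2 * (\<Sum>s\<in>S. (u (x + s) - u x) * (v (x + s) - v x))"
  unfolding grad_prod_def sum_neighbours ..

lemma grad_prod_nonneg: "0 \<le> grad_prod S u u x"
  unfolding grad_prod_eq by (simp add: sum_nonneg)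

lemma sum_S_uminus: "(\<Sum>s\<in>S. f (- s)) = (\<Sum>s\<in>S. f s)"
  using sum.reindex[of uminus S f] sym_S by simp

lemma lap_l2: "u \<in> l2 \<Longrightarrow> lap S u \<in> l2"
  unfolding lap_eq' by (intro l2_diff l2_sum l2_cmult l2_shift finite_S)

lemma ip_lap_sym:
  assumes "u \<in> l2" "v \<in> l2"
  shows "ip (lap S u) v = ip u (lap S v)"
proof -
  have 1: "ip (lap S w) z = (\<Sum>s\<in>S. ip (\<lambda>x. w (x + s)) z) - real (card S) * ip w z" if "w \<in> l2" "z \<in> l2" for w z
    unfolding lap_eq' using that by (simp add: ip_diff ip_sum ip_cmult l2_sum l2_cmult l2_shift finite_S)
  have "(\<Sum>s\<in>S. ip (\<lambda>x. u (x + s)) v) = (\<Sum>s\<in>S. ip u (\<lambda>x. v (x + s)))"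
    using sum_S_uminus[of "\<lambda>s. ip u (\<lambda>x. v (x + s))"] by (simp add: ip_shift_left)
  then show ?thesis using 1[OF assms] 1[OF assms(2,1)] by (simp add: ip_sym)
qed

lemma summable_grad: "u \<in> l2 \<Longrightarrow> v \<in> l2 \<Longrightarrow> grad_prod S u v summable_on UNIV"
proof -
  assume "u \<in> l2" "v \<in> l2"
  then have "(\<lambda>x. 1/2 * (\<Sum>s\<in>S. (u (x + s) - u x) * (v (x + s) - v x))) summable_on UNIV"
    by (intro summable_on_cmult_right summable_on_sum l2_mult_summable l2_diff l2_shift finite_S)
  then show ?thesis by (simp add: grad_prod_eq[abs_def])
qed

lemma infsum_grad_shifts:
  assumes "u \<in> l2" "v \<in> l2"
  shows "(\<Sum>\<^sub>\<infinity>x. grad_prod S u v x) = 1/2 * (\<Sum>s\<in>S. ip (\<lambda>x. u (x + s) - u x) (\<lambda>x. v (x + s) - v x))"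
  unfolding grad_prod_eq ip_def infsum_cmult_right'
  using assms
  by (subst summable_on_sum) (auto intro!: l2_mult_summable l2_diff l2_shift finite_S)

text \<open>Summation by parts. The sums can be reordered by right translations alone, because the gradient at \<open>x\<close>
is a sum over the finitely many \<open>s \<in> S\<close> and translation preserves the inner product.\<close>

lemma infsum_grad:
  assumes "u \<in> l2" "v \<in> l2"
  shows "(\<Sum>\<^sub>\<infinity>x. grad_prod S u v x) = - ip (lap S u) v"
proof -
  have 1: "ip (lap S w) z = (\<Sum>s\<in>S. ip (\<lambda>x. w (x + s)) z - ip w z)" if "w \<in> l2" "z \<in> l2" for w z
    unfolding lap_eq' using that
    by (simp add: ip_diff ip_sum ip_cmult l2_sum l2_cmult l2_shift finite_S sum_subtractf)
  have "ip (\<lambda>x. u (x + s) - u x) (\<lambda>x. v (x + s) - v x)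
     = - (ip (\<lambda>x. u (x + s)) v - ip u v) - (ip (\<lambda>x. v (x + s)) u - ip v u)" for s
    using assms by (simp add: ip_diff ip_diff2 l2_diff l2_shift ip_shift ip_sym[of v u] ip_sym[of _ u])
  then have "(\<Sum>\<^sub>\<infinity>x. grad_prod S u v x) = 1/2 * (- ip (lap S u) v - ip (lap S v) u)"
    using assms by (simp add: infsum_grad_shifts 1 sum_subtractf sum_negf)
  also have "ip (lap S v) u = ip (lap S u) v"
    using assms by (metis ip_sym ip_lap_sym)
  finally show ?thesis by simp
qed

lemma ip_lap_nonpos: "u \<in> l2 \<Longrightarrow> ip (lap S u) u \<le> 0"
  using infsum_grad[of u u] infsum_nonneg[of UNIV "grad_prod S u u"] by (simp add: grad_prod_nonneg)

lemma ip_lap_lap_le: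
  assumes "u \<in> l2"
  shows "ip (lap S u) (lap S u) \<le> (2 * real (card S))\<^sup>2 * ip u u"
proof -
  let ?D = "real (card S)"
  have pt: "(lap S u x)\<^sup>2 \<le> ?D * (\<Sum>s\<in>S. 2 * (u (x + s))\<^sup>2 + 2 * (u x)\<^sup>2)" for x
  proof -
    have "(lap S u x)\<^sup>2 \<le> ?D * (\<Sum>s\<in>S. (u (x + s) - u x)\<^sup>2)"
      unfolding lap_eq using sum_squared_le_sum_of_squares[of "\<lambda>s. u (x + s) - u x" S] by (simp add: mult.commute)
    also have "\<dots> \<le> ?D * (\<Sum>s\<in>S. 2 * (u (x + s))\<^sup>2 + 2 * (u x)\<^sup>2)"
    proof (intro mult_left_mono sum_mono)
      fix s
      have "0 \<le> (u (x + s) + u x)\<^sup>2" by simp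
      then show "(u (x + s) - u x)\<^sup>2 \<le> 2 * (u (x + s))\<^sup>2 + 2 * (u x)\<^sup>2"
        by (simp add: power2_sum power2_diff)
    qed simp
    finally show ?thesis .
  qed
  have sm: "(\<lambda>x. 2 * (u (x + s))\<^sup>2 + 2 * (u x)\<^sup>2) summable_on UNIV" for s
    using l2_shift[OF assms, of s] assms
    by (intro summable_on_add summable_on_cmult_right) (auto simp: l2_def)
  have "ip (lap S u) (lap S u) \<le> (\<Sum>\<^sub>\<infinity>x. ?D * (\<Sum>s\<in>S. 2 * (u (x + s))\<^sup>2 + 2 * (u x)\<^sup>2))"
    unfolding ip_self
    using lap_l2[OF assms]
    by (intro infsum_mono pt summable_on_cmult_right summable_on_sum sm finite_S) (simp add: l2_def)
  also have "\<dots> = ?D * (\<Sum>s\<in>S. \<Sum>\<^sub>\<infinity>x. 2 * (u (x + s))\<^sup>2 + 2 * (u x)\<^sup>2)"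
    by (simp add: infsum_cmult_right' summable_on_sum(2)[OF finite_S sm])
  also have "(\<lambda>s. \<Sum>\<^sub>\<infinity>x. 2 * (u (x + s))\<^sup>2 + 2 * (u x)\<^sup>2) = (\<lambda>_. 4 * ip u u)"
  proof
    fix s
    have "(\<Sum>\<^sub>\<infinity>x. 2 * (u (x + s))\<^sup>2 + 2 * (u x)\<^sup>2) = 2 * ip (\<lambda>x. u (x + s)) (\<lambda>x. u (x + s)) + 2 * ip u u"
      unfolding ip_self using l2_shift[OF assms, of s] assms
      by (subst infsum_add) (auto simp: l2_def infsum_cmult_right' intro!: summable_on_cmult_right)
    then show "(\<Sum>\<^sub>\<infinity>x. 2 * (u (x + s))\<^sup>2 + 2 * (u x)\<^sup>2) = 4 * ip u u" by (simp add: ip_shift)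
  qed
  finally show ?thesis by (simp add: power2_eq_square algebra_simps)
qed

end

section \<open>Exponential series\<close>

text \<open>The exponential generating function of \<open>b\<close>. With \<open>b n = (\<Delta>\<^sup>n u)(x)\<close> it is \<open>e\<^bsup>t\<Delta>\<^esup>u(x)\<close>, with
\<open>b n = \<langle>\<Delta>\<^sup>n u, v\<rangle>\<close> it is \<open>\<langle>e\<^bsup>t\<Delta>\<^esup>u, v\<rangle>\<close>; boundedness of \<open>\<Delta>\<close> makes both sequences grow at most geometrically.\<close>

definition egf :: "(nat \<Rightarrow> real) \<Rightarrow> real \<Rightarrow> real" where
  "egf b t = (\<Sum>n. t ^ n / fact n * b n)"

definition geom_bounded :: "(nat \<Rightarrow> real) \<Rightarrow> real \<Rightarrow> real \<Rightarrow> bool" where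
  "geom_bounded b c q \<longleftrightarrow> 0 \<le> q \<and> (\<forall>n. \<bar>b n\<bar> \<le> c * q ^ n)"

lemma egf_majorant_sums: "(\<lambda>n. c * ((t * q) ^ n / fact n)) sums (c * exp (t * q))" for t :: real
  using exp_converges[of "t * q"] by (intro sums_mult) (simp add: scaleR_conv_of_real field_simps)

lemma egf_term_le:
  assumes "geom_bounded b c q"
  shows "\<bar>t ^ n / fact n * b n\<bar> \<le> c * ((\<bar>t\<bar> * q) ^ n / fact n)"
proof -
  have "\<bar>t ^ n / fact n * b n\<bar> = \<bar>t\<bar> ^ n / fact n * \<bar>b n\<bar>"
    by (simp add: abs_mult power_abs)
  also have "\<dots> \<le> \<bar>t\<bar> ^ n / fact n * (c * q ^ n)"
    using assms by (intro mult_left_mono) (auto simp: geom_bounded_def)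
  finally show ?thesis by (simp add: power_mult_distrib mult_ac)
qed

lemma egf_abs_summable:
  assumes "geom_bounded b c q"
  shows "summable (\<lambda>n. \<bar>t ^ n / fact n * b n\<bar>)"
  by (rule summable_comparison_test'[OF sums_summable[OF egf_majorant_sums[of c "\<bar>t\<bar>" q]], of 0])
     (use egf_term_le[OF assms] in auto)

lemma egf_summable:
  assumes "geom_bounded b c q"
  shows "summable (\<lambda>n. t ^ n / fact n * b n)"
  using egf_abs_summable[OF assms] by (rule summable_rabs_cancel)

lemma egf_le:
  assumes "geom_bounded b c q"
  shows "\<bar>egf b t\<bar> \<le> c * exp (\<bar>t\<bar> * q)"
proof -
  have "\<bar>egf b t\<bar> \<le> (\<Sum>n. \<bar>t ^ n / fact n * b n\<bar>)"
    unfolding egf_def by (rule summable_rabs[OF egf_abs_summable[OF assms]])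
  also have "\<dots> \<le> (\<Sum>n. c * ((\<bar>t\<bar> * q) ^ n / fact n))"
    by (intro suminf_le egf_term_le[OF assms] egf_abs_summable[OF assms] sums_summable[OF egf_majorant_sums])
  finally show ?thesis using sums_unique[OF egf_majorant_sums[of c "\<bar>t\<bar>" q]] by simp
qed

lemma egf_add:
  assumes "geom_bounded b c q" "geom_bounded b' c' q'"
  shows "egf (\<lambda>n. b n + b' n) t = egf b t + egf b' t"
  unfolding egf_def using suminf_add[OF egf_summable[OF assms(1)] egf_summable[OF assms(2)], of t t]
  by (simp add: distrib_left)

lemma egf_cmult:
  assumes "geom_bounded b c q"
  shows "egf (\<lambda>n. d * b n) t = d * egf b t"
  unfolding egf_def using suminf_mult[OF egf_summable[OF assms], of d t]
  by (simp add: mult.left_commute)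

lemma egf_diff:
  assumes "geom_bounded b c q" "geom_bounded b' c' q'"
  shows "egf (\<lambda>n. b n - b' n) t = egf b t - egf b' t"
  unfolding egf_def using suminf_diff[OF egf_summable[OF assms(1)] egf_summable[OF assms(2)], of t t]
  by (simp add: right_diff_distrib)

lemma egf_sum:
  assumes "finite I" "\<And>i. i \<in> I \<Longrightarrow> geom_bounded (b i) (c i) (q i)"
  shows "egf (\<lambda>n. \<Sum>i\<in>I. b i n) t = (\<Sum>i\<in>I. egf (b i) t)"
  unfolding egf_def sum_distrib_left
  by (rule suminf_sum) (rule egf_summable[OF assms(2)])

lemma egf_zero [simp]: "egf b 0 = b 0"
  unfolding egf_def using powser_zero[of "\<lambda>n. b n / fact n"] by (simp add: mult.commute)

lemma geom_bounded_shift: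
  assumes "geom_bounded b c q"
  shows "geom_bounded (\<lambda>n. b (n + m)) (c * q ^ m) q"
  using assms unfolding geom_bounded_def by (metis mult.assoc mult.commute power_add)

lemma egf_deriv:
  assumes "geom_bounded b c q"
  shows "(egf b has_real_derivative egf (\<lambda>n. b (Suc n)) t) (at t)"
proof -
  have "((\<lambda>x. \<Sum>n. b n / fact n * x ^ n) has_real_derivative (\<Sum>n. diffs (\<lambda>n. b n / fact n) n * t ^ n)) (at t)"
    using egf_summable[OF assms] by (intro termdiffs_strong_converges_everywhere) (simp add: mult.commute)
  moreover have "(\<lambda>x. \<Sum>n. b n / fact n * x ^ n) = egf b"
    by (auto simp: egf_def mult.commute)
  moreover have "diffs (\<lambda>n. b n / fact n) n * t ^ n = t ^ n / fact n * b (Suc n)" for n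
    by (simp add: diffs_def field_simps del: of_nat_Suc)
  ultimately show ?thesis by (simp add: egf_def)
qed

text \<open>Uniqueness of the Taylor series: when the derivatives grow at most geometrically, the Lagrange remainder tends to
zero. Identities between exponentials are proved below by exhibiting both sides as functions with
the same derivatives at \<open>0\<close>, which avoids multiplying power series.\<close>

lemma entire_eq_egf:
  fixes F :: "nat \<Rightarrow> real \<Rightarrow> real"
  assumes der: "\<And>m t. (F m has_real_derivative F (Suc m) t) (at t)"
    and bd: "\<And>m t. \<bar>t\<bar> \<le> \<bar>x\<bar> \<Longrightarrow> \<bar>F m t\<bar> \<le> C * q ^ m"
  shows "F 0 x = egf (\<lambda>m. F m 0) x"
proof -
  have "\<exists>t. \<bar>t\<bar> \<le> \<bar>x\<bar> \<and> F 0 x = (\<Sum>m<n. F m 0 / fact m * x ^ m) + F n t / fact n * x ^ n" for n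
    by (rule Maclaurin_all_le) (use der in auto)
  then obtain \<xi> where \<xi>: "\<And>n. \<bar>\<xi> n\<bar> \<le> \<bar>x\<bar>"
     "\<And>n. F 0 x = (\<Sum>m<n. F m 0 / fact m * x ^ m) + F n (\<xi> n) / fact n * x ^ n" by metis
  have "(\<lambda>n. C * ((\<bar>x\<bar> * q) ^ n / fact n)) \<longlonglongrightarrow> 0"
    by (rule summable_LIMSEQ_zero[OF sums_summable[OF egf_majorant_sums]])
  then have "(\<lambda>n. F n (\<xi> n) / fact n * x ^ n) \<longlonglongrightarrow> 0"
  proof (rule Lim_null_comparison[rotated], intro always_eventually allI)
    fix n
    have "norm (F n (\<xi> n) / fact n * x ^ n) = \<bar>F n (\<xi> n)\<bar> * (\<bar>x\<bar> ^ n / fact n)"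
      by (simp add: abs_mult power_abs)
    also have "\<dots> \<le> (C * q ^ n) * (\<bar>x\<bar> ^ n / fact n)"
      by (intro mult_right_mono bd \<xi>) auto
    finally show "norm (F n (\<xi> n) / fact n * x ^ n) \<le> C * ((\<bar>x\<bar> * q) ^ n / fact n)"
      by (simp add: power_mult_distrib mult_ac)
  qed
  then have "(\<lambda>n. F 0 x - F n (\<xi> n) / fact n * x ^ n) \<longlonglongrightarrow> F 0 x - 0"
    by (intro tendsto_intros)
  also have "(\<lambda>n. F 0 x - F n (\<xi> n) / fact n * x ^ n) = (\<lambda>n. \<Sum>m<n. F m 0 / fact m * x ^ m)"
    using \<xi>(2) by (metis add_diff_cancel_right')
  finally have "(\<lambda>m. F m 0 / fact m * x ^ m) sums F 0 x" by (simp add: sums_def)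
  then have "(\<lambda>m. x ^ m / fact m * F m 0) sums F 0 x" by (simp add: mult.commute)
  then show ?thesis unfolding egf_def by (simp add: sums_unique)
qed

text \<open>The law \<open>e\<^bsup>(s+t)\<Delta>\<^esup> = e\<^bsup>s\<Delta>\<^esup>e\<^bsup>t\<Delta>\<^esup>\<close> on the level of coefficients: the left side is a function of \<open>s\<close> whose
\<open>m\<close>-th derivative at \<open>0\<close> is the series of the sequence shifted by \<open>m\<close>.\<close>

lemma egf_plus:
  assumes b: "geom_bounded b c q"
  shows "egf b (s + t) = egf (\<lambda>m. egf (\<lambda>n. b (n + m)) t) s"
proof -
  define F where "F m r = egf (\<lambda>n. b (n + m)) (r + t)" for m r
  have "F 0 s = egf (\<lambda>m. F m 0) s"
  proof (rule entire_eq_egf)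
    fix m r
    have "((\<lambda>r. egf (\<lambda>n. b (n + m)) (r + t)) has_real_derivative egf (\<lambda>n. b (Suc n + m)) (r + t)) (at r)"
      using DERIV_shift[of "egf (\<lambda>n. b (n + m))" _ r t] egf_deriv[OF geom_bounded_shift[OF b, of m], of "r + t"]
      by simp
    then show "(F m has_real_derivative F (Suc m) r) (at r)"
      by (simp add: F_def[abs_def])
  next
    fix m r assume r: "\<bar>r\<bar> \<le> \<bar>s\<bar>"
    have q: "0 \<le> q" and c: "0 \<le> c" using b unfolding geom_bounded_def by (auto dest: spec[of _ 0])
    have "\<bar>F m r\<bar> \<le> c * q ^ m * exp (\<bar>r + t\<bar> * q)"
      unfolding F_def by (rule egf_le[OF geom_bounded_shift[OF b]])
    also have "\<dots> \<le> c * q ^ m * exp ((\<bar>s\<bar> + \<bar>t\<bar>) * q)"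
      using r q c by (intro mult_left_mono) (auto intro!: mult_right_mono)
    finally show "\<bar>F m r\<bar> \<le> (c * exp ((\<bar>s\<bar> + \<bar>t\<bar>) * q)) * q ^ m" by (simp add: mult_ac)
  qed
  then show ?thesis by (simp add: F_def)
qed

section \<open>The heat semigroup on bounded functions\<close>

definition bdd_fun :: "('a \<Rightarrow> real) \<Rightarrow> bool" where
  "bdd_fun u \<longleftrightarrow> (\<exists>M. \<forall>x. \<bar>u x\<bar> \<le> M)"

lemma l2_bdd: "u \<in> l2 \<Longrightarrow> bdd_fun u"
  unfolding bdd_fun_def
proof (intro exI allI)
  fix x assume "u \<in> l2"
  then have "\<bar>u x\<bar>\<^sup>2 \<le> ip u u" using l2_sq_le[of u x] by simp
  moreover have "2 * \<bar>u x\<bar> \<le> \<bar>u x\<bar>\<^sup>2 + 1" using sum_squares_bound[of "\<bar>u x\<bar>" 1] by simp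
  ultimately show "\<bar>u x\<bar> \<le> 1 + ip u u" by linarith
qed

context cayley
begin

definition deg :: real where "deg = real (card S)"

lemma deg_nonneg: "0 \<le> deg" by (simp add: deg_def)

definition nbr_sum :: "('a \<Rightarrow> real) \<Rightarrow> 'a \<Rightarrow> real" where
  "nbr_sum u x = (\<Sum>s\<in>S. u (x + s))"

lemma lap_nbr: "lap S u x = nbr_sum u x - deg * u x"
  by (simp add: lap_eq' nbr_sum_def deg_def)

lemma nbr_pow_bound: "(\<And>x. \<bar>u x\<bar> \<le> M) \<Longrightarrow> \<bar>(nbr_sum ^^ n) u x\<bar> \<le> M * deg ^ n"
proof (induction n arbitrary: x)
  case (Suc n)
  have "\<bar>(nbr_sum ^^ Suc n) u x\<bar> \<le> (\<Sum>s\<in>S. \<bar>(nbr_sum ^^ n) u (x + s)\<bar>)"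
    by (simp add: nbr_sum_def)
  also have "\<dots> \<le> (\<Sum>s\<in>S. M * deg ^ n)" using Suc by (intro sum_mono) auto
  finally show ?case by (simp add: deg_def mult_ac)
qed simp

lemma lap_pow_bound: "(\<And>x. \<bar>u x\<bar> \<le> M) \<Longrightarrow> \<bar>(lap S ^^ n) u x\<bar> \<le> M * (2 * deg) ^ n"
proof (induction n arbitrary: x)
  case (Suc n)
  have "\<bar>(lap S ^^ Suc n) u x\<bar> \<le> (\<Sum>s\<in>S. \<bar>(lap S ^^ n) u (x + s) - (lap S ^^ n) u x\<bar>)"
    by (simp add: lap_eq)
  also have "\<dots> \<le> (\<Sum>s\<in>S. 2 * (M * (2 * deg) ^ n))"
  proof (intro sum_mono)
    fix s
    show "\<bar>(lap S ^^ n) u (x + s) - (lap S ^^ n) u x\<bar> \<le> 2 * (M * (2 * deg) ^ n)"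
      using Suc.IH[of x, OF Suc.prems] Suc.IH[of "x + s", OF Suc.prems] abs_triangle_ineq4[of "(lap S ^^ n) u (x + s)" "(lap S ^^ n) u x"]
      by linarith
  qed
  finally show ?case by (simp add: deg_def mult_ac)
qed simp

lemma lap_pow_geom: "(\<And>x. \<bar>u x\<bar> \<le> M) \<Longrightarrow> geom_bounded (\<lambda>n. (lap S ^^ n) u x) M (2 * deg)"
  unfolding geom_bounded_def using lap_pow_bound[of u M] deg_nonneg by auto

lemma nbr_pow_geom: "(\<And>x. \<bar>u x\<bar> \<le> M) \<Longrightarrow> geom_bounded (\<lambda>n. (nbr_sum ^^ n) u x) M deg"
  unfolding geom_bounded_def using nbr_pow_bound[of u M] deg_nonneg by auto

lemma lap_pow_geom': "bdd_fun u \<Longrightarrow> \<exists>M. \<forall>x. geom_bounded (\<lambda>n. (lap S ^^ n) u x) M (2 * deg)"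
  unfolding bdd_fun_def using lap_pow_geom by blast

lemma bdd_lap_pow: "bdd_fun u \<Longrightarrow> bdd_fun ((lap S ^^ n) u)"
  unfolding bdd_fun_def by (meson lap_pow_bound)

lemma heat_egf: "heat S t u x = egf (\<lambda>n. (lap S ^^ n) u x) t"
  by (simp add: heat_def egf_def)

lemma heat_0 [simp]: "heat S 0 u x = u x"
  by (simp add: heat_egf)

lemma heat_deriv:
  assumes "bdd_fun u"
  shows "((\<lambda>t. heat S t u x) has_real_derivative heat S t (lap S u) x) (at t)"
proof -
  obtain M where "geom_bounded (\<lambda>n. (lap S ^^ n) u x) M (2 * deg)" using lap_pow_geom'[OF assms] by blast
  from egf_deriv[OF this, of t] show ?thesis
    unfolding heat_egf by (simp add: funpow_swap1)
qed

lemma heat_bdd_raw: "(\<And>x. \<bar>u x\<bar> \<le> M) \<Longrightarrow> \<bar>heat S t u x\<bar> \<le> M * exp (\<bar>t\<bar> * (2 * deg))"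
  unfolding heat_egf by (intro egf_le lap_pow_geom)

lemma bdd_heat: "bdd_fun u \<Longrightarrow> bdd_fun (heat S t u)"
  unfolding bdd_fun_def by (meson heat_bdd_raw)

lemma lap_heat:
  assumes "bdd_fun u"
  shows "lap S (heat S t u) = heat S t (lap S u)"
proof
  fix x
  obtain M where M: "\<And>x. geom_bounded (\<lambda>n. (lap S ^^ n) u x) M (2 * deg)" using lap_pow_geom'[OF assms] by blast
  have g: "geom_bounded (\<lambda>n. (lap S ^^ n) u y - (lap S ^^ n) u x) (2 * M) (2 * deg)" for y
    unfolding geom_bounded_def
  proof (intro conjI allI)
    fix n
    have "\<bar>(lap S ^^ n) u y\<bar> \<le> M * (2 * deg) ^ n" "\<bar>(lap S ^^ n) u x\<bar> \<le> M * (2 * deg) ^ n"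
      using M[of y] M[of x] unfolding geom_bounded_def by blast+
    then show "\<bar>(lap S ^^ n) u y - (lap S ^^ n) u x\<bar> \<le> 2 * M * (2 * deg) ^ n"
      using abs_triangle_ineq4[of "(lap S ^^ n) u y" "(lap S ^^ n) u x"] unfolding mult.assoc[of 2 M] by linarith
  qed (simp add: deg_nonneg)
  have "lap S (heat S t u) x = (\<Sum>s\<in>S. egf (\<lambda>n. (lap S ^^ n) u (x + s) - (lap S ^^ n) u x) t)"
    by (simp add: lap_eq heat_egf egf_diff[OF M M])
  also have "\<dots> = egf (\<lambda>n. \<Sum>s\<in>S. (lap S ^^ n) u (x + s) - (lap S ^^ n) u x) t"
    by (rule egf_sum[symmetric, OF finite_S g])
  also have "\<dots> = heat S t (lap S u) x"
    by (simp add: heat_egf lap_eq[symmetric] funpow_swap1)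
  finally show "lap S (heat S t u) x = heat S t (lap S u) x" .
qed

lemma lap_pow_heat: "bdd_fun u \<Longrightarrow> (lap S ^^ n) (heat S t u) = heat S t ((lap S ^^ n) u)"
  by (induction n) (simp_all add: lap_heat bdd_lap_pow)

lemma heat_semigroup:
  assumes "bdd_fun u"
  shows "heat S s (heat S t u) = heat S (s + t) u"
proof
  fix x
  obtain M where M: "\<And>x. geom_bounded (\<lambda>n. (lap S ^^ n) u x) M (2 * deg)" using lap_pow_geom'[OF assms] by blast
  have "heat S s (heat S t u) x = egf (\<lambda>m. egf (\<lambda>n. (lap S ^^ (n + m)) u x) t) s"
    unfolding heat_egf[of s] lap_pow_heat[OF assms] by (simp add: heat_egf funpow_add)
  also have "\<dots> = heat S (s + t) u x"
    unfolding heat_egf by (rule egf_plus[OF M, symmetric])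
  finally show "heat S s (heat S t u) x = heat S (s + t) u x" .
qed

lemma nbr_pow_lap: "(nbr_sum ^^ n) (lap S v) x = (nbr_sum ^^ Suc n) v x - deg * (nbr_sum ^^ n) v x"
proof (induction n arbitrary: x)
  case (Suc n)
  have "(nbr_sum ^^ Suc n) (lap S v) x = (\<Sum>s\<in>S. (nbr_sum ^^ n) (lap S v) (x + s))"
    by (simp add: nbr_sum_def)
  also have "\<dots> = (\<Sum>s\<in>S. (nbr_sum ^^ Suc n) v (x + s)) - deg * (\<Sum>s\<in>S. (nbr_sum ^^ n) v (x + s))"
    by (simp only: Suc sum_subtractf sum_distrib_left)
  also have "\<dots> = (nbr_sum ^^ Suc (Suc n)) v x - deg * (nbr_sum ^^ Suc n) v x"
    by (simp only: funpow.simps o_apply nbr_sum_def[of "(nbr_sum ^^ Suc n) v"] nbr_sum_def[of "(nbr_sum ^^ n) v" x]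
        nbr_sum_def[of "nbr_sum ((nbr_sum ^^ n) v)"])
  finally show ?case .
qed (simp add: lap_nbr)

text \<open>With \<open>A\<close> the sum over neighbours, \<open>\<Delta> = A - deg\<close>, so \<open>e\<^bsup>t\<Delta>\<^esup> = e\<^bsup>-deg t\<^esup>e\<^bsup>tA\<^esup>\<close>. In this form positivity of
the semigroup is visible, since \<open>A\<close> has nonnegative coefficients.\<close>

lemma heat_nbr:
  assumes "bdd_fun u"
  shows "heat S t u x = exp (- deg * t) * egf (\<lambda>n. (nbr_sum ^^ n) u x) t"
proof -
  obtain M where M: "\<And>x. \<bar>u x\<bar> \<le> M" using assms unfolding bdd_fun_def by blast
  \<comment> \<open>\<open>F m\<close> is the right side for \<open>\<Delta>\<^sup>m u\<close>; it satisfies \<open>F m' = F (m + 1)\<close> and \<open>F m 0 = (\<Delta>\<^sup>m u)(x)\<close>.\<close>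
  define F where "F m r = exp (- deg * r) * egf (\<lambda>n. (nbr_sum ^^ n) ((lap S ^^ m) u) x) r" for m r
  have G: "geom_bounded (\<lambda>n. (nbr_sum ^^ n) ((lap S ^^ m) u) x) (M * (2 * deg) ^ m) deg" for m
    by (intro nbr_pow_geom lap_pow_bound M)
  have "F 0 t = egf (\<lambda>m. F m 0) t"
  proof (rule entire_eq_egf)
    fix m r
    let ?v = "(lap S ^^ m) u"
    have G': "geom_bounded (\<lambda>n. (nbr_sum ^^ (Suc n)) ?v x) (M * (2 * deg) ^ m * deg) deg"
      using geom_bounded_shift[OF G[of m], of 1] by simp
    have G'': "geom_bounded (\<lambda>n. deg * (nbr_sum ^^ n) ?v x) (deg * (M * (2 * deg) ^ m)) deg"
      using G[of m] deg_nonneg unfolding geom_bounded_def by (auto simp: abs_mult mult.assoc intro!: mult_left_mono)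
    have "egf (\<lambda>n. (nbr_sum ^^ n) ((lap S ^^ Suc m) u) x) r
       = egf (\<lambda>n. (nbr_sum ^^ (Suc n)) ?v x) r - deg * egf (\<lambda>n. (nbr_sum ^^ n) ?v x) r"
      using egf_diff[OF G' G'', of r] by (simp only: nbr_pow_lap egf_cmult[OF G] funpow.simps o_apply)
    moreover have "(F m has_real_derivative
        exp (- deg * r) * egf (\<lambda>n. (nbr_sum ^^ (Suc n)) ?v x) r - deg * exp (- deg * r) * egf (\<lambda>n. (nbr_sum ^^ n) ?v x) r) (at r)"
      unfolding F_def by (rule derivative_eq_intros egf_deriv[OF G] refl | simp)+
    ultimately show "(F m has_real_derivative F (Suc m) r) (at r)"
      unfolding F_def[of "Suc m"] by (simp only: right_diff_distrib mult.assoc mult.left_commute)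
  next
    fix m r assume r: "\<bar>r\<bar> \<le> \<bar>t\<bar>"
    have M0: "0 \<le> M" using M[of x] by linarith
    have rt: "\<bar>r\<bar> * deg \<le> \<bar>t\<bar> * deg" using r deg_nonneg by (rule mult_right_mono)
    have "\<bar>F m r\<bar> = exp (- deg * r) * \<bar>egf (\<lambda>n. (nbr_sum ^^ n) ((lap S ^^ m) u) x) r\<bar>"
      by (simp add: F_def abs_mult)
    also have "\<dots> \<le> exp (\<bar>t\<bar> * deg) * (M * (2 * deg) ^ m * exp (\<bar>t\<bar> * deg))"
    proof (intro mult_mono)
      have "- (deg * r) \<le> \<bar>r\<bar> * deg" using mult_right_mono[OF abs_ge_minus_self deg_nonneg, of r] by (simp add: mult.commute)
      then show "exp (- deg * r) \<le> exp (\<bar>t\<bar> * deg)" using rt by simp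
      have "\<bar>egf (\<lambda>n. (nbr_sum ^^ n) ((lap S ^^ m) u) x) r\<bar> \<le> M * (2 * deg) ^ m * exp (\<bar>r\<bar> * deg)"
        by (rule egf_le[OF G])
      also have "\<dots> \<le> M * (2 * deg) ^ m * exp (\<bar>t\<bar> * deg)"
        using rt M0 deg_nonneg by (intro mult_left_mono) auto
      finally show "\<bar>egf (\<lambda>n. (nbr_sum ^^ n) ((lap S ^^ m) u) x) r\<bar> \<le> M * (2 * deg) ^ m * exp (\<bar>t\<bar> * deg)" .
    qed auto
    finally show "\<bar>F m r\<bar> \<le> (exp (\<bar>t\<bar> * deg) * M * exp (\<bar>t\<bar> * deg)) * (2 * deg) ^ m" by (simp add: mult_ac)
  qed
  then show ?thesis by (simp add: F_def heat_egf)
qed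

lemma nbr_pow_nonneg: "(\<And>x. 0 \<le> u x) \<Longrightarrow> 0 \<le> (nbr_sum ^^ n) u x"
  by (induction n arbitrary: x) (auto simp: nbr_sum_def intro!: sum_nonneg)

lemma heat_nonneg:
  assumes "bdd_fun u" "\<And>x. 0 \<le> u x" "0 \<le> t"
  shows "0 \<le> heat S t u x"
proof -
  obtain M where M: "\<And>x. \<bar>u x\<bar> \<le> M" using assms unfolding bdd_fun_def by blast
  have "0 \<le> egf (\<lambda>n. (nbr_sum ^^ n) u x) t"
    unfolding egf_def using assms nbr_pow_nonneg[of u]
    by (intro suminf_nonneg egf_summable[OF nbr_pow_geom[OF M]]) auto
  then show ?thesis unfolding heat_nbr[OF assms(1)] by simp
qed

lemma lap_add: "lap S (\<lambda>x. u x + v x) = (\<lambda>x. lap S u x + lap S v x)"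
  by (rule ext) (simp add: lap_eq' sum.distrib algebra_simps)

lemma lap_cmult: "lap S (\<lambda>x. c * u x) = (\<lambda>x. c * lap S u x)"
  by (rule ext) (simp add: lap_eq' sum_distrib_left algebra_simps)

lemma lap_pow_add: "(lap S ^^ n) (\<lambda>x. u x + v x) = (\<lambda>x. (lap S ^^ n) u x + (lap S ^^ n) v x)"
  by (induction n) (simp_all add: lap_add)

lemma lap_pow_cmult: "(lap S ^^ n) (\<lambda>x. c * u x) = (\<lambda>x. c * (lap S ^^ n) u x)"
  by (induction n) (simp_all add: lap_cmult)

lemma heat_add:
  assumes "bdd_fun u" "bdd_fun v"
  shows "heat S t (\<lambda>x. u x + v x) x = heat S t u x + heat S t v x"
proof -
  obtain M M' where "geom_bounded (\<lambda>n. (lap S ^^ n) u x) M (2 * deg)" "geom_bounded (\<lambda>n. (lap S ^^ n) v x) M' (2 * deg)"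
    using lap_pow_geom'[OF assms(1)] lap_pow_geom'[OF assms(2)] by blast
  from egf_add[OF this] show ?thesis unfolding heat_egf lap_pow_add .
qed

lemma heat_cmult:
  assumes "bdd_fun u"
  shows "heat S t (\<lambda>x. c * u x) x = c * heat S t u x"
proof -
  obtain M where "geom_bounded (\<lambda>n. (lap S ^^ n) u x) M (2 * deg)"
    using lap_pow_geom'[OF assms] by blast
  from egf_cmult[OF this] show ?thesis unfolding heat_egf lap_pow_cmult .
qed

lemma lap_const: "lap S (\<lambda>_. c) = (\<lambda>_. 0)"
  by (rule ext) (simp add: lap_eq)

lemma heat_const: "heat S t (\<lambda>_. c) x = c"
proof -
  have "(lap S ^^ Suc n) (\<lambda>_. c) = (\<lambda>_. 0)" for n
    by (induction n) (simp_all add: lap_const)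
  then have "(\<lambda>n. (lap S ^^ n) (\<lambda>_. c) x) = (\<lambda>n. if n = 0 then c else 0)"
    by (intro ext) (metis funpow_0 not0_implies_Suc)
  then show ?thesis
    using powser_zero[of "\<lambda>n. (if n = 0 then c else 0) / fact n"]
      suminf_finite[of "{0}" "\<lambda>n. t ^ n / fact n * (if n = 0 then c else 0)"]
    by (simp add: heat_egf egf_def)
qed

lemma heat_mono:
  assumes "bdd_fun u" "bdd_fun v" "\<And>x. u x \<le> v x" "0 \<le> t"
  shows "heat S t u x \<le> heat S t v x"
proof -
  have b: "bdd_fun (\<lambda>x. -1 * u x)" using assms(1) by (auto simp: bdd_fun_def)
  obtain M M' where M: "\<And>x. \<bar>u x\<bar> \<le> M" "\<And>x. \<bar>v x\<bar> \<le> M'"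
    using assms(1,2) unfolding bdd_fun_def by blast
  have "\<bar>v x + -1 * u x\<bar> \<le> M' + M" for x
    using M(1)[of x] M(2)[of x] by linarith
  then have b2: "bdd_fun (\<lambda>x. v x + -1 * u x)" unfolding bdd_fun_def by blast
  have "0 \<le> heat S t (\<lambda>x. v x + -1 * u x) x"
    using assms b2 by (intro heat_nonneg) auto
  then show ?thesis using heat_add[OF assms(2) b, of t x] heat_cmult[OF assms(1), of t "-1" x] by simp
qed

lemma bdd_const: "bdd_fun (\<lambda>_. c)" by (auto simp: bdd_fun_def)

text \<open>The maximum principle: constants are stationary and the semigroup preserves order.\<close>

lemma heat_le_bound:
  assumes "\<And>x. \<bar>u x\<bar> \<le> M" "0 \<le> t"
  shows "\<bar>heat S t u x\<bar> \<le> M"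
proof -
  have u: "bdd_fun u" using assms by (auto simp: bdd_fun_def)
  have "u x \<le> M" "- M \<le> u x" for x
    using assms(1)[of x] by linarith+
  then have "heat S t u x \<le> heat S t (\<lambda>_. M) x" "heat S t (\<lambda>_. -M) x \<le> heat S t u x"
    using assms(2) by (auto intro!: heat_mono u bdd_const)
  then show ?thesis by (simp add: heat_const)
qed

lemma heat_translate:
  "heat S t (\<lambda>x. u (z + x)) x = heat S t u (z + x)"
proof -
  have "(lap S ^^ n) (\<lambda>x. u (z + x)) = (\<lambda>x. (lap S ^^ n) u (z + x))" for n
    by (induction n) (auto simp: lap_eq add.assoc)
  then show ?thesis by (simp add: heat_egf)
qed

end

section \<open>The heat semigroup on square-summable functions\<close>

context cayley
begin

lemma lap_pow_l2: "u \<in> l2 \<Longrightarrow> (lap S ^^ n) u \<in> l2"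
  by (induction n) (auto intro: lap_l2)

text \<open>A bound for the operator norm of \<open>\<Delta>\<close> on \<open>\<ell>\<^sup>2\<close>; adding \<open>1\<close> makes it positive even for empty \<open>S\<close>, so that one
may divide by it.\<close>

definition lap_rate :: real where "lap_rate = 2 * deg + 1"

lemma lap_rate_pos: "0 < lap_rate" "0 \<le> lap_rate" using deg_nonneg by (simp_all add: lap_rate_def)

lemma ip_lap_pow_self_le:
  assumes "u \<in> l2"
  shows "ip ((lap S ^^ n) u) ((lap S ^^ n) u) \<le> (lap_rate ^ n)\<^sup>2 * ip u u"
proof (induction n)
  case (Suc n)
  have "(2 * deg)\<^sup>2 \<le> lap_rate\<^sup>2" unfolding lap_rate_def using deg_nonneg by (intro power_mono) auto
  then have "(2 * deg)\<^sup>2 * ip ((lap S ^^ n) u) ((lap S ^^ n) u) \<le> lap_rate\<^sup>2 * ((lap_rate ^ n)\<^sup>2 * ip u u)"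
    using Suc by (intro mult_mono) (auto simp: ip_nonneg)
  then show ?case
    using ip_lap_lap_le[OF lap_pow_l2[OF assms], of n] by (simp add: deg_def power_mult_distrib mult_ac)
qed simp

text \<open>The weight of the Cauchy-Schwarz inequality is divided by the \<open>n\<close>-th power of the rate, so that both terms
grow with the same power of the rate.\<close>

lemma ip_abs_lap_pow_le:
  assumes "u \<in> l2" "v \<in> l2" "c > 0"
  shows "ip (\<lambda>x. \<bar>(lap S ^^ n) u x\<bar>) (\<lambda>x. \<bar>v x\<bar>) \<le> (c * ip u u + ip v v / c) / 2 * lap_rate ^ n"
proof -
  have s: "ip (\<lambda>x. \<bar>w x\<bar>) (\<lambda>x. \<bar>w x\<bar>) = ip w w" for w :: "'a \<Rightarrow> real" by (simp add: ip_def)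
  let ?c = "c / lap_rate ^ n"
  have q: "0 < lap_rate ^ n" using lap_rate_pos by simp
  have "ip (\<lambda>x. \<bar>(lap S ^^ n) u x\<bar>) (\<lambda>x. \<bar>v x\<bar>)
      \<le> (?c * ip ((lap S ^^ n) u) ((lap S ^^ n) u) + ip v v / ?c) / 2"
    using ip_scaled_bound[OF l2_abs[OF lap_pow_l2[OF assms(1)]] l2_abs[OF assms(2)], of ?c n] q assms(3)
    unfolding s by (simp add: abs_le_iff)
  also have "\<dots> \<le> (?c * ((lap_rate ^ n)\<^sup>2 * ip u u) + ip v v / ?c) / 2"
    using q assms(3) by (intro divide_right_mono add_right_mono mult_left_mono ip_lap_pow_self_le assms) auto
  also have "\<dots> = (c * ip u u + ip v v / c) / 2 * lap_rate ^ n"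
    using q assms(3) by (simp add: field_simps power2_eq_square)
  finally show ?thesis .
qed

lemma ip_lap_pow_geom:
  assumes "u \<in> l2" "v \<in> l2" "c > 0"
  shows "geom_bounded (\<lambda>n. ip ((lap S ^^ n) u) v) ((c * ip u u + ip v v / c) / 2) lap_rate"
  unfolding geom_bounded_def
proof (intro conjI allI)
  fix n
  have "\<bar>ip ((lap S ^^ n) u) v\<bar> \<le> ip (\<lambda>x. \<bar>(lap S ^^ n) u x\<bar>) (\<lambda>x. \<bar>v x\<bar>)"
    unfolding ip_def
    using norm_infsum_bound[of "\<lambda>x. (lap S ^^ n) u x * v x" UNIV] 
      l2_mult_summable[OF l2_abs[OF lap_pow_l2[OF assms(1)]] l2_abs[OF assms(2)], of n]
    by (simp add: abs_mult)
  also have "\<dots> \<le> (c * ip u u + ip v v / c) / 2 * lap_rate ^ n" by (rule ip_abs_lap_pow_le[OF assms])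
  finally show "\<bar>ip ((lap S ^^ n) u) v\<bar> \<le> (c * ip u u + ip v v / c) / 2 * lap_rate ^ n" .
qed (use lap_rate_pos in auto)

lemma ip_lap_pow_sym:
  assumes "u \<in> l2" "v \<in> l2"
  shows "ip ((lap S ^^ n) u) v = ip u ((lap S ^^ n) v)"
  using assms
proof (induction n arbitrary: v)
  case (Suc n)
  have "ip ((lap S ^^ Suc n) u) v = ip ((lap S ^^ n) u) (lap S v)"
    using Suc.prems by (simp add: ip_lap_sym lap_pow_l2)
  also have "\<dots> = ip u ((lap S ^^ n) (lap S v))" using Suc by (simp add: lap_l2)
  finally show ?case by (simp add: funpow_swap1)
qed simp

lemma ip_heat_finite_support:
  assumes u: "u \<in> l2" and F: "finite F" "\<And>x. x \<notin> F \<Longrightarrow> v x = 0"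
  shows "ip (heat S t u) v = egf (\<lambda>n. ip ((lap S ^^ n) u) v) t"
proof -
  have e: "ip w v = (\<Sum>x\<in>F. w x * v x)" for w
  proof -
    have "ip w v = (\<Sum>\<^sub>\<infinity>x\<in>F. w x * v x)"
      unfolding ip_def by (rule infsum_cong_neutral) (use F in auto)
    then show ?thesis using F by simp
  qed
  obtain M where M: "\<And>x. geom_bounded (\<lambda>n. (lap S ^^ n) u x) M (2 * deg)" using lap_pow_geom'[OF l2_bdd[OF u]] by blast
  have M': "geom_bounded (\<lambda>n. v x * (lap S ^^ n) u x) (\<bar>v x\<bar> * M) (2 * deg)" for x
    using M[of x] unfolding geom_bounded_def by (auto simp: abs_mult mult.assoc intro!: mult_left_mono)
  have "egf (\<lambda>n. ip ((lap S ^^ n) u) v) t = (\<Sum>x\<in>F. egf (\<lambda>n. v x * (lap S ^^ n) u x) t)"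
    unfolding e using egf_sum[OF F(1) M'] by (simp add: mult.commute)
  also have "\<dots> = (\<Sum>x\<in>F. heat S t u x * v x)"
    by (simp add: egf_cmult[OF M] heat_egf mult.commute)
  finally show ?thesis by (simp add: e)
qed

text \<open>Testing \<open>e\<^bsup>t\<Delta>\<^esup>u\<close> against its own restriction to a finite set \<open>F\<close>, where the pairing is a finite sum, bounds the
partial sum over \<open>F\<close> of its squares by a constant plus half of that same partial sum.\<close>

lemma heat_l2:
  assumes u: "u \<in> l2"
  shows "heat S t u \<in> l2"
proof -
  \<comment> \<open>Used also as the weight of the Cauchy-Schwarz inequality: then the second term is half the partial sum.\<close>
  define K where "K = exp (\<bar>t\<bar> * lap_rate)"
  have K: "K > 0" by (simp add: K_def)
  have "(\<Sum>x\<in>F. (heat S t u x)\<^sup>2) \<le> K\<^sup>2 * ip u u" if F: "finite F" for F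
  proof -
    define v where "v = (\<lambda>x. if x \<in> F then heat S t u x else 0)"
    have fv: "finite {x. v x \<noteq> 0}"
      by (rule finite_subset[OF _ F]) (auto simp: v_def)
    have v: "v \<in> l2" by (rule l2_finite_support[OF fv])
    have "ip (heat S t u) v = (\<Sum>\<^sub>\<infinity>x\<in>F. (heat S t u x)\<^sup>2)"
      unfolding ip_def by (rule infsum_cong_neutral) (auto simp: v_def power2_eq_square)
    then have 1: "ip (heat S t u) v = (\<Sum>x\<in>F. (heat S t u x)\<^sup>2)" using F by simp
    have "ip v v = (\<Sum>\<^sub>\<infinity>x\<in>F. (heat S t u x)\<^sup>2)"
      unfolding ip_def by (rule infsum_cong_neutral) (auto simp: v_def power2_eq_square)
    then have 2: "ip v v = (\<Sum>x\<in>F. (heat S t u x)\<^sup>2)" using F by simp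
    have "ip (heat S t u) v = egf (\<lambda>n. ip ((lap S ^^ n) u) v) t"
      by (rule ip_heat_finite_support[OF u F]) (simp add: v_def)
    then have "ip (heat S t u) v \<le> (K * ip u u + ip v v / K) / 2 * K"
      using egf_le[OF ip_lap_pow_geom[OF u v K], of t] by (simp add: K_def abs_le_iff)
    then show ?thesis unfolding 1 2 using K by (simp add: field_simps power2_eq_square)
  qed
  then show ?thesis unfolding l2_def by (auto intro!: summable_on_bounded_sums(1))
qed

text \<open>The exponential series may be paired term by term because the double series over \<open>n\<close> and \<open>x\<close> converges absolutely.\<close>

lemma ip_heat:
  assumes u: "u \<in> l2" and v: "v \<in> l2"
  shows "ip (heat S t u) v = egf (\<lambda>n. ip ((lap S ^^ n) u) v) t"
proof -
  define a where "a n x = t ^ n / fact n * ((lap S ^^ n) u x * v x)" for n x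
  define C where "C = (1 * ip u u + ip v v / 1) / 2"
  obtain M where M: "\<And>x. geom_bounded (\<lambda>n. (lap S ^^ n) u x) M (2 * deg)" using lap_pow_geom'[OF l2_bdd[OF u]] by blast
  have sx: "(\<lambda>x. \<bar>a n x\<bar>) summable_on UNIV" for n
  proof -
    have "(\<lambda>x. \<bar>t ^ n / fact n\<bar> * (\<bar>(lap S ^^ n) u x\<bar> * \<bar>v x\<bar>)) summable_on UNIV"
      by (intro summable_on_cmult_right l2_mult_summable l2_abs lap_pow_l2 u v)
    then show ?thesis by (simp add: a_def abs_mult)
  qed
  have bd: "(\<Sum>\<^sub>\<infinity>x. \<bar>a n x\<bar>) \<le> C * ((\<bar>t\<bar> * lap_rate) ^ n / fact n)" for n
  proof -
    have "(\<Sum>\<^sub>\<infinity>x. \<bar>a n x\<bar>) = \<bar>t\<bar> ^ n / fact n * ip (\<lambda>x. \<bar>(lap S ^^ n) u x\<bar>) (\<lambda>x. \<bar>v x\<bar>)"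
      unfolding a_def ip_def by (simp add: abs_mult power_abs infsum_cmult_right'[symmetric])
    also have "\<dots> \<le> \<bar>t\<bar> ^ n / fact n * (C * lap_rate ^ n)"
      unfolding C_def by (intro mult_left_mono ip_abs_lap_pow_le u v) auto
    finally show ?thesis by (simp add: power_mult_distrib mult_ac)
  qed
  have sn: "summable (\<lambda>n. \<Sum>\<^sub>\<infinity>x. \<bar>a n x\<bar>)"
    by (rule summable_comparison_test'[OF sums_summable[OF egf_majorant_sums[of C "\<bar>t\<bar>" lap_rate]], of 0])
       (use bd in \<open>auto simp: infsum_nonneg abs_of_nonneg\<close>)
  have "(\<lambda>z. norm (case z of (n, x) \<Rightarrow> a n x)) summable_on UNIV \<times> UNIV"
  proof (rule iffD2[OF Infinite_Sum.abs_summable_on_Sigma_iff], intro conjI ballI)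
    show "(\<lambda>x. norm (case (n, x) of (n, x) \<Rightarrow> a n x)) summable_on UNIV" for n
      using sx[of n] by simp
    show "(\<lambda>n. norm (\<Sum>\<^sub>\<infinity>x. norm (case (n, x) of (n, x) \<Rightarrow> a n x))) summable_on UNIV"
      using sn by (intro norm_summable_imp_summable_on) (simp add: infsum_nonneg)
  qed
  then have "(\<lambda>(n, x). a n x) summable_on UNIV \<times> UNIV" by (rule abs_summable_summable)
  then have sw: "(\<Sum>\<^sub>\<infinity>n. \<Sum>\<^sub>\<infinity>x. a n x) = (\<Sum>\<^sub>\<infinity>x. \<Sum>\<^sub>\<infinity>n. a n x)"
    by (rule infsum_swap_banach)
  have "(\<Sum>\<^sub>\<infinity>n. a n x) = heat S t u x * v x" for x
  proof (rule infsumI, rule norm_summable_imp_has_sum)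
    have M': "geom_bounded (\<lambda>n. v x * (lap S ^^ n) u x) (\<bar>v x\<bar> * M) (2 * deg)"
      using M[of x] unfolding geom_bounded_def by (auto simp: abs_mult mult.assoc intro!: mult_left_mono)
    show "summable (\<lambda>n. norm (a n x))"
      using egf_abs_summable[OF M', of t] by (simp add: a_def mult.commute)
    show "(\<lambda>n. a n x) sums (heat S t u x * v x)"
      using summable_sums[OF egf_summable[OF M', of t]] egf_cmult[OF M[of x], of "v x" t]
      unfolding egf_def[of "\<lambda>n. v x * (lap S ^^ n) u x", symmetric] by (simp add: a_def mult.commute heat_egf)
  qed
  moreover have "(\<Sum>\<^sub>\<infinity>x. a n x) = t ^ n / fact n * ip ((lap S ^^ n) u) v" for n
    unfolding a_def ip_def by (rule infsum_cmult_right')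
  moreover have "(\<Sum>\<^sub>\<infinity>n. t ^ n / fact n * ip ((lap S ^^ n) u) v) = egf (\<lambda>n. ip ((lap S ^^ n) u) v) t"
  proof (rule infsumI, rule norm_summable_imp_has_sum)
    show "summable (\<lambda>n. norm (t ^ n / fact n * ip ((lap S ^^ n) u) v))"
      using egf_abs_summable[OF ip_lap_pow_geom[OF u v, of 1], of t] by simp
    show "(\<lambda>n. t ^ n / fact n * ip ((lap S ^^ n) u) v) sums egf (\<lambda>n. ip ((lap S ^^ n) u) v) t"
      unfolding egf_def using egf_summable[OF ip_lap_pow_geom[OF u v, of 1], of t] by (simp add: summable_sums)
  qed
  ultimately show ?thesis using sw by (simp add: ip_def[of "heat S t u" v])
qed

lemma ip_heat_sym:
  assumes "u \<in> l2" "v \<in> l2"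
  shows "ip (heat S t u) v = ip u (heat S t v)"
  using ip_heat[OF assms, of t] ip_heat[OF assms(2,1), of t] ip_lap_pow_sym[OF assms]
  by (simp add: ip_sym[of u])

lemma ip_heat_deriv:
  assumes "u \<in> l2" "v \<in> l2"
  shows "((\<lambda>t. ip (heat S t u) v) has_real_derivative ip (heat S t (lap S u)) v) (at t)"
  using egf_deriv[OF ip_lap_pow_geom[OF assms, of 1], of t]
  by (simp add: ip_heat assms lap_l2 funpow_swap1)

text \<open>Symmetry and the semigroup law make \<open>\<langle>e\<^bsup>t\<Delta>\<^esup>u, u\<rangle>\<close> the squared norm of \<open>e\<^bsup>(t/2)\<Delta>\<^esup>u\<close>; hence it is nonnegative, and
decreasing since its derivative is minus a Dirichlet energy.\<close>

lemma ip_heat_half: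
  assumes "u \<in> l2" "v \<in> l2"
  shows "ip (heat S t u) v = ip (heat S (t/2) u) (heat S (t/2) v)"
proof -
  have "heat S t u = heat S (t/2) (heat S (t/2) u)"
    using heat_semigroup[OF l2_bdd[OF assms(1)], of "t/2" "t/2"] by simp
  then show ?thesis using ip_heat_sym[OF heat_l2[OF assms(1)] assms(2)] by metis
qed

lemma ip_heat_self_nonneg: "u \<in> l2 \<Longrightarrow> 0 \<le> ip (heat S t u) u"
  by (simp add: ip_heat_half ip_nonneg)

lemma ip_heat_lap_self:
  assumes "u \<in> l2"
  shows "ip (heat S t (lap S u)) u = ip (lap S (heat S (t/2) u)) (heat S (t/2) u)"
  using ip_heat_half[OF lap_l2[OF assms] assms, of t] lap_heat[OF l2_bdd[OF assms]] by simp

lemma ip_heat_lap_self_nonpos: "u \<in> l2 \<Longrightarrow> ip (heat S t (lap S u)) u \<le> 0"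
  unfolding ip_heat_lap_self by (intro ip_lap_nonpos heat_l2)

lemma heat_kernel_eq: "heat_kernel S t x y = heat S t (single y) x"
  by (simp add: heat_kernel_def single_def)

lemma bdd_single [simp]: "bdd_fun (single y)" by (rule l2_bdd) simp

lemma heat_kernel_ip: "heat_kernel S t x y = ip (heat S t (single y)) (single x)"
  by (simp add: heat_kernel_eq)

lemma heat_kernel_sym: "heat_kernel S t x y = heat_kernel S t y x"
  unfolding heat_kernel_ip using ip_heat_sym[of "single y" "single x" t] by (metis ip_sym l2_single)

lemma heat_kernel_nonneg: "0 \<le> t \<Longrightarrow> 0 \<le> heat_kernel S t x y"
  unfolding heat_kernel_eq by (rule heat_nonneg[OF bdd_single]) (auto simp: single_def)

lemma heat_kernel_le_1: "0 \<le> t \<Longrightarrow> heat_kernel S t x y \<le> 1"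
  unfolding heat_kernel_eq using abs_le_D1[OF heat_le_bound[of "single y" 1 t x]] by (simp add: single_def)

lemma heat_kernel_translate: "heat_kernel S t (z + x) (z + y) = heat_kernel S t x y"
proof -
  have "single y = (\<lambda>x. single (z + y) (z + x))" by (auto simp: single_def)
  then show ?thesis unfolding heat_kernel_eq using heat_translate[of t "single (z + y)" z x] by simp
qed

lemma heat_eq_ip_kernel:
  assumes "u \<in> l2"
  shows "heat S t u x = ip u (heat_kernel S t x)"
proof -
  have "heat S t u x = ip (heat S t u) (single x)" by simp
  also have "\<dots> = ip u (heat S t (single x))" by (rule ip_heat_sym[OF assms]) simp
  also have "heat S t (single x) = heat_kernel S t x"
    by (rule ext) (metis heat_kernel_eq heat_kernel_sym)
  finally show ?thesis .
qed

lemma heat_kernel_l2: "heat_kernel S t x \<in> l2"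
proof -
  have "heat_kernel S t x = heat S t (single x)"
    by (rule ext) (metis heat_kernel_eq heat_kernel_sym)
  then show ?thesis by (simp add: heat_l2)
qed

lemma heat_finite_sum:
  "finite F \<Longrightarrow> (\<And>i. i \<in> F \<Longrightarrow> bdd_fun (f i)) \<Longrightarrow>
    bdd_fun (\<lambda>x. \<Sum>i\<in>F. f i x) \<and> heat S t (\<lambda>x. \<Sum>i\<in>F. f i x) x = (\<Sum>i\<in>F. heat S t (f i) x)"
proof (induction F rule: finite_induct)
  case empty
  then show ?case by (simp add: heat_const bdd_const)
next
  case (insert i F)
  obtain M M' where M: "\<And>x. \<bar>f i x\<bar> \<le> M" "\<And>x. \<bar>\<Sum>i\<in>F. f i x\<bar> \<le> M'"
    using insert unfolding bdd_fun_def by (metis insertCI)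
  have "\<bar>f i x + (\<Sum>i\<in>F. f i x)\<bar> \<le> M + M'" for x
    using M(1)[of x] M(2)[of x] by linarith
  then have "bdd_fun (\<lambda>x. f i x + (\<Sum>i\<in>F. f i x))" unfolding bdd_fun_def by blast
  then show ?case using insert heat_add[of "f i" "\<lambda>x. \<Sum>i\<in>F. f i x" t x] by simp
qed

lemma heat_kernel_sum_le:
  assumes "finite F" "0 \<le> t"
  shows "(\<Sum>y\<in>F. heat_kernel S t x y) \<le> 1"
proof -
  have "(\<Sum>y\<in>F. heat_kernel S t x y) = heat S t (\<lambda>z. \<Sum>y\<in>F. single y z) x"
    unfolding heat_kernel_eq using heat_finite_sum[OF assms(1), of single t x] by simp
  also have "\<dots> \<le> heat S t (\<lambda>_. 1) x"
  proof (rule heat_mono)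
    show "bdd_fun (\<lambda>z. \<Sum>y\<in>F. single y z)" using heat_finite_sum[OF assms(1), of single t x] by simp
    show "(\<Sum>y\<in>F. single y z) \<le> 1" for z
      using assms(1) by (simp add: single_def)
  qed (use assms in \<open>auto simp: bdd_const\<close>)
  finally show ?thesis by (simp add: heat_const)
qed

lemma heat_kernel_summable:
  assumes "0 \<le> t"
  shows "heat_kernel S t x summable_on UNIV" "infsum (heat_kernel S t x) UNIV \<le> 1"
  using summable_on_bounded_sums[of UNIV "heat_kernel S t x" 1] heat_kernel_sum_le[OF _ assms] heat_kernel_nonneg[OF assms]
  by auto

end

section \<open>Decay of the heat kernel from volume growth\<close>

text \<open>In the application \<open>h\<close> is the return probability \<open>k\<^sub>t(0,0)\<close>, \<open>n\<close> the dimension, and \<open>t/n\<close> is the squared radius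
of the ball over which one averages. With exactly this radius \<open>t\<^sup>n\<close> is an integrating factor:
\<open>(t\<^sup>n h)' \<le> K t\<^bsup>n/2 - 1\<^esup>\<close>, and integration gives \<open>t\<^sup>n h \<le> C t\<^bsup>n/2\<^esup>\<close>.\<close>

lemma decay_of_differential_inequality:
  fixes h h' :: "real \<Rightarrow> real" and n c :: real
  assumes n: "n \<ge> 2" and c: "c \<ge> 0"
    and der: "\<And>t. (h has_real_derivative h' t) (at t)"
    and nash: "\<And>t. t \<ge> n \<Longrightarrow> h t + (t / n) * h' t \<le> c * (t / n) powr (- n/2)"
    and h1: "\<And>t. t > 0 \<Longrightarrow> h t \<le> 1"
  shows "\<exists>C>0. \<forall>t>0. h t \<le> C * t powr (- n / 2)"
proof -
  define K where "K = c * n * n powr (n/2)"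
  have K: "K \<ge> 0" using c n by (simp add: K_def)
  have nash': "n * t powr (n - 1) * h t + t powr n * h' t \<le> K * t powr (n/2 - 1)" if t: "t \<ge> n" for t
  proof -
    have t0: "t > 0" using t n by linarith
    have 1: "n * t powr (n - 1) * (h t + (t / n) * h' t) \<le> n * t powr (n - 1) * (c * (t / n) powr (- n/2))"
      by (rule mult_left_mono[OF nash[OF t]]) (use n in simp)
    have 2: "t powr n = t powr (n - 1) * t" using t0 powr_add[of t "n - 1" 1] by simp
    have 3: "n * t powr (n - 1) * (h t + (t / n) * h' t) = n * t powr (n - 1) * h t + t powr n * h' t"
      unfolding 2 using n by (simp add: distrib_left)
    have 4: "t powr (n - 1) * t powr (- n/2) = t powr (n/2 - 1)"
      unfolding powr_add[symmetric] by (rule arg_cong[where f = "\<lambda>x. t powr x"]) (simp add: field_simps)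
    have 5: "(t / n) powr (- n/2) = t powr (- n/2) * n powr (n/2)"
      using t0 n powr_divide[of t n "- n/2"] powr_minus_divide[of n "n/2"] by simp
    have "n * t powr (n - 1) * (c * (t / n) powr (- n/2)) = K * (t powr (n - 1) * t powr (- n/2))"
      unfolding 5 K_def by (simp only: mult_ac)
    then show ?thesis using 1 unfolding 3 4 by argo
  qed
  \<comment> \<open>The second term is a primitive of the right side of the differential inequality, so \<open>G\<close> decreases.\<close>
  define G where "G t = t powr n * h t - (2 * K / n) * t powr (n/2)" for t
  have G: "G t \<le> G n" if "n \<le> t" for t
  proof (rule DERIV_nonpos_imp_nonincreasing[OF that])
    fix x assume x: "n \<le> x" "x \<le> t"
    have x0: "x > 0" using x n by linarith
    have a: "((\<lambda>t. t powr n) has_real_derivative n * x powr (n - 1)) (at x)"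
      by (rule has_real_derivative_powr[OF x0])
    have b: "((\<lambda>t. t powr (n/2)) has_real_derivative (n/2) * x powr (n/2 - 1)) (at x)"
      by (rule has_real_derivative_powr[OF x0])
    have "(G has_real_derivative (n * x powr (n - 1) * h x + h' x * x powr n - (2 * K / n) * ((n/2) * x powr (n/2 - 1)))) (at x)"
      unfolding G_def by (intro DERIV_diff DERIV_mult DERIV_cmult a b der)
    moreover have "(2 * K / n) * ((n/2) * x powr (n/2 - 1)) = K * x powr (n/2 - 1)" using n by simp
    ultimately show "\<exists>y. (G has_real_derivative y) (at x) \<and> y \<le> 0"
      using nash'[OF x(1)]
      by (intro exI[of _ "n * x powr (n - 1) * h x + h' x * x powr n - (2 * K / n) * ((n/2) * x powr (n/2 - 1))"] conjI)
         (simp_all add: mult.commute)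
  qed
  define C where "C = n powr n + 2 * K / n + n powr (n/2)"
  have h: "h t \<le> C * t powr (- n / 2)" if t: "t > 0" for t
  proof (cases "t \<le> n")
    case True
    have "1 = t powr (n/2) * t powr (- n/2)" unfolding powr_add[symmetric] using t by simp
    also have "\<dots> \<le> n powr (n/2) * t powr (- n/2)"
      using True t n by (intro mult_right_mono powr_mono2) auto
    also have "\<dots> \<le> C * t powr (- n/2)"
      using K n by (intro mult_right_mono) (auto simp: C_def)
    finally show ?thesis using h1[OF t] by linarith
  next
    case False
    have "n powr n * h n \<le> n powr n * 1" using h1[of n] n by (intro mult_left_mono) auto
    moreover have "0 \<le> 2 * K / n * n powr (n/2)" using K n by simp
    ultimately have "t powr n * h t \<le> n powr n + (2 * K / n) * t powr (n/2)"
      using G[of t] False unfolding G_def by linarith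
    also have "\<dots> \<le> C * t powr (n/2)"
    proof -
      have a: "1 \<le> t powr (n/2)" using False n by (intro ge_one_powr_ge_zero) auto
      have "n powr n * 1 \<le> n powr n * t powr (n/2)" by (rule mult_left_mono[OF a]) simp
      moreover have "0 \<le> n powr (n/2) * t powr (n/2)" by simp
      ultimately show ?thesis unfolding C_def distrib_right by linarith
    qed
    finally have 1: "t powr (- n) * (t powr n * h t) \<le> t powr (- n) * (C * t powr (n/2))"
      by (rule mult_left_mono) simp
    have 2: "t powr (- n) * t powr n = 1" "t powr (- n) * t powr (n/2) = t powr (- n/2)"
      unfolding powr_add[symmetric] using t by simp_all
    have 3: "t powr (- n) * (t powr n * h t) = h t" unfolding mult.assoc[symmetric] 2 by simp
    have 4: "t powr (- n) * (C * t powr (n/2)) = C * t powr (- n/2)"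
      using 2(2) by (metis mult.left_commute)
    show ?thesis using 1 unfolding 3 4 .
  qed
  have "C > 0" using K n by (simp add: C_def add_nonneg_pos)
  with h show ?thesis by blast
qed

locale growth_cayley = cayley S for S :: "'a::group_add set" +
  fixes N :: nat
  assumes gen: "generating_set S" and dim: "homogeneous_dim S N" and N_ge_2: "N \<ge> 2"
begin

abbreviation edges :: "('a \<times> 'a) set" where "edges \<equiv> {(z, w). adj S z w}"

lemma edge_path: "set xs \<subseteq> S \<Longrightarrow> (x, x + sum_list xs) \<in> edges ^^ length xs"
proof (induction xs arbitrary: x)
  case (Cons s xs)
  have "(x, x + s) \<in> edges" using Cons.prems by (simp add: adj_def add.assoc[symmetric])
  moreover have "(x + s, x + s + sum_list xs) \<in> edges ^^ length xs" using Cons by simp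
  ultimately have "(x, x + s + sum_list xs) \<in> edges ^^ Suc (length xs)" by (rule relpow_Suc_I2)
  then show ?case by (simp add: add.assoc)
qed simp

lemma word_dist_path: "(x, y) \<in> edges ^^ word_dist S x y"
proof -
  obtain xs where "set xs \<subseteq> S" "sum_list xs = - x + y"
    using gen unfolding generating_set_def by blast
  then have "(x, y) \<in> edges ^^ length xs" using edge_path[of xs x] by (simp add: add.assoc[symmetric])
  then show ?thesis unfolding word_dist_def by (rule LeastI)
qed

lemma countable_vertices: "countable (UNIV :: 'a set)"
proof -
  have "(UNIV :: 'a set) = sum_list ` lists S"
  proof -
    have "x \<in> sum_list ` lists S" for x
    proof -
      obtain xs where "set xs \<subseteq> S" "sum_list xs = x" using gen unfolding generating_set_def by blast
      then show ?thesis by (intro image_eqI[of _ _ xs]) (auto simp: lists_eq_set)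
    qed
    then show ?thesis by blast
  qed
  moreover have "countable (lists S)" using finite_S by (simp add: countable_finite countable_lists)
  ultimately show ?thesis by (metis countable_image)
qed

text \<open>The Dirichlet energy, by summation by parts the sum of the squared gradient over all vertices.\<close>

definition dirichlet :: "('a \<Rightarrow> real) \<Rightarrow> real" where "dirichlet u = - ip (lap S u) u"

lemma step_dirichlet:
  assumes "u \<in> l2" "s \<in> S"
  shows "ip (\<lambda>x. u (x + s) - u x) (\<lambda>x. u (x + s) - u x) \<le> 2 * dirichlet u"
proof -
  have "ip (\<lambda>x. u (x + s) - u x) (\<lambda>x. u (x + s) - u x)
      \<le> (\<Sum>s\<in>S. ip (\<lambda>x. u (x + s) - u x) (\<lambda>x. u (x + s) - u x))"
    using assms finite_S by (intro member_le_sum) (auto simp: ip_nonneg)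
  also have "\<dots> = 2 * dirichlet u"
    using infsum_grad_shifts[OF assms(1,1)] infsum_grad[OF assms(1,1)] by (simp add: dirichlet_def)
  finally show ?thesis .
qed

lemma dirichlet_nonneg: "u \<in> l2 \<Longrightarrow> 0 \<le> dirichlet u"
  using ip_lap_nonpos by (simp add: dirichlet_def)

text \<open>The triangle inequality along a path of \<open>n\<close> edges, in squared form: one step costs at most twice the energy, and the
Cauchy-Schwarz inequality with weight \<open>n\<close> produces the terms of \<open>(n + 1)\<^sup>2 = n\<^sup>2 + 2n + 1\<close>.\<close>

lemma path_dirichlet:
  assumes "u \<in> l2" "(0, y) \<in> edges ^^ n"
  shows "ip (\<lambda>x. u (x + y) - u x) (\<lambda>x. u (x + y) - u x) \<le> (real n)\<^sup>2 * (2 * dirichlet u)"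
  using assms(2)
proof (induction n arbitrary: y)
  case 0
  then show ?case by (simp add: ip_def)
next
  case (Suc n)
  obtain z where z: "(0, z) \<in> edges ^^ n" "adj S z y" using Suc.prems by auto
  define s where "s = - z + y"
  have s: "s \<in> S" "y = z + s" using z by (auto simp: s_def adj_def add.assoc[symmetric])
  define a where "a x = u (x + z + s) - u (x + z)" for x
  define b where "b x = u (x + z) - u x" for x
  have a2: "a \<in> l2" "b \<in> l2"
    unfolding a_def b_def using l2_shift[OF l2_shift[OF assms(1), of s], of z] 
    by (auto intro!: l2_diff l2_shift assms(1) simp: add.assoc)
  have eq: "(\<lambda>x. u (x + y) - u x) = (\<lambda>x. a x + b x)"
    by (auto simp: a_def b_def s(2) add.assoc)
  have A: "ip a a \<le> 2 * dirichlet u"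
  proof -
    have "ip a a = ip (\<lambda>x. u (x + s) - u x) (\<lambda>x. u (x + s) - u x)"
      unfolding a_def using ip_shift[of "\<lambda>x. u (x + s) - u x" z "\<lambda>x. u (x + s) - u x"] by simp
    then show ?thesis using step_dirichlet[OF assms(1) s(1)] by simp
  qed
  have B: "ip b b \<le> (real n)\<^sup>2 * (2 * dirichlet u)" unfolding b_def using Suc.IH[OF z(1)] .
  show ?case
  proof (cases "n = 0")
    case True
    then have "b = (\<lambda>x. 0)" using z by (auto simp: b_def)
    then show ?thesis using A True by (simp add: eq)
  next
    case False
    have "ip (\<lambda>x. a x + b x) (\<lambda>x. a x + b x) = ip a a + 2 * ip a b + ip b b"
      using a2 by (simp add: ip_add ip_add2 l2_add ip_sym[of b a])
    moreover have "2 * ip a b \<le> real n * ip a a + ip b b / real n"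
      using ip_scaled_bound[OF a2, of "real n"] False by (simp add: abs_le_iff)
    moreover have "ip b b / real n \<le> real n * (2 * dirichlet u)"
      using B False by (simp add: field_simps power2_eq_square)
    moreover have "real n * ip a a \<le> real n * (2 * dirichlet u)"
      using A by (intro mult_left_mono) auto
    ultimately have "ip (\<lambda>x. a x + b x) (\<lambda>x. a x + b x) \<le> 2 * dirichlet u + 2 * (real n * (2 * dirichlet u)) + (real n)\<^sup>2 * (2 * dirichlet u)"
      using A B by linarith
    then show ?thesis unfolding eq by (simp add: power2_eq_square algebra_simps)
  qed
qed

lemma heat_kernel_convolution:
  "ip (\<lambda>x. heat_kernel S t (x + y) 0) (\<lambda>x. heat_kernel S t x 0) = heat_kernel S (2 * t) y 0"
proof -
  have "ip (\<lambda>x. heat_kernel S t (x + y) 0) (\<lambda>x. heat_kernel S t x 0) =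
    (\<Sum>\<^sub>\<infinity>x. heat_kernel S t y (- x) * heat_kernel S t 0 (- x))"
    unfolding ip_def
  proof (rule infsum_cong)
    fix x
    show "heat_kernel S t (x + y) 0 * heat_kernel S t x 0 = heat_kernel S t y (- x) * heat_kernel S t 0 (- x)"
      using heat_kernel_translate[of t "- x" "x + y" 0] heat_kernel_translate[of t "- x" x 0]
      by (simp add: add.assoc[symmetric])
  qed
  also have "\<dots> = (\<Sum>\<^sub>\<infinity>x. heat_kernel S t y x * heat_kernel S t 0 x)"
    by (rule infsum_reindex_bij_betw[where f = "\<lambda>x. heat_kernel S t y x * heat_kernel S t 0 x"])
       (rule bij_betwI[where g = uminus], auto)
  also have "\<dots> = ip (heat S t (single 0)) (heat S t (single y))"
    unfolding ip_def by (simp add: heat_kernel_eq[symmetric] heat_kernel_sym[of t _ y] heat_kernel_sym[of t _ 0] mult.commute)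
  also have "\<dots> = heat_kernel S (2 * t) y 0"
    unfolding heat_kernel_ip using ip_heat_half[of "single 0" "single y" "2 * t"] by simp
  finally show ?thesis .
qed

text \<open>The semigroup law and translation invariance write \<open>k\<^sub>t(y,0)\<close> as a correlation of \<open>k\<^bsub>t/2\<^esub>(-,0)\<close> with its
translate by \<open>y\<close>. This both bounds \<open>k\<^sub>t(y,0)\<close> by the value at \<open>y = 0\<close> and controls the difference by a
Dirichlet energy.\<close>

lemma heat_kernel_difference:
  defines "g t \<equiv> (\<lambda>x. heat_kernel S (t/2) x 0)"
  shows "heat_kernel S t 0 0 - heat_kernel S t y 0 = ip (\<lambda>x. g t (x + y) - g t x) (\<lambda>x. g t (x + y) - g t x) / 2"
proof -
  have g: "g t = heat S (t/2) (single 0)" by (auto simp: g_def heat_kernel_eq)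
  then have l: "g t \<in> l2" by (simp add: heat_l2)
  have "ip (\<lambda>x. g t (x + y)) (g t) = heat_kernel S t y 0" "ip (g t) (g t) = heat_kernel S t 0 0"
    using heat_kernel_convolution[of "t/2" y] heat_kernel_convolution[of "t/2" 0] by (simp_all add: g_def)
  moreover have "ip (\<lambda>x. g t (x + y) - g t x) (\<lambda>x. g t (x + y) - g t x) = 2 * ip (g t) (g t) - 2 * ip (\<lambda>x. g t (x + y)) (g t)"
    using l l2_shift[OF l, of y] by (simp add: ip_diff ip_diff2 l2_diff ip_shift ip_sym[of "g t" "\<lambda>x. g t (x + y)"])
  ultimately show ?thesis by simp
qed

lemma heat_kernel_le_diagonal: "heat_kernel S t x y \<le> heat_kernel S t 0 0"
proof -
  have "heat_kernel S t x y = heat_kernel S t (- y + x) 0"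
    using heat_kernel_translate[of t "- y" x y] by simp
  also have "\<dots> \<le> heat_kernel S t 0 0"
    using heat_kernel_difference[of t "- y + x"] ip_nonneg[of "\<lambda>xa. heat_kernel S (t / 2) (xa + (- y + x)) 0 - heat_kernel S (t / 2) xa 0"]
    by linarith
  finally show ?thesis .
qed

abbreviation diag :: "real \<Rightarrow> real" where "diag t \<equiv> heat_kernel S t 0 0"
abbreviation diag' :: "real \<Rightarrow> real" where "diag' t \<equiv> heat S t (lap S (single 0)) 0"

lemma diag_deriv: "(diag has_real_derivative diag' t) (at t)"
  unfolding heat_kernel_eq by (rule heat_deriv) simp

text \<open>The value \<open>k\<^sub>t(0,0)\<close> differs from \<open>k\<^sub>t(0,y)\<close> by at most \<open>r\<^sup>2\<close> times the energy of \<open>k\<^bsub>t/2\<^esub>(-,0)\<close>, which is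
\<open>-d/dt k\<^sub>t(0,0)\<close>. Summing over the ball and using \<open>\<Sum>\<^sub>y k\<^sub>t(0,y) \<le> 1\<close> gives the estimate; it plays the role
of a Nash inequality.\<close>

lemma diag_le_ball_average:
  assumes t: "0 \<le> t" and V: "finite (word_ball S 0 r)" and r: "0 \<le> r"
  shows "real (card (word_ball S 0 r)) * diag t \<le> 1 + real (card (word_ball S 0 r)) * (r\<^sup>2 * (- diag' t))"
proof -
  define g where "g = heat S (t/2) (single 0)"
  have g: "g \<in> l2" by (simp add: g_def heat_l2)
  have gk: "g = (\<lambda>x. heat_kernel S (t/2) x 0)" by (auto simp: g_def heat_kernel_eq)
  have E: "dirichlet g = - diag' t"
    using ip_heat_lap_self[of "single 0" t] by (simp add: dirichlet_def g_def)
  have hk: "heat_kernel S (t/2) z 0 = g z" for z by (simp add: gk)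
  have "diag t - heat_kernel S t y 0 \<le> r\<^sup>2 * (- diag' t)" if "y \<in> word_ball S 0 r" for y
  proof -
    have "ip (\<lambda>x. g (x + y) - g x) (\<lambda>x. g (x + y) - g x) \<le> (real (word_dist S 0 y))\<^sup>2 * (2 * dirichlet g)"
      by (rule path_dirichlet[OF g word_dist_path])
    also have "\<dots> \<le> r\<^sup>2 * (2 * dirichlet g)"
      using that r by (intro mult_right_mono power_mono) (auto simp: word_ball_def dirichlet_nonneg[OF g])
    finally show ?thesis using heat_kernel_difference[of t y] unfolding hk E[symmetric] by simp
  qed
  then have "diag t \<le> heat_kernel S t 0 y + r\<^sup>2 * (- diag' t)" if "y \<in> word_ball S 0 r" for y
    using that heat_kernel_sym[of t 0 y] by fastforce
  then have "(\<Sum>y\<in>word_ball S 0 r. diag t) \<le> (\<Sum>y\<in>word_ball S 0 r. heat_kernel S t 0 y + r\<^sup>2 * (- diag' t))"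
    by (rule sum_mono)
  then show ?thesis using heat_kernel_sum_le[OF V t, of 0] unfolding sum.distrib sum_constant by linarith
qed

lemma diag_decay: "\<exists>C>0. \<forall>t>0. diag t \<le> C * t powr (- real N / 2)"
proof -
  obtain C1 where C1: "C1 > 0" "\<And>r. r \<ge> 1 \<Longrightarrow> C1 * r ^ N \<le> real (card (word_ball S 0 r))"
    using dim unfolding homogeneous_dim_def by blast
  have n: "real N \<ge> 2" using N_ge_2 by simp
  show ?thesis
  proof (rule decay_of_differential_inequality[OF n, of "1 / C1"])
    fix t assume t: "t \<ge> real N"
    define r where "r = sqrt (t / real N)"
    have t0: "t > 0" using t n by linarith
    have r: "r \<ge> 1" using t n by (simp add: r_def)
    define V where "V = real (card (word_ball S 0 r))"
    have V: "C1 * r ^ N \<le> V" unfolding V_def by (rule C1(2)[OF r])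
    have V0: "0 < C1 * r ^ N" by (intro mult_pos_pos C1(1) zero_less_power) (use r in linarith)
    have Vp: "0 < V" using V V0 by linarith
    have fin: "finite (word_ball S 0 r)" using Vp unfolding V_def by (intro card_ge_0_finite) simp
    have rh: "r = (t / real N) powr (1/2)" using t0 n by (simp add: r_def powr_half_sqrt)
    have "r ^ N = r powr real N" using r by (simp add: powr_realpow)
    also have "\<dots> = (t / real N) powr (real N / 2)" unfolding rh powr_powr by simp
    finally have rN: "r ^ N = (t / real N) powr (real N / 2)" .
    have r0: "0 \<le> r" "0 \<le> t" using r t0 by linarith+
    have "V * diag t \<le> 1 + V * (r\<^sup>2 * (- diag' t))"
      unfolding V_def by (rule diag_le_ball_average[OF r0(2) fin r0(1)])
    then have "diag t \<le> 1 / V + r\<^sup>2 * (- diag' t)"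
      using Vp divide_right_mono[of "V * diag t" "1 + V * (r\<^sup>2 * (- diag' t))" V]
      unfolding add_divide_distrib by simp
    moreover have "1 / V \<le> 1 / (C1 * r ^ N)" using V V0 Vp by (intro divide_left_mono) auto
    moreover have r2: "r\<^sup>2 = t / real N" unfolding r_def by (rule real_sqrt_pow2) (use t0 in simp)
    ultimately have "diag t + (t / real N) * diag' t \<le> 1 / (C1 * r ^ N)"
      unfolding r2 mult_minus_right by linarith
    also have "\<dots> = 1 / C1 * (t / real N) powr (- real N / 2)"
      unfolding rN minus_divide_left[symmetric] powr_minus_divide by simp
    finally show "diag t + (t / real N) * diag' t \<le> 1 / C1 * (t / real N) powr (- real N / 2)" .
  next
    show "diag t \<le> 1" if "t > 0" for t using heat_kernel_le_1 that by simp
  qed (use C1 in simp, rule diag_deriv)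
qed

end

section \<open>Mellin transforms in time\<close>

definition mellin :: "real \<Rightarrow> (real \<Rightarrow> real) \<Rightarrow> real" where
  "mellin s f = (LINT t:{0<..}|lborel. f t * t powr (- 1 + s))"

definition mellin_ok :: "real \<Rightarrow> (real \<Rightarrow> real) \<Rightarrow> bool" where
  "mellin_ok s f \<longleftrightarrow> set_integrable lborel {0<..} (\<lambda>t. f t * t powr (- 1 + s))"

text \<open>The upper bound for all heat quantities below: trivial for small times, polynomial decay for large times.\<close>

definition envelope :: "real \<Rightarrow> real \<Rightarrow> real" where
  "envelope b t = (if t \<le> 1 then 1 else t powr (- b))"

lemma envelope_nonneg: "0 \<le> envelope b t" by (simp add: envelope_def)

lemma envelope_measurable [measurable]: "envelope b \<in> borel_measurable borel"
  unfolding envelope_def by measurable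

lemma set_integrable_nonneg_lborel:
  fixes f :: "real \<Rightarrow> real"
  assumes [measurable]: "f \<in> borel_measurable borel" "A \<in> sets borel"
    and "f integrable_on A" "\<And>x. x \<in> A \<Longrightarrow> 0 \<le> f x"
  shows "set_integrable lborel A f"
proof -
  have "set_integrable lebesgue A f" using assms(3,4) by (rule nonnegative_absolutely_integrable_1)
  then show ?thesis unfolding set_integrable_def
    by (subst (asm) integrable_completion) auto
qed

lemma mellin_ok_envelope:
  assumes "0 < s" "s < b"
  shows "mellin_ok s (envelope b)"
proof -
  have "set_integrable lborel {0<..1} (\<lambda>t::real. t powr (- 1 + s))"
    using assms by (intro set_integrable_nonneg_lborel integrable_on_powr_from_0') auto
  then have 1: "set_integrable lborel {0<..1} (\<lambda>t. envelope b t * t powr (- 1 + s))"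
    by (rule iffD1[OF set_integrable_cong, rotated -1]) (auto simp: envelope_def)
  have "set_integrable lborel {1..} (\<lambda>t::real. t powr (- 1 + s - b))"
    using assms has_integral_powr_to_inf[of "- 1 + s - b" 1]
    by (intro set_integrable_nonneg_lborel) (auto simp: integrable_on_def)
  then have "set_integrable lborel {1<..} (\<lambda>t::real. t powr (- 1 + s - b))"
    by (rule set_integrable_subset) auto
  then have 2: "set_integrable lborel {1<..} (\<lambda>t. envelope b t * t powr (- 1 + s))"
  proof (rule iffD1[OF set_integrable_cong, rotated -1])
    fix t :: real assume "t \<in> {1<..}"
    then show "t powr (- 1 + s - b) = envelope b t * t powr (- 1 + s)"
      unfolding envelope_def using powr_add[of t "- b" "- 1 + s"] by (simp add: algebra_simps)
  qed auto
  have "set_integrable lborel ({0<..1} \<union> {1<..}) (\<lambda>t. envelope b t * t powr (- 1 + s))"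
    by (rule set_integrable_Un[OF 1 2]) auto
  moreover have "{0<..1} \<union> {1<..} = {0::real<..}" by auto
  ultimately show ?thesis by (simp add: mellin_ok_def)
qed

lemma mellin_ok_bound:
  assumes [measurable]: "f \<in> borel_measurable borel"
    and s: "0 < s" "s < b" and f: "\<And>t. t > 0 \<Longrightarrow> \<bar>f t\<bar> \<le> C * envelope b t"
  shows "mellin_ok s f" "\<bar>mellin s f\<bar> \<le> C * mellin s (envelope b)"
proof -
  have m: "set_integrable lborel {0<..} (\<lambda>t. C * (envelope b t * t powr (- 1 + s)))"
    using mellin_ok_envelope[OF s] by (simp add: mellin_ok_def)
  have le: "\<bar>f t * t powr (- 1 + s)\<bar> \<le> C * (envelope b t * t powr (- 1 + s))" if "t > 0" for t
    using mult_right_mono[OF f[OF that], of "t powr (- 1 + s)"] by (simp add: abs_mult mult.assoc)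
  show ok: "mellin_ok s f"
    unfolding mellin_ok_def
  proof (rule set_integrable_bound[OF m])
    show "set_borel_measurable lborel {0<..} (\<lambda>t. f t * t powr (- 1 + s))"
      unfolding set_borel_measurable_def by measurable
    show "AE t in lborel. t \<in> {0<..} \<longrightarrow>
        norm (f t * t powr (- 1 + s)) \<le> norm (C * (envelope b t * t powr (- 1 + s)))"
    proof (rule AE_I2, rule impI)
      fix t :: real assume "t \<in> {0<..}"
      then have "\<bar>f t * t powr (- 1 + s)\<bar> \<le> \<bar>C * (envelope b t * t powr (- 1 + s))\<bar>"
        using order_trans[OF le abs_ge_self] by auto
      then show "norm (f t * t powr (- 1 + s)) \<le> norm (C * (envelope b t * t powr (- 1 + s)))" by simp
    qed
  qed
  have "\<bar>mellin s f\<bar> \<le> (LINT t:{0<..}|lborel. \<bar>f t * t powr (- 1 + s)\<bar>)"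
    using set_integral_norm_bound[OF ok[unfolded mellin_ok_def]] by (simp add: mellin_def)
  also have "\<dots> \<le> (LINT t:{0<..}|lborel. C * (envelope b t * t powr (- 1 + s)))"
    using set_integrable_abs[OF ok[unfolded mellin_ok_def]] m le by (intro set_integral_mono) auto
  finally show "\<bar>mellin s f\<bar> \<le> C * mellin s (envelope b)" by (simp add: mellin_def)
qed

lemma mellin_sum:
  assumes "finite I" "\<And>i. i \<in> I \<Longrightarrow> mellin_ok s (f i)"
  shows "mellin_ok s (\<lambda>t. \<Sum>i\<in>I. c i * f i t)"
    "mellin s (\<lambda>t. \<Sum>i\<in>I. c i * f i t) = (\<Sum>i\<in>I. c i * mellin s (f i))"
proof -
  have eq: "(\<lambda>t. (\<Sum>i\<in>I. c i * f i t) * t powr (- 1 + s)) = (\<lambda>t. \<Sum>i\<in>I. c i * (f i t * t powr (- 1 + s)))"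
    by (simp add: sum_distrib_right mult.assoc)
  have i: "integrable lborel (\<lambda>t. c i * (indicator {0<..} t * (f i t * t powr (- 1 + s))))" if "i \<in> I" for i
    using assms(2)[OF that] by (simp add: mellin_ok_def set_integrable_def)
  have eq2: "(\<lambda>t. indicator {0<..} t *\<^sub>R (\<Sum>i\<in>I. c i * (f i t * t powr (- 1 + s))))
     = (\<lambda>t. \<Sum>i\<in>I. c i * (indicator {0<..} t * (f i t * t powr (- 1 + s))))"
    by (simp add: sum_distrib_left mult.left_commute)
  show "mellin_ok s (\<lambda>t. \<Sum>i\<in>I. c i * f i t)"
    unfolding mellin_ok_def set_integrable_def eq eq2 by (rule Bochner_Integration.integrable_sum[OF i])
  show "mellin s (\<lambda>t. \<Sum>i\<in>I. c i * f i t) = (\<Sum>i\<in>I. c i * mellin s (f i))"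
    unfolding mellin_def set_lebesgue_integral_def eq eq2 by (subst Bochner_Integration.integral_sum[OF i]) auto
qed

lemma mellin_nonneg: "(\<And>t. t > 0 \<Longrightarrow> 0 \<le> f t) \<Longrightarrow> 0 \<le> mellin s f"
  unfolding mellin_def set_lebesgue_integral_def by (intro integral_nonneg_AE) (auto simp: indicator_def)

text \<open>Interpolation made pointwise. At level \<open>h = 1\<close> the inequality \<open>ab \<le> a\<^sup>qb\<^sup>q + a\<^sup>q + b\<^sup>q\<close> is a case distinction on which
of \<open>a\<close> and \<open>b\<close> exceed \<open>1\<close>: the larger factor gains from \<open>q \<ge> 1\<close>, and if both are small then \<open>2ab \<le> a\<^sup>2 + b\<^sup>2\<close>
and \<open>q \<le> 2\<close> suffice. Scaling by \<open>h\<close> gives the general case.\<close>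

lemma product_le_powers:
  fixes f g h q :: real
  assumes "0 \<le> f" "0 \<le> g" "0 < h" "1 \<le> q" "q \<le> 2"
  shows "f * g \<le> h powr (2 - 2 * q) * (f powr q * g powr q) + h powr (2 - q) * (f powr q + g powr q)"
proof -
  have key: "a * b \<le> a powr q * b powr q + (a powr q + b powr q)" if ab: "0 \<le> a" "0 \<le> b" for a b :: real
  proof -
    have ge: "x \<le> x powr q" if "1 < x" for x :: real
      using powr_mono[of 1 q x] that assms by simp
    have sq: "x * x \<le> x powr q" if "0 \<le> x" "x \<le> 1" for x :: real
    proof (cases "x = 0")
      case False
      then have "x powr 2 \<le> x powr q" using that assms by (intro powr_mono') auto
      then show ?thesis using that False by (simp add: power2_eq_square)
    qed (use assms in simp)
    have n: "0 \<le> a powr q * b powr q" "0 \<le> a powr q" "0 \<le> b powr q" by simp_all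
    consider "1 < a" "1 < b" | "a \<le> 1" "1 < b" | "1 < a" "b \<le> 1" | "a \<le> 1" "b \<le> 1" by linarith
    then show ?thesis
    proof cases
      case 1
      then have "a * b \<le> a powr q * b powr q" using ge ab by (intro mult_mono) auto
      then show ?thesis using n by linarith
    next
      case 2
      then have "a * b \<le> 1 * b" using ab by (intro mult_right_mono) auto
      then show ?thesis using ge[of b] 2 n by linarith
    next
      case 3
      then have "a * b \<le> a * 1" using ab by (intro mult_left_mono) auto
      then show ?thesis using ge[of a] 3 n by linarith
    next
      case 4
      have "2 * a * b \<le> a\<^sup>2 + b\<^sup>2" by (rule sum_squares_bound)
      then have "2 * (a * b) \<le> a * a + b * b" by (simp add: power2_eq_square)
      moreover have "0 \<le> a * b" using ab by simp
      ultimately show ?thesis using sq[of a] sq[of b] 4 ab n by linarith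
    qed
  qed
  have hq: "h powr q \<noteq> 0" using assms by simp
  have h2: "h * h = h powr 2" using assms by (simp add: power2_eq_square)
  have e1: "h powr (2 - 2 * q) * (h powr q * h powr q) = h * h" unfolding h2 powr_add[symmetric] by simp
  have e2: "h powr (2 - q) * h powr q = h * h" unfolding h2 powr_add[symmetric] by simp
  define a b where "a = f / h" and "b = g / h"
  have ab: "0 \<le> a" "0 \<le> b" using assms by (simp_all add: a_def b_def)
  have fa: "f = a * h" "g = b * h" using assms by (simp_all add: a_def b_def)
  have fq: "f powr q = a powr q * h powr q" "g powr q = b powr q * h powr q"
    unfolding fa using ab assms by (simp_all add: powr_mult)
  have r1: "h powr (2 - 2 * q) * (f powr q * g powr q) = (h powr (2 - 2 * q) * (h powr q * h powr q)) * (a powr q * b powr q)"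
    unfolding fq by (simp only: mult_ac)
  have r2: "h powr (2 - q) * (f powr q + g powr q) = (h powr (2 - q) * h powr q) * (a powr q + b powr q)"
    unfolding fq by (simp only: algebra_simps)
  have "f * g = (h * h) * (a * b)" unfolding fa by (simp only: mult_ac)
  also have "\<dots> \<le> (h * h) * (a powr q * b powr q + (a powr q + b powr q))"
    by (intro mult_left_mono key ab) simp
  finally show ?thesis unfolding r1 r2 e1 e2 by (simp only: distrib_left)
qed

section \<open>Pairings of the heat semigroup and the Green kernel\<close>

text \<open>The exponent \<open>q\<close> is an auxiliary choice. For functions in \<open>\<ell>\<^sup>q\<close> the heat pairing decays with exponent
\<open>\<beta> = N/q - N/2\<close>, and \<open>\<alpha>/2 < \<beta>\<close> makes the time integral in the Green kernel converge at infinity.\<close>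

locale green_cayley = growth_cayley S N for S :: "'a::group_add set" and N +
  fixes \<alpha> q :: real
  assumes alpha_pos: "0 < \<alpha>" and q_gt_1: "1 < q" and q_lt_2: "q < 2"
    and alpha_lt: "\<alpha> / 2 < real N / q - real N / 2"
begin

abbreviation \<beta> :: real where "\<beta> \<equiv> real N / q - real N / 2"

definition qsum :: "('a \<Rightarrow> real) \<Rightarrow> real" where "qsum f = (\<Sum>\<^sub>\<infinity>x. \<bar>f x\<bar> powr q)"

definition lq :: "('a \<Rightarrow> real) set" where "lq = {f. (\<lambda>x. \<bar>f x\<bar> powr q) summable_on UNIV}"

lemma qsum_nonneg: "0 \<le> qsum f" by (simp add: qsum_def infsum_nonneg)

text \<open>The product \<open>f(y)g(x)\<close> is split pointwise; the part \<open>f(y)\<^sup>q g(x)\<^sup>q\<close> is summed with the uniform bound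
\<open>k\<^sub>t \<le> M\<close>, the remaining part with \<open>\<Sum>\<^sub>y k\<^sub>t(x,y) \<le> 1\<close>.\<close>

lemma heat_pairing_le:
  assumes t: "0 \<le> t" and h: "0 < h" and M: "diag t \<le> M"
    and f: "f \<in> l2" "f \<in> lq" "\<And>x. 0 \<le> f x" and g: "g \<in> l2" "g \<in> lq" "\<And>x. 0 \<le> g x"
  shows "ip (heat S t f) g \<le> M * h powr (2 - 2 * q) * (qsum f * qsum g) + h powr (2 - q) * (qsum f + qsum g)"
proof -
  define A where "A = M * h powr (2 - 2 * q)"
  define B where "B = h powr (2 - q)"
  have M0: "0 \<le> M" using M heat_kernel_nonneg[OF t, of 0 0] by linarith
  have B0: "0 \<le> B" and A0: "0 \<le> A" using M0 by (simp_all add: B_def A_def)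
  let ?k = "heat_kernel S t"
  have k0: "0 \<le> ?k x y" and k1: "?k x y \<le> 1" and kM: "?k x y \<le> M" for x y
    using heat_kernel_nonneg[OF t] heat_kernel_le_1[OF t] heat_kernel_le_diagonal[of t x y] M by auto
  have fq: "(\<lambda>y. f y powr q) summable_on UNIV" and gq: "(\<lambda>y. g y powr q) summable_on UNIV"
    using f g by (simp_all add: lq_def)
  have Qf: "qsum f = (\<Sum>\<^sub>\<infinity>y. f y powr q)" and Qg: "qsum g = (\<Sum>\<^sub>\<infinity>y. g y powr q)"
    using f(3) g(3) by (simp_all add: qsum_def)
  have kfq: "(\<lambda>y. ?k x y * f y powr q) summable_on UNIV" for x
    using fq by (rule summable_on_comparison_test) (use k0 k1 in \<open>auto intro!: mult_left_le_one_le\<close>)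
  have ks: "(\<lambda>y. ?k x y) summable_on UNIV" for x using heat_kernel_summable(1)[OF t, of x] .
  have pt: "?k x y * f y * g x \<le> A * g x powr q * f y powr q + (B * (?k x y * f y powr q) + B * g x powr q * ?k x y)" for x y
  proof -
    have "?k x y * (f y * g x) \<le> ?k x y * (h powr (2 - 2 * q) * (f y powr q * g x powr q) + B * (f y powr q + g x powr q))"
      unfolding B_def by (intro mult_left_mono product_le_powers k0 f g h) (use q_gt_1 q_lt_2 in auto)
    also have "\<dots> = ?k x y * (h powr (2 - 2 * q) * (f y powr q * g x powr q)) + ?k x y * (B * (f y powr q + g x powr q))"
      by (rule distrib_left)
    also have "\<dots> \<le> M * (h powr (2 - 2 * q) * (f y powr q * g x powr q)) + ?k x y * (B * (f y powr q + g x powr q))"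
      by (intro add_right_mono mult_right_mono kM) auto
    finally show ?thesis by (simp add: A_def algebra_simps)
  qed
  have row: "heat S t f x * g x \<le> A * g x powr q * qsum f + (B * (\<Sum>\<^sub>\<infinity>y. ?k x y * f y powr q) + B * g x powr q)" for x
  proof -
    have s: "(\<lambda>y. A * g x powr q * f y powr q + (B * (?k x y * f y powr q) + B * g x powr q * ?k x y)) summable_on UNIV"
      by (intro summable_on_add summable_on_cmult_right fq kfq ks)
    have "heat S t f x * g x = (\<Sum>\<^sub>\<infinity>y. ?k x y * f y * g x)"
      unfolding heat_eq_ip_kernel[OF f(1)] ip_def infsum_cmult_left'[symmetric] by (simp only: mult.commute mult.assoc)
    also have "\<dots> \<le> (\<Sum>\<^sub>\<infinity>y. A * g x powr q * f y powr q + (B * (?k x y * f y powr q) + B * g x powr q * ?k x y))"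
      by (intro infsum_mono pt s summable_on_comparison_test[OF s]) (use k0 f g in auto)
    also have "\<dots> = A * g x powr q * qsum f + (B * (\<Sum>\<^sub>\<infinity>y. ?k x y * f y powr q) + B * g x powr q * (\<Sum>\<^sub>\<infinity>y. ?k x y))"
      by (simp only: infsum_add summable_on_add summable_on_cmult_right fq kfq ks infsum_cmult_right' Qf)
    also have "\<dots> \<le> A * g x powr q * qsum f + (B * (\<Sum>\<^sub>\<infinity>y. ?k x y * f y powr q) + B * g x powr q)"
      using heat_kernel_summable(2)[OF t, of x] B0 by (intro add_left_mono) (simp add: mult_left_le)
    finally show ?thesis .
  qed
  have "ip (heat S t f) g \<le> A * qsum g * qsum f + (B * qsum f + B * qsum g)"
    unfolding ip_def
  proof (rule infsum_le_finite_sums)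
    show "(\<lambda>x. heat S t f x * g x) summable_on UNIV" by (intro l2_mult_summable heat_l2 f g)
    fix X :: "'a set" assume X: "finite X"
    have gX: "(\<Sum>x\<in>X. g x powr q) \<le> qsum g"
      unfolding Qg by (intro finite_sum_le_infsum gq X) auto
    have "(\<Sum>x\<in>X. \<Sum>\<^sub>\<infinity>y. ?k x y * f y powr q) = (\<Sum>\<^sub>\<infinity>y. \<Sum>x\<in>X. ?k x y * f y powr q)"
      by (rule summable_on_sum(2)[symmetric, OF X kfq])
    also have "\<dots> \<le> (\<Sum>\<^sub>\<infinity>y. f y powr q)"
    proof (rule infsum_mono)
      show "(\<lambda>y. \<Sum>x\<in>X. ?k x y * f y powr q) summable_on UNIV" by (rule summable_on_sum(1)[OF X kfq])
      fix y
      have "(\<Sum>x\<in>X. ?k x y) \<le> 1" using heat_kernel_sum_le[OF X t, of y] by (simp add: heat_kernel_sym[of t _ y])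
      then have "(\<Sum>x\<in>X. ?k x y) * f y powr q \<le> 1 * f y powr q" by (rule mult_right_mono) simp
      then show "(\<Sum>x\<in>X. ?k x y * f y powr q) \<le> f y powr q" by (simp add: sum_distrib_right)
    qed (rule fq)
    finally have kX: "(\<Sum>x\<in>X. \<Sum>\<^sub>\<infinity>y. ?k x y * f y powr q) \<le> qsum f" unfolding Qf .
    have "(\<Sum>x\<in>X. heat S t f x * g x) \<le> (\<Sum>x\<in>X. A * g x powr q * qsum f + (B * (\<Sum>\<^sub>\<infinity>y. ?k x y * f y powr q) + B * g x powr q))"
      by (rule sum_mono) (rule row)
    also have "\<dots> = A * (\<Sum>x\<in>X. g x powr q) * qsum f + (B * (\<Sum>x\<in>X. \<Sum>\<^sub>\<infinity>y. ?k x y * f y powr q) + B * (\<Sum>x\<in>X. g x powr q))"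
      by (simp only: sum.distrib sum_distrib_left sum_distrib_right)
    also have "\<dots> \<le> A * qsum g * qsum f + (B * qsum f + B * qsum g)"
      by (intro add_mono mult_right_mono mult_left_mono gX kX A0 B0 qsum_nonneg)
    finally show "(\<Sum>x\<in>X. heat S t f x * g x) \<le> A * qsum g * qsum f + (B * qsum f + B * qsum g)" .
  qed
  then show ?thesis by (simp add: A_def B_def algebra_simps)
qed

text \<open>The level \<open>h = t\<^bsup>-N/(2q)\<^esup>\<close> balances the two terms of the previous estimate: both decay like \<open>t\<^bsup>-\<beta>\<^esup>\<close>.\<close>

lemma heat_pairing_decay:
  "\<exists>C>0. \<forall>f g t. f \<in> l2 \<and> f \<in> lq \<and> (\<forall>x. 0 \<le> f x) \<and> g \<in> l2 \<and> g \<in> lq \<and> (\<forall>x. 0 \<le> g x) \<and> 0 < t \<longrightarrow>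
     ip (heat S t f) g \<le> C * (qsum f * qsum g + qsum f + qsum g) * envelope \<beta> t"
proof -
  obtain C0 where C0: "C0 > 0" "\<And>t. t > 0 \<Longrightarrow> diag t \<le> C0 * t powr (- real N / 2)" using diag_decay by blast
  define C where "C = max 1 C0"
  have C: "1 \<le> C" "C0 \<le> C" by (simp_all add: C_def)
  have "ip (heat S t f) g \<le> C * (qsum f * qsum g + qsum f + qsum g) * envelope \<beta> t"
    if f: "f \<in> l2" "f \<in> lq" "\<And>x. 0 \<le> f x" and g: "g \<in> l2" "g \<in> lq" "\<And>x. 0 \<le> g x" and t: "0 < t" for f g t
  proof -
    let ?Q1 = "qsum f * qsum g" and ?Q2 = "qsum f + qsum g"
    have Q: "0 \<le> ?Q1" "0 \<le> ?Q2" using qsum_nonneg[of f] qsum_nonneg[of g] by auto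
    show ?thesis
    proof (cases "t \<le> 1")
      case True
      have "ip (heat S t f) g \<le> 1 * 1 powr (2 - 2 * q) * ?Q1 + 1 powr (2 - q) * ?Q2"
        using heat_kernel_le_1[of t 0 0] t by (intro heat_pairing_le f g) auto
      then have "ip (heat S t f) g \<le> ?Q1 + ?Q2" by simp
      moreover have "1 * (?Q1 + ?Q2) \<le> C * (?Q1 + ?Q2)" using C Q by (intro mult_right_mono) auto
      ultimately show ?thesis using True by (simp add: envelope_def add.assoc)
    next
      case False
      define h where "h = t powr (- real N / (2 * q))"
      have h: "0 < h" using t by (simp add: h_def)
      have b: "envelope \<beta> t = t powr (- \<beta>)" using False by (simp add: envelope_def)
      have q_nz: "q \<noteq> 0" using q_gt_1 by simp
      have ex: "- real N / 2 + (- real N / (2 * q)) * (2 - 2 * q) = - \<beta>" "(- real N / (2 * q)) * (2 - q) = - \<beta>"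
        using q_nz by (simp_all add: field_simps)
      have h1: "t powr (- real N / 2) * h powr (2 - 2 * q) = t powr (- \<beta>)"
        unfolding h_def powr_powr powr_add[symmetric] ex ..
      have h2: "h powr (2 - q) = t powr (- \<beta>)"
        unfolding h_def powr_powr ex ..
      have "ip (heat S t f) g \<le> C0 * t powr (- real N / 2) * h powr (2 - 2 * q) * ?Q1 + h powr (2 - q) * ?Q2"
        using t by (intro heat_pairing_le f g h C0(2)) auto
      also have "\<dots> = C0 * (t powr (- \<beta>) * ?Q1) + t powr (- \<beta>) * ?Q2"
        unfolding h1[symmetric] h2 by (simp only: mult_ac)
      also have "\<dots> \<le> C * (t powr (- \<beta>) * ?Q1) + C * (t powr (- \<beta>) * ?Q2)"
      proof (intro add_mono mult_right_mono)
        have "1 * (t powr (- \<beta>) * ?Q2) \<le> C * (t powr (- \<beta>) * ?Q2)"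
          using C Q by (intro mult_right_mono mult_nonneg_nonneg) auto
        then show "t powr (- \<beta>) * ?Q2 \<le> C * (t powr (- \<beta>) * ?Q2)" by simp
      qed (use C Q in auto)
      finally show ?thesis unfolding b by (simp add: algebra_simps)
    qed
  qed
  moreover have "C > 0" using C by simp
  ultimately show ?thesis by blast
qed

lemma alpha_half_pos: "0 < \<alpha> / 2" using alpha_pos by simp

lemma single_lq: "single y \<in> lq"
  unfolding lq_def mem_Collect_eq
  by (rule finite_nonzero_values_imp_summable_on) (simp add: single_def)

lemma qsum_single: "qsum (single y) = 1"
proof -
  have "qsum (single y) = (\<Sum>\<^sub>\<infinity>x\<in>{y}. \<bar>single y x\<bar> powr q)"
    unfolding qsum_def by (rule infsum_cong_neutral) (auto simp: single_def)
  then show ?thesis by (simp add: single_def)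
qed

lemma heat_kernel_measurable [measurable]: "(\<lambda>t. heat_kernel S t x y) \<in> borel_measurable borel"
proof -
  have "continuous_on UNIV (\<lambda>t. heat_kernel S t x y)"
    unfolding heat_kernel_eq
    by (intro DERIV_continuous_on heat_deriv) (auto intro: has_field_derivative_at_within heat_deriv)
  then show ?thesis by (rule borel_measurable_continuous_onI)
qed

lemma heat_kernel_decay: "\<exists>C>0. \<forall>t>0. \<forall>x y. heat_kernel S t x y \<le> C * envelope \<beta> t"
proof -
  obtain C where C: "C > 0" "\<And>f g t. f \<in> l2 \<and> f \<in> lq \<and> (\<forall>x. 0 \<le> f x) \<and> g \<in> l2 \<and> g \<in> lq \<and> (\<forall>x. 0 \<le> g x) \<and> 0 < t \<Longrightarrow>
     ip (heat S t f) g \<le> C * (qsum f * qsum g + qsum f + qsum g) * envelope \<beta> t"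
    using heat_pairing_decay by blast
  have "heat_kernel S t x y \<le> (C * 3) * envelope \<beta> t" if "t > 0" for t x y
    unfolding heat_kernel_ip using C(2)[of "single y" "single x" t] that
    by (simp add: qsum_single single_lq) (simp add: single_def)
  moreover have "C * 3 > 0" using C by simp
  ultimately show ?thesis by blast
qed

lemma heat_kernel_mellin_ok: "mellin_ok (\<alpha>/2) (\<lambda>t. heat_kernel S t x y)"
proof -
  obtain C where C: "C > 0" "\<forall>t>0. \<forall>x y. heat_kernel S t x y \<le> C * envelope \<beta> t" using heat_kernel_decay by blast
  show ?thesis
    by (rule mellin_ok_bound(1)[OF _ alpha_half_pos alpha_lt, of _ C]) (use C heat_kernel_nonneg in auto)
qed

abbreviation R :: "'a \<Rightarrow> 'a \<Rightarrow> real" where "R \<equiv> green S \<alpha>"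

lemma Gamma_half_pos: "Gamma (\<alpha>/2) > 0" using alpha_pos by (simp add: Gamma_real_pos)

lemma green_mellin: "R x y = mellin (\<alpha>/2) (\<lambda>t. heat_kernel S t x y) / Gamma (\<alpha>/2)"
  using Gamma_half_pos by (simp add: green_def mellin_def)

lemma green_nonneg: "0 \<le> R x y"
  unfolding green_mellin using Gamma_half_pos
  by (intro divide_nonneg_pos mellin_nonneg) (auto simp: heat_kernel_nonneg)

lemma green_sym: "R x y = R y x"
  unfolding green_mellin using heat_kernel_sym by metis

text \<open>Integrating the decay of the heat pairing against \<open>t\<^bsup>\<alpha>/2-1\<^esup>\<close>. Over finite sets of vertices the sum and the time integral commute
trivially, and a bound on finite sums of nonnegative terms is all that summability requires.\<close>

lemma green_form_finite_bound:
  "\<exists>K>0. \<forall>X Y f g. finite X \<and> finite Y \<and> (\<forall>x. 0 \<le> f x) \<and> (\<forall>x. 0 \<le> g x) \<longrightarrow>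
     (\<Sum>x\<in>X. \<Sum>y\<in>Y. R x y * f y * g x)
       \<le> K * ((\<Sum>y\<in>Y. f y powr q) * (\<Sum>x\<in>X. g x powr q) + (\<Sum>y\<in>Y. f y powr q) + (\<Sum>x\<in>X. g x powr q))"
proof -
  obtain C where C: "C > 0" "\<And>f g t. f \<in> l2 \<and> f \<in> lq \<and> (\<forall>x. 0 \<le> f x) \<and> g \<in> l2 \<and> g \<in> lq \<and> (\<forall>x. 0 \<le> g x) \<and> 0 < t \<Longrightarrow>
     ip (heat S t f) g \<le> C * (qsum f * qsum g + qsum f + qsum g) * envelope \<beta> t"
    using heat_pairing_decay by blast
  define L where "L = mellin (\<alpha>/2) (envelope \<beta>) / Gamma (\<alpha>/2)"
  have L0: "0 \<le> L" unfolding L_def using Gamma_half_pos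
    by (intro divide_nonneg_pos mellin_nonneg envelope_nonneg)
  have "(\<Sum>x\<in>X. \<Sum>y\<in>Y. R x y * f y * g x)
       \<le> C * L * ((\<Sum>y\<in>Y. f y powr q) * (\<Sum>x\<in>X. g x powr q) + (\<Sum>y\<in>Y. f y powr q) + (\<Sum>x\<in>X. g x powr q))"
    if X: "finite X" and Y: "finite Y" and f: "\<And>x. 0 \<le> f x" and g: "\<And>x. 0 \<le> g x"
    for X Y :: "'a set" and f g :: "'a \<Rightarrow> real"
  proof -
    define f1 where "f1 = (\<lambda>y. if y \<in> Y then f y else 0)"
    define g1 where "g1 = (\<lambda>x. if x \<in> X then g x else 0)"
    have restr: "h1 \<in> l2 \<and> h1 \<in> lq \<and> (\<forall>x. 0 \<le> h1 x) \<and> qsum h1 = (\<Sum>z\<in>Z. h z powr q)"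
      if "h1 = (\<lambda>z. if z \<in> Z then h z else 0)" "finite Z" "\<And>z. 0 \<le> h z" for h1 h Z
    proof -
      have fs: "finite {z. h1 z \<noteq> 0}" by (rule finite_subset[OF _ that(2)]) (auto simp: that(1))
      have "(\<lambda>z. \<bar>h1 z\<bar> powr q) summable_on UNIV"
        by (rule finite_nonzero_values_imp_summable_on) (use fs in simp)
      moreover have "qsum h1 = (\<Sum>\<^sub>\<infinity>z\<in>Z. h z powr q)"
        unfolding qsum_def by (rule infsum_cong_neutral) (auto simp: that)
      ultimately show ?thesis using that l2_finite_support[OF fs] by (auto simp: lq_def)
    qed
    note rf = restr[OF f1_def Y f] and rg = restr[OF g1_def X g]
    define Q where "Q = qsum f1 * qsum g1 + qsum f1 + qsum g1"
    have Q: "Q = (\<Sum>y\<in>Y. f y powr q) * (\<Sum>x\<in>X. g x powr q) + (\<Sum>y\<in>Y. f y powr q) + (\<Sum>x\<in>X. g x powr q)"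
      using rf rg by (simp add: Q_def)
    have pair: "(\<Sum>z\<in>X\<times>Y. (f (snd z) * g (fst z)) * heat_kernel S t (fst z) (snd z)) = ip (heat S t f1) g1" for t
    proof -
      have "ip (heat S t f1) g1 = (\<Sum>\<^sub>\<infinity>x\<in>X. heat S t f1 x * g x)"
        unfolding ip_def by (rule infsum_cong_neutral) (auto simp: g1_def)
      also have "\<dots> = (\<Sum>x\<in>X. heat S t f1 x * g x)" using X by simp
      also have "\<dots> = (\<Sum>x\<in>X. (\<Sum>y\<in>Y. f y * heat_kernel S t x y) * g x)"
      proof (rule sum.cong[OF refl])
        fix x
        have "heat S t f1 x = (\<Sum>\<^sub>\<infinity>y\<in>Y. f y * heat_kernel S t x y)"
          using rf unfolding heat_eq_ip_kernel[OF conjunct1[OF rf]] ip_def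
          by (intro infsum_cong_neutral) (auto simp: f1_def)
        then show "heat S t f1 x * g x = (\<Sum>y\<in>Y. f y * heat_kernel S t x y) * g x" using Y by simp
      qed
      finally show ?thesis unfolding sum_distrib_right by (simp add: sum.cartesian_product case_prod_beta mult_ac)
    qed
    have "(\<Sum>x\<in>X. \<Sum>y\<in>Y. R x y * f y * g x)
        = (\<Sum>z\<in>X\<times>Y. (f (snd z) * g (fst z)) * mellin (\<alpha>/2) (\<lambda>t. heat_kernel S t (fst z) (snd z))) / Gamma (\<alpha>/2)"
      unfolding green_mellin by (simp add: sum.cartesian_product case_prod_beta sum_divide_distrib mult_ac)
    also have "\<dots> = mellin (\<alpha>/2) (\<lambda>t. ip (heat S t f1) g1) / Gamma (\<alpha>/2)"
      using mellin_sum(2)[of "X \<times> Y" "\<alpha>/2" "\<lambda>z t. heat_kernel S t (fst z) (snd z)" "\<lambda>z. f (snd z) * g (fst z)"]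
        X Y heat_kernel_mellin_ok by (simp add: pair)
    also have "\<dots> \<le> (C * Q * mellin (\<alpha>/2) (envelope \<beta>)) / Gamma (\<alpha>/2)"
    proof (intro divide_right_mono)
      have m: "(\<lambda>t. ip (heat S t f1) g1) \<in> borel_measurable borel"
        unfolding pair[symmetric] by measurable
      have "\<bar>ip (heat S t f1) g1\<bar> \<le> C * Q * envelope \<beta> t" if "t > 0" for t
      proof -
        have "0 \<le> ip (heat S t f1) g1"
          unfolding pair[symmetric] using that f g by (intro sum_nonneg mult_nonneg_nonneg heat_kernel_nonneg) auto
        moreover have "ip (heat S t f1) g1 \<le> C * Q * envelope \<beta> t"
          unfolding Q_def using rf rg that by (intro C(2)) auto
        ultimately show ?thesis by simp
      qed
      from mellin_ok_bound(2)[OF m alpha_half_pos alpha_lt this]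
      show "mellin (\<alpha>/2) (\<lambda>t. ip (heat S t f1) g1) \<le> C * Q * mellin (\<alpha>/2) (envelope \<beta>)" by linarith
    qed (use Gamma_half_pos in simp)
    finally show ?thesis unfolding Q[symmetric] L_def by (simp add: mult_ac)
  qed
  note bound = this
  have pos: "0 < C * (L + 1)" using C L0 by simp
  have le: "C * L \<le> C * (L + 1)" using C by simp
  show ?thesis
  proof (intro exI[of _ "C * (L + 1)"] conjI pos allI impI)
    fix X Y :: "'a set" and f g :: "'a \<Rightarrow> real" assume a: "finite X \<and> finite Y \<and> (\<forall>x. 0 \<le> f x) \<and> (\<forall>x. 0 \<le> g x)"
    have "0 \<le> (\<Sum>y\<in>Y. f y powr q) * (\<Sum>x\<in>X. g x powr q) + (\<Sum>y\<in>Y. f y powr q) + (\<Sum>x\<in>X. g x powr q)"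
      by (intro add_nonneg_nonneg mult_nonneg_nonneg sum_nonneg) auto
    from order_trans[OF bound mult_right_mono[OF le this]] a
    show "(\<Sum>x\<in>X. \<Sum>y\<in>Y. R x y * f y * g x)
       \<le> C * (L + 1) * ((\<Sum>y\<in>Y. f y powr q) * (\<Sum>x\<in>X. g x powr q) + (\<Sum>y\<in>Y. f y powr q) + (\<Sum>x\<in>X. g x powr q))"
      by blast
  qed
qed

end

section \<open>The convolution energy\<close>

text \<open>The condition \<open>pq > 2\<close> puts \<open>|u|\<^sup>p\<close> into \<open>\<ell>\<^sup>q\<close> for every \<open>u \<in> \<ell>\<^sup>2\<close>; strictness leaves a small power of \<open>|u|\<close> to spare,
which \<open>green_tail\<close> spends.\<close>

locale choquard = green_cayley S N \<alpha> q for S :: "'a::group_add set" and N \<alpha> q +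
  fixes p :: real
  assumes pq: "2 < p * q"
begin

lemma p_gt_1: "1 < p"
proof (rule ccontr)
  assume "\<not> 1 < p"
  then have "p * q \<le> 1 * q" using q_gt_1 by (intro mult_right_mono) auto
  then show False using pq q_lt_2 by linarith
qed

lemma l2_unit_abs_le_1: "u \<in> l2 \<Longrightarrow> ip u u \<le> 1 \<Longrightarrow> \<bar>u x\<bar> \<le> 1"
  using l2_sq_le[of u x] abs_square_le_1[of "u x"] by linarith

lemma powr_pq_le:
  assumes "\<bar>v\<bar> \<le> 1"
  shows "(\<bar>v\<bar> powr p) powr q \<le> v\<^sup>2"
proof (cases "v = 0")
  case False
  have "(\<bar>v\<bar> powr p) powr q = \<bar>v\<bar> powr (p * q)" by (rule powr_powr)
  also have "\<dots> \<le> \<bar>v\<bar> powr 2" using assms pq False by (intro powr_mono') auto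
  also have "\<dots> = v\<^sup>2" using False by simp
  finally show ?thesis .
qed simp

lemma sum_sq_le_ip: "u \<in> l2 \<Longrightarrow> finite X \<Longrightarrow> (\<Sum>x\<in>X. (u x)\<^sup>2) \<le> ip u u"
  unfolding ip_self by (intro finite_sum_le_infsum l2_square_summable) auto

lemma sum_powr_pq_le:
  assumes "u \<in> l2" "ip u u \<le> 1" "finite X"
  shows "(\<Sum>x\<in>X. (\<bar>u x\<bar> powr p) powr q) \<le> 1"
proof -
  have "(\<Sum>x\<in>X. (\<bar>u x\<bar> powr p) powr q) \<le> (\<Sum>x\<in>X. (u x)\<^sup>2)"
    by (intro sum_mono powr_pq_le l2_unit_abs_le_1 assms)
  also have "\<dots> \<le> 1" using sum_sq_le_ip[OF assms(1,3)] assms(2) by linarith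
  finally show ?thesis .
qed

lemma green_unit_bound:
  "\<exists>K>0. \<forall>u v X Y. u \<in> l2 \<and> v \<in> l2 \<and> ip u u \<le> 1 \<and> ip v v \<le> 1 \<and> finite X \<and> finite Y \<longrightarrow>
     (\<Sum>x\<in>X. \<Sum>y\<in>Y. R x y * \<bar>u y\<bar> powr p * \<bar>v x\<bar> powr p) \<le> K"
proof -
  obtain K where K: "K > 0" "\<And>X Y f g. finite X \<and> finite Y \<and> (\<forall>x. 0 \<le> f x) \<and> (\<forall>x. 0 \<le> g x) \<Longrightarrow>
     (\<Sum>x\<in>X. \<Sum>y\<in>Y. R x y * f y * g x)
       \<le> K * ((\<Sum>y\<in>Y. f y powr q) * (\<Sum>x\<in>X. g x powr q) + (\<Sum>y\<in>Y. f y powr q) + (\<Sum>x\<in>X. g x powr q))"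
    using green_form_finite_bound by blast
  have "(\<Sum>x\<in>X. \<Sum>y\<in>Y. R x y * \<bar>u y\<bar> powr p * \<bar>v x\<bar> powr p) \<le> K * 3"
    if uv: "u \<in> l2" "v \<in> l2" "ip u u \<le> 1" "ip v v \<le> 1" and XY: "finite X" "finite Y" for u v X Y
  proof -
    let ?a = "\<Sum>y\<in>Y. (\<bar>u y\<bar> powr p) powr q" and ?b = "\<Sum>x\<in>X. (\<bar>v x\<bar> powr p) powr q"
    have ab: "0 \<le> ?a" "?a \<le> 1" "0 \<le> ?b" "?b \<le> 1"
      using sum_powr_pq_le uv XY by (auto intro: sum_nonneg)
    have "(\<Sum>x\<in>X. \<Sum>y\<in>Y. R x y * \<bar>u y\<bar> powr p * \<bar>v x\<bar> powr p) \<le> K * (?a * ?b + ?a + ?b)"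
      using XY by (intro K(2)) auto
    also have "?a * ?b \<le> 1 * 1" using ab by (intro mult_mono) auto
    then have "K * (?a * ?b + ?a + ?b) \<le> K * 3" using ab K(1) by (intro mult_left_mono) auto
    finally show ?thesis .
  qed
  moreover have "K * 3 > 0" using K by simp
  ultimately show ?thesis by blast
qed

lemma l2_eq_0: "u \<in> l2 \<Longrightarrow> ip u u = 0 \<Longrightarrow> u x = 0"
  using l2_sq_le[of u x] by simp

text \<open>On the unit ball of \<open>\<ell>\<^sup>2\<close> the \<open>\<ell>\<^sup>q\<close> sums of \<open>|u|\<^sup>p\<close> are at most \<open>1\<close>; homogeneity extends the resulting bound to all of
\<open>\<ell>\<^sup>2\<close>.\<close>

lemma green_bound:
  "\<exists>K>0. \<forall>u v X Y. u \<in> l2 \<and> v \<in> l2 \<and> finite X \<and> finite Y \<longrightarrow>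
     (\<Sum>x\<in>X. \<Sum>y\<in>Y. R x y * \<bar>u y\<bar> powr p * \<bar>v x\<bar> powr p) \<le> K * (ip u u powr (p/2) * ip v v powr (p/2))"
proof -
  obtain K where K: "K > 0" "\<And>u v X Y. u \<in> l2 \<and> v \<in> l2 \<and> ip u u \<le> 1 \<and> ip v v \<le> 1 \<and> finite X \<and> finite Y \<Longrightarrow>
     (\<Sum>x\<in>X. \<Sum>y\<in>Y. R x y * \<bar>u y\<bar> powr p * \<bar>v x\<bar> powr p) \<le> K" using green_unit_bound by blast
  have "(\<Sum>x\<in>X. \<Sum>y\<in>Y. R x y * \<bar>u y\<bar> powr p * \<bar>v x\<bar> powr p) \<le> K * (ip u u powr (p/2) * ip v v powr (p/2))"
    if uv: "u \<in> l2" "v \<in> l2" and XY: "finite X" "finite Y" for u v X Y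
  proof (cases "ip u u = 0 \<or> ip v v = 0")
    case True
    then have "R x y * \<bar>u y\<bar> powr p * \<bar>v x\<bar> powr p = 0" for x y
      using l2_eq_0[OF uv(1), of y] l2_eq_0[OF uv(2), of x] by auto
    then have "(\<Sum>x\<in>X. \<Sum>y\<in>Y. R x y * \<bar>u y\<bar> powr p * \<bar>v x\<bar> powr p) = 0"
      by (intro sum.neutral ballI) auto
    then show ?thesis using K(1) by simp
  next
    case False
    define a b where "a = sqrt (ip u u)" and "b = sqrt (ip v v)"
    have ab: "a > 0" "b > 0" using False ip_nonneg[of u] ip_nonneg[of v] by (auto simp: a_def b_def less_le)
    have nrm: "(\<lambda>x. 1 / c * w x) \<in> l2 \<and> ip (\<lambda>x. 1 / c * w x) (\<lambda>x. 1 / c * w x) \<le> 1"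
      if "w \<in> l2" "c > 0" "c = sqrt (ip w w)" for w :: "'a \<Rightarrow> real" and c
    proof
      have "c * c = ip w w" using that ip_nonneg[of w] by simp
      then show "ip (\<lambda>x. 1 / c * w x) (\<lambda>x. 1 / c * w x) \<le> 1"
        unfolding ip_cmult ip_cmult2 using that(2) by (metis divide_self_if less_irrefl mult.commute
          nonzero_divide_mult_cancel_right order_refl times_divide_eq_left mult_1)
    qed (rule l2_cmult[OF that(1)])
    have pw: "\<bar>w\<bar> powr p = c powr p * \<bar>1 / c * w\<bar> powr p" if "c > 0" for c w :: real
      using that powr_mult[of c "\<bar>1 / c * w\<bar>" p] by (simp add: abs_mult)
    have half: "sqrt (ip w w) powr p = ip w w powr (p/2)" if "ip w w \<noteq> 0" for w :: "'a \<Rightarrow> real"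
      using that ip_nonneg[of w] powr_half_sqrt[of "ip w w"] powr_powr[of "ip w w" "1/2" p] by simp
    have "(\<Sum>x\<in>X. \<Sum>y\<in>Y. R x y * \<bar>u y\<bar> powr p * \<bar>v x\<bar> powr p)
      = (a powr p * b powr p) * (\<Sum>x\<in>X. \<Sum>y\<in>Y. R x y * \<bar>1 / a * u y\<bar> powr p * \<bar>1 / b * v x\<bar> powr p)"
      unfolding pw[OF ab(1), of "u _"] pw[OF ab(2), of "v _"] sum_distrib_left by (simp only: mult_ac)
    also have "\<dots> \<le> (a powr p * b powr p) * K"
      using nrm[OF uv(1) ab(1) a_def] nrm[OF uv(2) ab(2) b_def] XY by (intro mult_left_mono K(2)) auto
    finally show ?thesis using half False by (simp add: a_def b_def mult_ac)
  qed
  with K(1) show ?thesis by blast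
qed

definition form_const :: real where
  "form_const = (SOME K. K > 0 \<and> (\<forall>u v X Y. u \<in> l2 \<and> v \<in> l2 \<and> finite X \<and> finite Y \<longrightarrow>
     (\<Sum>x\<in>X. \<Sum>y\<in>Y. R x y * \<bar>u y\<bar> powr p * \<bar>v x\<bar> powr p) \<le> K * (ip u u powr (p/2) * ip v v powr (p/2))))"

lemma form_const: "form_const > 0" "u \<in> l2 \<Longrightarrow> v \<in> l2 \<Longrightarrow> finite X \<Longrightarrow> finite Y \<Longrightarrow>
     (\<Sum>x\<in>X. \<Sum>y\<in>Y. R x y * \<bar>u y\<bar> powr p * \<bar>v x\<bar> powr p) \<le> form_const * (ip u u powr (p/2) * ip v v powr (p/2))"
  using someI_ex[OF green_bound[unfolded]] unfolding form_const_def[symmetric] by blast+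

definition R0 :: "'a \<Rightarrow> 'a \<Rightarrow> real" where "R0 x y = (if x = y then 0 else R x y)"

lemma R0_nonneg: "0 \<le> R0 x y" and R0_le: "R0 x y \<le> R x y" and R0_sym: "R0 x y = R0 y x"
  using green_nonneg green_sym by (auto simp: R0_def)

definition form :: "('a \<Rightarrow> real) \<Rightarrow> ('a \<Rightarrow> real) \<Rightarrow> real" where
  "form f g = (\<Sum>\<^sub>\<infinity>(x, y). R0 x y * f y * g x)"

abbreviation pow :: "('a \<Rightarrow> real) \<Rightarrow> 'a \<Rightarrow> real" where "pow u \<equiv> (\<lambda>x. \<bar>u x\<bar> powr p)"

lemma pairs_bound:
  assumes "u \<in> l2" "v \<in> l2" "finite Z" "\<And>x y. 0 \<le> c x y" "\<And>x y. c x y \<le> R x y"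
  shows "(\<Sum>(x, y)\<in>Z. c x y * pow u y * pow v x) \<le> form_const * (ip u u powr (p/2) * ip v v powr (p/2))"
proof -
  have "(\<Sum>(x, y)\<in>Z. c x y * pow u y * pow v x) \<le> (\<Sum>(x, y)\<in>fst ` Z \<times> snd ` Z. R x y * pow u y * pow v x)"
  proof (rule order_trans[OF sum_mono sum_mono2])
    fix z assume "z \<in> Z"
    show "(case z of (x, y) \<Rightarrow> c x y * pow u y * pow v x) \<le> (case z of (x, y) \<Rightarrow> R x y * pow u y * pow v x)"
      using assms(5)[of "fst z" "snd z"] unfolding case_prod_beta by (intro mult_right_mono) auto
  next
    show "Z \<subseteq> fst ` Z \<times> snd ` Z" by force
  qed (use assms(3) green_nonneg in auto)
  also have "\<dots> = (\<Sum>x\<in>fst ` Z. \<Sum>y\<in>snd ` Z. R x y * pow u y * pow v x)"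
    by (simp add: sum.cartesian_product)
  also have "\<dots> \<le> form_const * (ip u u powr (p/2) * ip v v powr (p/2))" using assms by (intro form_const(2)) auto
  finally show ?thesis .
qed

lemma form_summable:
  assumes "u \<in> l2" "v \<in> l2"
  shows "(\<lambda>(x, y). R0 x y * pow u y * pow v x) summable_on UNIV"
  by (rule summable_on_bounded_sums(1)[OF pairs_bound[OF assms]]) (auto simp: R0_nonneg R0_le)

lemma form_le:
  assumes "u \<in> l2" "v \<in> l2"
  shows "form (pow u) (pow v) \<le> form_const * (ip u u powr (p/2) * ip v v powr (p/2))"
  unfolding form_def
  by (rule summable_on_bounded_sums(2)[OF pairs_bound[OF assms]]) (auto simp: R0_nonneg R0_le)

lemma form_nonneg: "0 \<le> form (pow u) (pow v)"
  unfolding form_def by (intro infsum_nonneg) (auto simp: R0_nonneg)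

lemma green_conv_R0: "green_conv S \<alpha> f x = (\<Sum>\<^sub>\<infinity>y. R0 x y * f y)"
  unfolding green_conv_def by (rule infsum_cong_neutral) (auto simp: R0_def)

lemma form_iterated:
  assumes "u \<in> l2" "v \<in> l2"
  shows "form (pow u) (pow v) = (\<Sum>\<^sub>\<infinity>x. green_conv S \<alpha> (pow u) x * pow v x)"
proof -
  have "(\<Sum>\<^sub>\<infinity>x. \<Sum>\<^sub>\<infinity>y. R0 x y * pow u y * pow v x) = form (pow u) (pow v)"
    unfolding form_def using infsum_Sigma'_banach[of "\<lambda>x y. R0 x y * pow u y * pow v x" UNIV "\<lambda>_. UNIV"]
      form_summable[OF assms] by simp
  then show ?thesis by (simp add: green_conv_R0 infsum_cmult_left')
qed

lemma form_sym: "form f g = form g f"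
proof -
  have "form f g = (\<Sum>\<^sub>\<infinity>z. (\<lambda>(x, y). R0 x y * f y * g x) (prod.swap z))"
    unfolding form_def
    by (rule infsum_reindex_bij_betw[symmetric]) (rule bij_betwI[where g = prod.swap], auto)
  also have "\<dots> = form g f"
    unfolding form_def by (intro infsum_cong) (auto simp: R0_sym mult_ac)
  finally show ?thesis .
qed

lemma pow_single: "pow (single z) = single z" "\<bar>single z x\<bar> powr p = single z x"
  by (auto simp: single_def)

lemma form_single:
  assumes "u \<in> l2"
  shows "form (pow u) (single z) = green_conv S \<alpha> (pow u) z"
proof -
  have "form (pow u) (pow (single z)) = ip (green_conv S \<alpha> (pow u)) (single z)"
    unfolding form_iterated[OF assms l2_single] unfolding pow_single ip_def ..
  then show ?thesis unfolding pow_single(1) by simp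
qed

lemma form_single_single: "form (single z) (single z) = 0"
  unfolding form_def by (rule infsum_0) (auto simp: single_def R0_def)

text \<open>With the diagonal omitted, a change at \<open>z\<close> does not interact with itself: the term quadratic in the change vanishes and
the formula is exact.\<close>

lemma form_change_one_site:
  assumes u: "u \<in> l2" and w: "\<And>x. x \<noteq> z \<Longrightarrow> w x = u x"
  shows "form (pow w) (pow w) = form (pow u) (pow u) + 2 * (pow w z - pow u z) * green_conv S \<alpha> (pow u) z"
proof -
  define d where "d = pow w z - pow u z"
  have pw: "pow w = (\<lambda>x. pow u x + d * single z x)"
    using w by (auto simp: d_def single_def)
  let ?h = "\<lambda>f g z. (\<lambda>(x, y). R0 x y * f y * g x) z"
  have s1: "?h (pow u) (pow u) summable_on UNIV" using form_summable[OF u u] .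
  have s2: "?h (pow u) (single z) summable_on UNIV" using form_summable[OF u l2_single[of z]] unfolding pow_single .
  have s3: "?h (single z) (pow u) summable_on UNIV" using form_summable[OF l2_single[of z] u] unfolding pow_single .
  have s4: "?h (single z) (single z) summable_on UNIV"
    using form_summable[OF l2_single[of z] l2_single[of z]] unfolding pow_single .
  have "form (pow w) (pow w) = (\<Sum>\<^sub>\<infinity>xy. ?h (pow u) (pow u) xy + (d * ?h (pow u) (single z) xy
      + (d * ?h (single z) (pow u) xy + d\<^sup>2 * ?h (single z) (single z) xy)))"
    unfolding form_def pw
    by (intro infsum_cong) (auto simp: algebra_simps power2_eq_square)
  also have "\<dots> = form (pow u) (pow u) + (d * form (pow u) (single z) + (d * form (single z) (pow u) + d\<^sup>2 * form (single z) (single z)))"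
    unfolding form_def
    by (simp only: infsum_add summable_on_add summable_on_cmult_right s1 s2 s3 s4 infsum_cmult_right')
  also have "form (single z) (pow u) = form (pow u) (single z)" by (rule form_sym)
  finally show ?thesis by (simp add: form_single[OF u] form_single_single d_def algebra_simps)
qed

lemma form_scale: "form (pow (\<lambda>x. c * u x)) (pow (\<lambda>x. c * u x)) = (\<bar>c\<bar> powr p)\<^sup>2 * form (pow u) (pow u)"
proof -
  have "form (pow (\<lambda>x. c * u x)) (pow (\<lambda>x. c * u x)) = (\<Sum>\<^sub>\<infinity>z. (\<bar>c\<bar> powr p)\<^sup>2 * (case z of (x, y) \<Rightarrow> R0 x y * pow u y * pow u x))"
    unfolding form_def
    by (intro infsum_cong) (auto simp: abs_mult powr_mult power2_eq_square)
  then show ?thesis by (simp only: infsum_cmult_right' form_def)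
qed

text \<open>Where \<open>|v| \<le> \<eta>\<close>, the spare power \<open>|v|\<^sup>r\<close> with \<open>r = p - 2/q\<close> is small and the rest is bounded by the \<open>\<ell>\<^sup>q\<close> estimate for a single
row. Where \<open>|v| > \<eta>\<close>, there are at most \<open>\<eta>\<^bsup>-2\<^esup>\<close> sites, and off the finite set \<open>{y. R x y > \<delta>}\<close> each contributes at
most \<open>\<delta>\<close>. The finite set depends only on \<open>x\<close> and \<open>\<epsilon>\<close>, which makes the statement uniform in \<open>v\<close>.\<close>

lemma green_tail:
  assumes "\<epsilon> > 0"
  shows "\<exists>F. finite F \<and> (\<forall>v Y. v \<in> l2 \<and> ip v v \<le> 1 \<and> finite Y \<and> Y \<inter> F = {} \<longrightarrow> (\<Sum>y\<in>Y. R x y * pow v y) \<le> \<epsilon>)"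
proof -
  obtain K where K: "K > 0" "\<And>X Y f g. finite X \<and> finite Y \<and> (\<forall>x. 0 \<le> f x) \<and> (\<forall>x. 0 \<le> g x) \<Longrightarrow>
     (\<Sum>x\<in>X. \<Sum>y\<in>Y. R x y * f y * g x)
       \<le> K * ((\<Sum>y\<in>Y. f y powr q) * (\<Sum>x\<in>X. g x powr q) + (\<Sum>y\<in>Y. f y powr q) + (\<Sum>x\<in>X. g x powr q))"
    using green_form_finite_bound by blast
  have row: "(\<Sum>y\<in>Y. R x y * f y) \<le> K * (2 * (\<Sum>y\<in>Y. f y powr q) + 1)" if "finite Y" "\<And>y. 0 \<le> f y" for Y f
    using K(2)[of "{x}" Y f "\<lambda>_. 1"] that by simp
  define r where "r = p - 2 / q"
  have r: "r > 0" using pq q_gt_1 by (simp add: r_def field_simps)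
  have fin: "finite {y. R x y > \<delta>}" if \<delta>: "\<delta> > 0" for \<delta>
  proof (rule ccontr)
    assume inf: "infinite {y. R x y > \<delta>}"
    \<comment> \<open>Test the row estimate on \<open>h\<close> times the indicator of \<open>n\<close> sites; this \<open>h\<close> lets half of the left side be absorbed.\<close>
    define h where "h = (\<delta> / (4 * K)) powr (1 / (q - 1))"
    have h: "h > 0" using \<delta> K by (simp add: h_def)
    have hq1: "h powr (q - 1) = \<delta> / (4 * K)" unfolding h_def powr_powr using q_gt_1 \<delta> K by simp
    have hq: "h powr q = h * (\<delta> / (4 * K))" using powr_add[of h 1 "q - 1"] h by (simp add: hq1)
    obtain n :: nat where n: "real n > 2 * K / (\<delta> * h)" using reals_Archimedean2 by blast
    obtain Y where Y: "Y \<subseteq> {y. R x y > \<delta>}" "finite Y" "card Y = n"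
      using infinite_arbitrarily_large[OF inf] by metis
    have "real n * (\<delta> * h) = (\<Sum>y\<in>Y. \<delta> * h)" using Y by simp
    also have "\<dots> \<le> (\<Sum>y\<in>Y. R x y * h)" using Y h by (intro sum_mono mult_right_mono) auto
    also have "\<dots> \<le> K * (2 * (\<Sum>y\<in>Y. h powr q) + 1)" using Y h by (intro row) auto
    also have "\<dots> = real n * (\<delta> * h) / 2 + K" using Y K by (simp add: hq field_simps)
    finally have "real n * (\<delta> * h) \<le> 2 * K" by simp
    then show False using n \<delta> h by (simp add: field_simps)
  qed
  define \<eta> where "\<eta> = (\<epsilon> / (6 * K)) powr (1 / r)"
  have \<eta>: "\<eta> > 0" using assms K by (simp add: \<eta>_def)
  have \<eta>r: "\<eta> powr r = \<epsilon> / (6 * K)" unfolding \<eta>_def powr_powr using r assms K by simp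
  define \<delta> where "\<delta> = \<epsilon> / 2 * \<eta>\<^sup>2"
  have \<delta>: "\<delta> > 0" using assms \<eta> by (simp add: \<delta>_def)
  define F where "F = {y. R x y > \<delta>}"
  have "(\<Sum>y\<in>Y. R x y * pow v y) \<le> \<epsilon>" if v: "v \<in> l2" "ip v v \<le> 1" and Y: "finite Y" "Y \<inter> F = {}" for v Y
  proof -
    have v1: "\<bar>v y\<bar> \<le> 1" for y using l2_unit_abs_le_1[OF v] .
    have pt: "R x y * pow v y \<le> \<eta> powr r * (R x y * \<bar>v y\<bar> powr (2 / q)) + \<delta> / \<eta>\<^sup>2 * (v y)\<^sup>2" if "y \<in> Y" for y
    proof (cases "\<bar>v y\<bar> \<le> \<eta>")
      case True
      have "\<bar>v y\<bar> powr p = \<bar>v y\<bar> powr r * \<bar>v y\<bar> powr (2 / q)" by (simp add: r_def powr_add[symmetric])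
      also have "\<dots> \<le> \<eta> powr r * \<bar>v y\<bar> powr (2 / q)"
        using True r by (intro mult_right_mono powr_mono2) auto
      finally have "R x y * pow v y \<le> R x y * (\<eta> powr r * \<bar>v y\<bar> powr (2 / q))"
        by (rule mult_left_mono) (rule green_nonneg)
      moreover have "0 \<le> \<delta> / \<eta>\<^sup>2 * (v y)\<^sup>2" using \<delta> by simp
      ultimately show ?thesis by (simp add: mult.left_commute)
    next
      case False
      have "pow v y \<le> 1" using v1[of y] p_gt_1 by (intro powr_le1) auto
      moreover have "1 \<le> (v y)\<^sup>2 / \<eta>\<^sup>2"
      proof -
        have "\<eta>\<^sup>2 \<le> \<bar>v y\<bar>\<^sup>2" using False \<eta> by (intro power_mono) auto
        then show ?thesis using \<eta> by simp
      qed
      ultimately have "pow v y \<le> (v y)\<^sup>2 / \<eta>\<^sup>2" by linarith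
      moreover have "R x y \<le> \<delta>" using Y that by (auto simp: F_def)
      ultimately have "R x y * pow v y \<le> \<delta> * ((v y)\<^sup>2 / \<eta>\<^sup>2)" using \<delta> by (intro mult_mono) auto
      moreover have "0 \<le> \<eta> powr r * (R x y * \<bar>v y\<bar> powr (2 / q))" using green_nonneg by simp
      ultimately show ?thesis by simp
    qed
    have vq: "(\<bar>v y\<bar> powr (2 / q)) powr q = (v y)\<^sup>2" for y
      unfolding powr_powr using q_gt_1 by simp
    have sq: "(\<Sum>y\<in>Y. (v y)\<^sup>2) \<le> 1" using sum_sq_le_ip[OF v(1) Y(1)] v(2) by linarith
    have "(\<Sum>y\<in>Y. R x y * pow v y) \<le> (\<Sum>y\<in>Y. \<eta> powr r * (R x y * \<bar>v y\<bar> powr (2 / q)) + \<delta> / \<eta>\<^sup>2 * (v y)\<^sup>2)"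
      by (rule sum_mono[OF pt])
    also have "\<dots> = \<eta> powr r * (\<Sum>y\<in>Y. R x y * \<bar>v y\<bar> powr (2 / q)) + \<delta> / \<eta>\<^sup>2 * (\<Sum>y\<in>Y. (v y)\<^sup>2)"
      by (simp only: sum.distrib sum_distrib_left)
    also have "\<dots> \<le> \<eta> powr r * (K * 3) + \<delta> / \<eta>\<^sup>2 * 1"
    proof (intro add_mono mult_left_mono)
      have "(\<Sum>y\<in>Y. R x y * \<bar>v y\<bar> powr (2 / q)) \<le> K * (2 * (\<Sum>y\<in>Y. (\<bar>v y\<bar> powr (2 / q)) powr q) + 1)"
        by (rule row[OF Y(1)]) simp
      also have "\<dots> \<le> K * 3" unfolding vq using sq K by (intro mult_left_mono) auto
      finally show "(\<Sum>y\<in>Y. R x y * \<bar>v y\<bar> powr (2 / q)) \<le> K * 3" .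
    qed (use sq \<delta> in auto)
    also have "\<dots> = \<epsilon>" unfolding \<eta>r \<delta>_def using \<eta> K by simp
    finally show ?thesis .
  qed
  with fin[OF \<delta>] show ?thesis unfolding F_def[symmetric] by blast
qed

text \<open>The term of order one in the series for \<open>e\<^bsup>tA\<^esup>\<close> already reaches a neighbour, so the kernel there is positive for all \<open>t > 0\<close>.\<close>

lemma green_pos_neighbour:
  assumes s: "s \<in> S" "s \<noteq> 0"
  shows "R x (x + s) > 0"
proof -
  let ?y = "x + s"
  have kpos: "heat_kernel S t x ?y > 0" if t: "t > 0" for t
  proof -
    have M: "geom_bounded (\<lambda>n. (nbr_sum ^^ n) (single ?y) x) 1 deg"
      by (rule nbr_pow_geom) (simp add: single_def)
    have nn: "0 \<le> t ^ n / fact n * (nbr_sum ^^ n) (single ?y) x" for n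
      using t nbr_pow_nonneg[of "single ?y" n x] by (simp add: single_def)
    have "1 \<le> nbr_sum (single ?y) x"
    proof -
      have "single ?y (x + s) \<le> nbr_sum (single ?y) x"
        unfolding nbr_sum_def using s finite_S by (intro member_le_sum) (auto simp: single_def)
      then show ?thesis by (simp add: single_def)
    qed
    then have "0 < t ^ 1 / fact 1 * (nbr_sum ^^ 1) (single ?y) x" using t by simp
    then have "0 < egf (\<lambda>n. (nbr_sum ^^ n) (single ?y) x) t"
      unfolding egf_def by (rule suminf_pos2[OF egf_summable[OF M] nn])
    then show ?thesis unfolding heat_kernel_eq heat_nbr[OF bdd_single] by simp
  qed
  have "mellin (\<alpha>/2) (\<lambda>t. heat_kernel S t x ?y) \<noteq> 0"
  proof
    let ?f = "\<lambda>t. indicator {0<..} t *\<^sub>R (heat_kernel S t x ?y * t powr (- 1 + \<alpha>/2))"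
    assume "mellin (\<alpha>/2) (\<lambda>t. heat_kernel S t x ?y) = 0"
    then have "integral\<^sup>L lborel ?f = 0" by (simp only: mellin_def set_lebesgue_integral_def)
    moreover have "integrable lborel ?f"
      using heat_kernel_mellin_ok[of x ?y] by (simp only: mellin_ok_def set_integrable_def)
    moreover have "AE t in lborel. 0 \<le> ?f t" by (auto simp: indicator_def heat_kernel_nonneg)
    ultimately have "AE t in lborel. ?f t = 0" by (simp only: integral_nonneg_eq_0_iff_AE)
    then have "AE t in lborel. t \<notin> {0::real<..}"
    proof (rule AE_mp, intro AE_I2 impI)
      fix t assume "?f t = 0"
      then show "t \<notin> {0::real<..}" using kpos[of t] by (auto simp: indicator_def split: if_splits)
    qed
    then have "{0::real<..} \<in> null_sets lborel" by (subst (asm) AE_iff_null) (auto simp: greaterThan_def)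
    then have "{0<..1::real} \<in> null_sets lborel" by (rule null_sets_subset) auto
    then show False by (auto simp: null_sets_def)
  qed
  then have "R x ?y \<noteq> 0" unfolding green_mellin using Gamma_half_pos by simp
  then show ?thesis using green_nonneg[of x ?y] by simp
qed

text \<open>Otherwise the group would be trivial, which contradicts unbounded volume growth.\<close>

lemma nonzero_generator: "\<exists>s\<in>S. s \<noteq> 0"
proof (rule ccontr)
  assume "\<not> (\<exists>s\<in>S. s \<noteq> 0)"
  then have S0: "s = 0" if "s \<in> S" for s using that by blast
  have all0: "x = 0" for x :: 'a
  proof -
    obtain xs where xs: "set xs \<subseteq> S" "sum_list xs = x" using gen unfolding generating_set_def by blast
    have "sum_list xs = 0" using xs(1) by (induction xs) (auto dest: S0)
    then show ?thesis using xs by simp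
  qed
  obtain C1 where C1: "C1 > 0" "\<And>r. r \<ge> 1 \<Longrightarrow> C1 * r ^ N \<le> real (card (word_ball S 0 r))"
    using dim unfolding homogeneous_dim_def by blast
  define r where "r = max 1 (2 / C1)"
  have r: "r \<ge> 1" "C1 * r \<ge> 2"
  proof -
    have "C1 * (2 / C1) \<le> C1 * r" using C1 by (intro mult_left_mono) (auto simp: r_def)
    then show "C1 * r \<ge> 2" using C1 by simp
  qed (simp add: r_def)
  have "r ^ 1 \<le> r ^ N" using r N_ge_2 by (intro power_increasing) auto
  then have "C1 * r \<le> C1 * r ^ N" using C1 by simp
  then have "2 \<le> real (card (word_ball S 0 r))" using C1(2)[OF r(1)] r(2) by linarith
  moreover have "card (word_ball S 0 r) \<le> card {0::'a}" using all0 by (intro card_mono) auto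
  ultimately show False by simp
qed

end

section \<open>Compactness and the maximiser\<close>

definition restr :: "'a set \<Rightarrow> ('a \<Rightarrow> real) \<Rightarrow> 'a \<Rightarrow> real" where
  "restr F u = (\<lambda>x. if x \<in> F then u x else 0)"

lemma restr_l2: "u \<in> l2 \<Longrightarrow> restr F u \<in> l2"
  by (erule l2_comparison) (simp add: restr_def)

lemma ip_restr_finite: "finite F \<Longrightarrow> ip (restr F u) (restr F u) = (\<Sum>x\<in>F. (u x)\<^sup>2)"
proof -
  assume "finite F"
  moreover have "ip (restr F u) (restr F u) = (\<Sum>\<^sub>\<infinity>x\<in>F. (u x)\<^sup>2)"
    unfolding ip_self by (rule infsum_cong_neutral) (auto simp: restr_def)
  ultimately show ?thesis by simp
qed

lemma infsum_compl_finite: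
  fixes f :: "'b \<Rightarrow> real"
  assumes "f summable_on UNIV" "finite F"
  shows "infsum f (- F) = infsum f UNIV - sum f F"
proof -
  have "infsum f (UNIV - F) = infsum f UNIV - infsum f F"
    using assms by (intro infsum_Diff) auto
  then show ?thesis using assms by (simp add: Compl_eq_Diff_UNIV)
qed

lemma infsum_tail:
  fixes f :: "'b \<Rightarrow> real"
  assumes "f summable_on UNIV" "\<And>x. 0 \<le> f x" "\<epsilon> > 0"
  shows "\<exists>F. finite F \<and> (\<forall>F'. finite F' \<longrightarrow> F \<subseteq> F' \<longrightarrow> infsum f UNIV - sum f F' \<le> \<epsilon>)"
proof -
  obtain F where F: "finite F" "dist (sum f F) (infsum f UNIV) \<le> \<epsilon>"
    using infsum_finite_approximation[OF assms(1,3)] by blast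
  have "infsum f UNIV - sum f F' \<le> \<epsilon>" if "finite F'" "F \<subseteq> F'" for F'
  proof -
    have "sum f F \<le> sum f F'" using that assms(2) by (intro sum_mono2) auto
    then show ?thesis using F(2) by (simp add: dist_real_def)
  qed
  with F(1) show ?thesis by blast
qed

lemma ip_restr_compl:
  assumes "u \<in> l2" "finite F"
  shows "ip (restr (- F) u) (restr (- F) u) = ip u u - (\<Sum>x\<in>F. (u x)\<^sup>2)"
proof -
  have "ip (restr (- F) u) (restr (- F) u) = (\<Sum>\<^sub>\<infinity>x\<in>-F. (u x)\<^sup>2)"
    unfolding ip_self by (rule infsum_cong_neutral) (auto simp: restr_def)
  then show ?thesis unfolding ip_self using infsum_compl_finite[OF l2_square_summable[OF assms(1)] assms(2)] by simp
qed

text \<open>One value \<open>l\<close> of the parameter \<open>\<lambda>\<close> is fixed. The squared norm of \<open>E\<close> is a sum of a nonnegative density over the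
vertices, which allows its mass to be tracked on finite sets.\<close>

locale potential_well = choquard S N \<alpha> q p for S :: "'a::group_add set" and N \<alpha> q p +
  fixes a :: "'a \<Rightarrow> real" and l :: real
  assumes a_nonneg: "\<And>x. 0 \<le> a x" and l_pos: "0 < l"
begin

definition density :: "('a \<Rightarrow> real) \<Rightarrow> 'a \<Rightarrow> real" where
  "density u x = (lap S u x)\<^sup>2 + grad_prod S u u x + (1 + l * a x) * (u x)\<^sup>2"

definition norm_sq :: "('a \<Rightarrow> real) \<Rightarrow> real" where "norm_sq u = (\<Sum>\<^sub>\<infinity>x. density u x)"

definition Efun :: "('a \<Rightarrow> real) set" where
  "Efun = {u \<in> l2. (\<lambda>x. l * a x * (u x)\<^sup>2) summable_on UNIV}"

lemma potential_nonneg: "0 \<le> l * a x" using a_nonneg l_pos by simp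

lemma density_nonneg: "0 \<le> density u x"
  unfolding density_def using potential_nonneg[of x] grad_prod_nonneg[of u x] by simp

lemma weighted_sq_le_density: "(1 + l * a x) * (u x)\<^sup>2 \<le> density u x"
  unfolding density_def using grad_prod_nonneg[of u x] by simp

lemma sq_le_density: "(u x)\<^sup>2 \<le> density u x" and potential_le_density: "l * a x * (u x)\<^sup>2 \<le> density u x"
proof -
  have "0 \<le> l * a x * (u x)\<^sup>2" "0 \<le> (u x)\<^sup>2" using potential_nonneg[of x] by simp_all
  then show "(u x)\<^sup>2 \<le> density u x" "l * a x * (u x)\<^sup>2 \<le> density u x"
    using weighted_sq_le_density[of x u] unfolding distrib_right by linarith+
qed

lemma W22_summable: "u \<in> l2 \<Longrightarrow> (\<lambda>x. (lap S u x)\<^sup>2 + grad_prod S u u x + (u x)\<^sup>2) summable_on UNIV"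
  by (intro summable_on_add l2_square_summable lap_l2 summable_grad)

lemma Efun_l2: "u \<in> Efun \<Longrightarrow> u \<in> l2" by (simp add: Efun_def)

lemma density_summable: "u \<in> Efun \<Longrightarrow> density u summable_on UNIV"
proof -
  assume u: "u \<in> Efun"
  then have "(\<lambda>x. ((lap S u x)\<^sup>2 + grad_prod S u u x + (u x)\<^sup>2) + l * a x * (u x)\<^sup>2) summable_on UNIV"
    by (intro summable_on_add[OF W22_summable]) (auto simp: Efun_def)
  then show ?thesis by (simp add: density_def[abs_def] distrib_right add.assoc)
qed

lemma Efun_if_summable: "density u summable_on UNIV \<Longrightarrow> u \<in> Efun"
proof -
  assume s: "density u summable_on UNIV"
  have "(\<lambda>x. (u x)\<^sup>2) summable_on UNIV" by (rule summable_on_comparison_test[OF s sq_le_density]) simp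
  moreover have "(\<lambda>x. l * a x * (u x)\<^sup>2) summable_on UNIV"
    by (rule summable_on_comparison_test[OF s potential_le_density]) (use potential_nonneg in auto)
  ultimately show ?thesis by (simp add: Efun_def l2_def)
qed

lemma norm_sq_nonneg: "0 \<le> norm_sq u" unfolding norm_sq_def by (intro infsum_nonneg density_nonneg)

lemma ip_le_norm_sq: "u \<in> Efun \<Longrightarrow> ip u u \<le> norm_sq u"
  unfolding ip_self norm_sq_def by (intro infsum_mono sq_le_density density_summable l2_square_summable Efun_l2)

lemma density_cmult: "density (\<lambda>x. c * u x) x = c\<^sup>2 * density u x"
proof -
  have "grad_prod S (\<lambda>x. c * u x) (\<lambda>x. c * u x) x = c\<^sup>2 * grad_prod S u u x"
    unfolding grad_prod_eq by (simp add: sum_distrib_left power2_eq_square algebra_simps)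
  then show ?thesis by (simp add: density_def lap_cmult power_mult_distrib distrib_left mult_ac)
qed

lemma Efun_cmult: "u \<in> Efun \<Longrightarrow> (\<lambda>x. c * u x) \<in> Efun"
  using summable_on_cmult_right[OF density_summable, of u "c\<^sup>2"]
  by (intro Efun_if_summable) (simp add: density_cmult[abs_def])

lemma norm_sq_cmult: "norm_sq (\<lambda>x. c * u x) = c\<^sup>2 * norm_sq u"
  by (simp add: norm_sq_def density_cmult infsum_cmult_right')

lemma form_self_le: "u \<in> l2 \<Longrightarrow> form (pow u) (pow u) \<le> form_const * ip u u powr p"
  using form_le[of u u] by (simp add: powr_add[symmetric])

definition best :: real where
  "best = (SUP u\<in>{u \<in> Efun. norm_sq u \<le> 1}. form (pow u) (pow u))"

lemma form_le_form_const: "u \<in> Efun \<Longrightarrow> norm_sq u \<le> 1 \<Longrightarrow> form (pow u) (pow u) \<le> form_const"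
proof -
  assume u: "u \<in> Efun" "norm_sq u \<le> 1"
  have "ip u u powr p \<le> 1" using ip_le_norm_sq[OF u(1)] u(2) ip_nonneg[of u] p_gt_1 by (intro powr_le1) auto
  then have "form_const * ip u u powr p \<le> form_const * 1" using form_const(1) by (intro mult_left_mono) auto
  then show ?thesis using form_self_le[OF Efun_l2[OF u(1)]] by linarith
qed

lemma form_le_best: "u \<in> Efun \<Longrightarrow> norm_sq u \<le> 1 \<Longrightarrow> form (pow u) (pow u) \<le> best"
  unfolding best_def using form_le_form_const by (intro cSUP_upper bdd_aboveI2) auto

text \<open>Homogeneity of degree \<open>2p\<close>, against degree \<open>2\<close> for the squared norm.\<close>

lemma form_le_best_norm_sq:
  assumes u: "u \<in> Efun"
  shows "form (pow u) (pow u) \<le> best * norm_sq u powr p"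
proof (cases "norm_sq u = 0")
  case True
  then have "u x = 0" for x using ip_le_norm_sq[OF u] ip_nonneg[of u] l2_eq_0[OF Efun_l2[OF u]] by simp
  then have "form (pow u) (pow u) = 0" unfolding form_def by (intro infsum_0) auto
  then show ?thesis using True by simp
next
  case False
  define c where "c = sqrt (norm_sq u)"
  have c: "c > 0" "c\<^sup>2 = norm_sq u" using False norm_sq_nonneg[of u] by (auto simp: c_def)
  have "norm_sq (\<lambda>x. 1 / c * u x) = 1"
    unfolding norm_sq_cmult power_divide c(2) using False by simp
  then have "form (pow (\<lambda>x. 1 / c * u x)) (pow (\<lambda>x. 1 / c * u x)) \<le> best"
    by (intro form_le_best Efun_cmult u) (rule eq_refl)
  then have 1: "(\<bar>1 / c\<bar> powr p)\<^sup>2 * form (pow u) (pow u) \<le> best" unfolding form_scale .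
  have cp: "c powr p * \<bar>1 / c\<bar> powr p = 1" using c powr_mult[of c "1/c" p] by simp
  have "c powr p * c powr p = (c * c) powr p" using c by (simp add: powr_mult)
  then have 2: "(c powr p)\<^sup>2 = norm_sq u powr p" using c by (simp add: power2_eq_square)
  have "(c powr p)\<^sup>2 * ((\<bar>1 / c\<bar> powr p)\<^sup>2 * form (pow u) (pow u)) \<le> (c powr p)\<^sup>2 * best"
    using 1 by (intro mult_left_mono) auto
  moreover have "(c powr p)\<^sup>2 * ((\<bar>1 / c\<bar> powr p)\<^sup>2 * form (pow u) (pow u)) = form (pow u) (pow u)"
    unfolding mult.assoc[symmetric] power_mult_distrib[symmetric] cp by simp
  ultimately show ?thesis unfolding 2 by (simp only: mult.commute)
qed

lemma form_restr_finite:
  assumes "finite F"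
  shows "form (pow (restr F u)) (pow (restr F u)) = (\<Sum>x\<in>F. \<Sum>y\<in>F. R0 x y * pow u y * pow u x)"
proof -
  have "form (pow (restr F u)) (pow (restr F u)) = (\<Sum>\<^sub>\<infinity>(x, y)\<in>F \<times> F. R0 x y * pow u y * pow u x)"
    unfolding form_def by (rule infsum_cong_neutral) (auto simp: restr_def split: if_splits)
  then show ?thesis using assms by (simp add: sum.cartesian_product)
qed

lemma form_mono:
  assumes "u \<in> l2" "v \<in> l2" "\<And>x. \<bar>u' x\<bar> \<le> \<bar>u x\<bar>" "\<And>x. \<bar>v' x\<bar> \<le> \<bar>v x\<bar>"
  shows "form (pow u') (pow v') \<le> form (pow u) (pow v)"
proof -
  have l: "u' \<in> l2" "v' \<in> l2" using assms l2_comparison by blast+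
  have pw: "pow u' x \<le> pow u x" "pow v' x \<le> pow v x" for x
    using assms p_gt_1 by (auto intro!: powr_mono2)
  show ?thesis unfolding form_def
  proof (rule infsum_mono[OF form_summable[OF l] form_summable[OF assms(1,2)]])
    fix z
    show "(case z of (x, y) \<Rightarrow> R0 x y * pow u' y * pow v' x) \<le> (case z of (x, y) \<Rightarrow> R0 x y * pow u y * pow v x)"
      unfolding case_prod_beta by (intro mult_mono pw R0_nonneg) (auto simp: R0_nonneg)
  qed
qed

lemma form_split_left:
  assumes "u \<in> l2" "v \<in> l2" "A \<inter> B = {}"
  shows "form (pow (restr (A \<union> B) u)) (pow v) = form (pow (restr A u)) (pow v) + form (pow (restr B u)) (pow v)"
proof -
  have "form (pow (restr (A \<union> B) u)) (pow v) = (\<Sum>\<^sub>\<infinity>z. (case z of (x, y) \<Rightarrow> R0 x y * pow (restr A u) y * pow v x)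
      + (case z of (x, y) \<Rightarrow> R0 x y * pow (restr B u) y * pow v x))"
    unfolding form_def case_prod_beta using assms(3)
    by (intro infsum_cong) (auto simp: restr_def)
  then show ?thesis unfolding form_def
    by (simp only: infsum_add[OF form_summable[OF restr_l2 assms(2)] form_summable[OF restr_l2 assms(2)], OF assms(1) assms(1)])
qed

lemma form_split:
  assumes "u \<in> l2"
  shows "form (pow u) (pow u) = form (pow (restr F u)) (pow (restr F u)) + form (pow (restr (- F) u)) (pow (restr (- F) u))
     + 2 * form (pow (restr F u)) (pow (restr (- F) u))"
proof -
  have U: "restr (F \<union> - F) u = u" by (auto simp: restr_def)
  have d: "F \<inter> - F = {}" by simp
  have "form (pow u) (pow u) = form (pow (restr F u)) (pow u) + form (pow (restr (- F) u)) (pow u)"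
    using form_split_left[OF assms assms d] unfolding U .
  moreover have "form (pow v) (pow u) = form (pow v) (pow (restr F u)) + form (pow v) (pow (restr (- F) u))" if "v \<in> l2" for v
    using form_split_left[OF assms that d] unfolding U by (simp only: form_sym[of _ "pow v"])
  ultimately show ?thesis
    using restr_l2[OF assms] form_sym[of "pow (restr F u)" "pow (restr (- F) u)"] by simp
qed

text \<open>Uniform decay of the rows \<open>R y -\<close> for the finitely many \<open>y\<close> in \<open>F'\<close>.\<close>

lemma form_cross_tail:
  assumes "finite F'" "\<epsilon> > 0"
  shows "\<exists>F0. finite F0 \<and> (\<forall>u v. u \<in> l2 \<and> ip u u \<le> 1 \<and> v \<in> l2 \<and> ip v v \<le> 1 \<and> (\<forall>x\<in>F0. v x = 0)
     \<longrightarrow> form (pow (restr F' u)) (pow v) \<le> \<epsilon>)"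
proof -
  define e where "e = \<epsilon> / (real (card F') + 1)"
  have e: "e > 0" using assms by (simp add: e_def add_nonneg_pos)
  have "\<forall>y. \<exists>F. finite F \<and> (\<forall>v Y. v \<in> l2 \<and> ip v v \<le> 1 \<and> finite Y \<and> Y \<inter> F = {} \<longrightarrow> (\<Sum>x\<in>Y. R y x * pow v x) \<le> e)"
    using green_tail[OF e] by blast
  then obtain F where F: "\<And>y. finite (F y)"
    "\<And>y v Y. v \<in> l2 \<and> ip v v \<le> 1 \<and> finite Y \<and> Y \<inter> F y = {} \<Longrightarrow> (\<Sum>x\<in>Y. R y x * pow v x) \<le> e" by metis
  define F0 where "F0 = (\<Union>y\<in>F'. F y)"
  have "form (pow (restr F' u)) (pow v) \<le> \<epsilon>"
    if u: "u \<in> l2" "ip u u \<le> 1" and v: "v \<in> l2" "ip v v \<le> 1" and v0: "\<And>x. x \<in> F0 \<Longrightarrow> v x = 0" for u v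
    unfolding form_def
  proof (rule infsum_le_finite_sums[OF form_summable[OF restr_l2[OF u(1)] v(1)]])
    fix Z :: "('a \<times> 'a) set" assume Z: "finite Z"
    define X where "X = fst ` Z - F0"
    have X: "finite X" using Z by (simp add: X_def)
    let ?t = "\<lambda>z. case z of (x, y) \<Rightarrow> R0 x y * pow (restr F' u) y * pow v x"
    let ?g = "\<lambda>z. R (snd z) (fst z) * pow v (fst z)"
    have "sum ?t Z = sum ?t (Z \<inter> (X \<times> F'))"
    proof (rule sum.mono_neutral_right[OF Z])
      show "\<forall>z\<in>Z - Z \<inter> X \<times> F'. ?t z = 0"
      proof
        fix z assume z: "z \<in> Z - Z \<inter> X \<times> F'"
        obtain x y where xy: "z = (x, y)" by (cases z)
        have "x \<in> fst ` Z" using z xy by force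
        then have "x \<in> F0 \<or> y \<notin> F'" using z xy by (auto simp: X_def)
        then show "?t z = 0" using v0 by (auto simp: xy restr_def)
      qed
    qed simp
    also have "\<dots> \<le> sum ?g (Z \<inter> (X \<times> F'))"
    proof (rule sum_mono)
      fix z assume "z \<in> Z \<inter> (X \<times> F')"
      have "pow (restr F' u) (snd z) \<le> 1"
        using l2_unit_abs_le_1[OF u] p_gt_1 by (intro powr_le1) (auto simp: restr_def)
      then have "R0 (fst z) (snd z) * pow (restr F' u) (snd z) \<le> R (fst z) (snd z) * 1"
        by (intro mult_mono R0_le) (auto simp: green_nonneg)
      then show "?t z \<le> ?g z" unfolding case_prod_beta green_sym[of "snd z"] by (intro mult_right_mono) auto
    qed
    also have "\<dots> \<le> sum ?g (X \<times> F')"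
      using X assms(1) green_nonneg by (intro sum_mono2) auto
    also have "\<dots> = (\<Sum>y\<in>F'. \<Sum>x\<in>X. R y x * pow v x)"
      by (subst sum.swap) (simp add: sum.cartesian_product case_prod_beta)
    also have "\<dots> \<le> (\<Sum>y\<in>F'. e)"
    proof (rule sum_mono)
      fix y assume "y \<in> F'"
      then show "(\<Sum>x\<in>X. R y x * pow v x) \<le> e" using v X by (intro F(2)) (auto simp: X_def F0_def)
    qed
    also have "\<dots> \<le> \<epsilon>" using assms(2) by (simp add: e_def field_simps)
    finally show "sum ?t Z \<le> \<epsilon>" .
  qed
  moreover have "finite F0" using assms(1) F(1) by (simp add: F0_def)
  ultimately show ?thesis by blast
qed

text \<open>Outside \<open>F\<close> the potential exceeds \<open>M\<close>, so the squared \<open>\<ell>\<^sup>2\<close> norm there is at most the escaping part \<open>c \<le> 1\<close> of the squared norm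
divided by \<open>1 + lM\<close>; finally \<open>c\<^sup>p \<le> c\<close>.\<close>

lemma form_restr_compl_le:
  assumes u: "u \<in> Efun" "norm_sq u \<le> 1" and F: "finite F" "{x. a x \<le> M} \<subseteq> F" and M: "0 < M"
  shows "form (pow (restr (- F) u)) (pow (restr (- F) u)) \<le> form_const * (1 + l * M) powr (- p) * (1 - (\<Sum>x\<in>F. density u x))"
proof -
  define c where "c = norm_sq u - (\<Sum>x\<in>F. density u x)"
  have c: "c = (\<Sum>\<^sub>\<infinity>x\<in>-F. density u x)"
    unfolding c_def norm_sq_def by (rule infsum_compl_finite[OF density_summable[OF u(1)] F(1), symmetric])
  have c0: "0 \<le> c" unfolding c by (intro infsum_nonneg density_nonneg)
  have c1: "c \<le> 1" using u(2) sum_nonneg[of F "density u"] density_nonneg unfolding c_def by fastforce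
  let ?w = "restr (- F) u"
  let ?b = "1 + l * M"
  have b: "?b > 0" using l_pos M by (simp add: add_pos_pos)
  have "?b * ip ?w ?w = (\<Sum>\<^sub>\<infinity>x\<in>-F. ?b * (u x)\<^sup>2)"
    unfolding ip_self infsum_cmult_right'[symmetric]
    by (rule infsum_cong_neutral) (auto simp: restr_def)
  also have "\<dots> \<le> c"
    unfolding c
  proof (rule infsum_mono)
    show "(\<lambda>x. ?b * (u x)\<^sup>2) summable_on - F"
      by (intro summable_on_cmult_right summable_on_subset[OF l2_square_summable[OF Efun_l2[OF u(1)]]]) simp
    show "density u summable_on - F" by (rule summable_on_subset[OF density_summable[OF u(1)]]) simp
    fix x assume "x \<in> - F"
    then have "M \<le> a x" using F(2) by force
    then have "?b * (u x)\<^sup>2 \<le> (1 + l * a x) * (u x)\<^sup>2" using l_pos by (intro mult_right_mono) auto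
    then show "?b * (u x)\<^sup>2 \<le> density u x" using weighted_sq_le_density[of x u] by linarith
  qed
  finally have "ip ?w ?w \<le> c / ?b" using b by (simp add: field_simps)
  then have "ip ?w ?w powr p \<le> (c / ?b) powr p"
    using p_gt_1 ip_nonneg by (intro powr_mono2) auto
  also have "\<dots> = ?b powr (- p) * c powr p"
    using b c0 powr_divide[of c ?b p] powr_minus_divide[of ?b p] by simp
  also have "\<dots> \<le> ?b powr (- p) * c"
  proof (rule mult_left_mono)
    show "c powr p \<le> c"
    proof (cases "c = 0")
      case False
      then have "c powr p \<le> c powr 1" using c0 c1 p_gt_1 by (intro powr_mono') auto
      then show ?thesis using c0 by simp
    qed simp
  qed simp
  finally have "form_const * ip ?w ?w powr p \<le> form_const * (?b powr (- p) * c)" using form_const(1) by (intro mult_left_mono) auto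
  also have "\<dots> \<le> form_const * (?b powr (- p) * (1 - (\<Sum>x\<in>F. density u x)))"
    using form_const(1) u(2) by (intro mult_left_mono) (auto simp: c_def)
  finally show ?thesis using form_self_le[OF restr_l2[OF Efun_l2[OF u(1)]], of "- F"] by (simp add: mult.assoc)
qed

lemma density_tendsto:
  assumes "\<And>x. (\<lambda>n. U n x) \<longlonglongrightarrow> u x"
  shows "(\<lambda>n. density (U n) x) \<longlonglongrightarrow> density u x"
  unfolding density_def lap_eq grad_prod_eq by (intro tendsto_intros assms)

lemma form_restr_tendsto:
  assumes "\<And>x. (\<lambda>n. U n x) \<longlonglongrightarrow> u x" "finite F"
  shows "(\<lambda>n. form (pow (restr F (U n))) (pow (restr F (U n)))) \<longlonglongrightarrow> form (pow (restr F u)) (pow (restr F u))"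
  unfolding form_restr_finite[OF assms(2)] using p_gt_1
  by (intro tendsto_intros tendsto_powr2 assms) auto

text \<open>A pointwise limit \<open>u\<close> of a maximising sequence satisfies \<open>best \<le> D(u) + \<kappa>(1 - \<theta>)\<close> with \<open>\<theta>\<close> its squared norm, because whatever
mass escapes contributes at most \<open>\<kappa>\<close> per unit. Since \<open>D(u) \<le> best \<theta>\<close> and \<open>\<kappa> < best\<close>, nothing escapes.\<close>

proposition best_attained:
  assumes M: "0 < M" "finite {x. a x \<le> M}" and small: "form_const * (1 + l * M) powr (- p) < best"
  shows "\<exists>u\<in>Efun. norm_sq u = 1 \<and> form (pow u) (pow u) = best"
proof -
  define \<kappa> where "\<kappa> = form_const * (1 + l * M) powr (- p)"
  have k0: "0 \<le> \<kappa>" using form_const(1) by (simp add: \<kappa>_def)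
  have ne: "{u \<in> Efun. norm_sq u \<le> 1} \<noteq> {}"
  proof -
    have "(\<lambda>x. 0) \<in> Efun" by (simp add: Efun_def l2_zero)
    moreover from norm_sq_cmult[of 0 "\<lambda>x. 0"] have "norm_sq (\<lambda>x. 0) = 0" by simp
    ultimately show ?thesis by auto
  qed
  have "\<exists>u. u \<in> Efun \<and> norm_sq u \<le> 1 \<and> best - 1 / real (Suc n) < form (pow u) (pow u)" for n
  proof -
    have "best - 1 / real (Suc n) < best" by simp
    then show ?thesis unfolding best_def using form_le_form_const ne
      by (subst (asm) less_cSUP_iff) (auto intro!: bdd_aboveI2)
  qed
  then obtain U0 where U0: "\<And>n. U0 n \<in> Efun" "\<And>n. norm_sq (U0 n) \<le> 1"
     "\<And>n. best - 1 / real (Suc n) < form (pow (U0 n)) (pow (U0 n))" by metis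
  have ipU0: "ip (U0 n) (U0 n) \<le> 1" for n using ip_le_norm_sq[OF U0(1)] U0(2) order_trans by blast
  obtain r where r: "strict_mono r" "\<And>x. \<exists>lm. (\<lambda>n. U0 (r n) x) \<longlonglongrightarrow> lm"
  proof (rule function_convergent_subsequence[OF countable_vertices, of U0 1])
    show "norm (U0 n x) \<le> 1" for n x using l2_unit_abs_le_1[OF Efun_l2[OF U0(1)] ipU0] by simp
  qed (use that in auto)
  define U where "U n = U0 (r n)" for n
  define u where "u x = lim (\<lambda>n. U n x)" for x
  have lim: "(\<lambda>n. U n x) \<longlonglongrightarrow> u x" for x
    using r(2)[of x] unfolding U_def u_def by (auto simp: limI)
  have U: "U n \<in> Efun" "norm_sq (U n) \<le> 1" "ip (U n) (U n) \<le> 1" for n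
    using U0 ipU0 by (auto simp: U_def)
  have Ul: "U n \<in> l2" for n using Efun_l2[OF U(1)] .
  have Dlim: "(\<lambda>n. form (pow (U n)) (pow (U n))) \<longlonglongrightarrow> best"
  proof (rule tendsto_sandwich[of "\<lambda>n. best - 1 / real (Suc (r n))" _ _ "\<lambda>_. best"])
    have "(\<lambda>n. 1 / real (Suc n)) \<longlonglongrightarrow> 0" using LIMSEQ_inverse_real_of_nat by (simp add: divide_inverse)
    from LIMSEQ_subseq_LIMSEQ[OF this r(1)] have "(\<lambda>n. 1 / real (Suc (r n))) \<longlonglongrightarrow> 0" by (simp add: o_def)
    from tendsto_diff[OF tendsto_const this, of best]
    show "(\<lambda>n. best - 1 / real (Suc (r n))) \<longlonglongrightarrow> best" by simp
  qed (use U0(3) form_le_best U in \<open>auto simp: U_def less_imp_le\<close>)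
  have ensum: "(\<Sum>x\<in>F. density u x) \<le> 1" if "finite F" for F
  proof (rule LIMSEQ_le_const2)
    show "(\<lambda>n. \<Sum>x\<in>F. density (U n) x) \<longlonglongrightarrow> (\<Sum>x\<in>F. density u x)" by (intro tendsto_sum density_tendsto lim)
    have "(\<Sum>x\<in>F. density (U n) x) \<le> 1" for n
      using finite_sum_le_infsum[OF density_summable[OF U(1)[of n]] that] density_nonneg U(2)[of n] unfolding norm_sq_def
      by (meson order_trans subset_UNIV)
    then show "\<exists>N. \<forall>n\<ge>N. (\<Sum>x\<in>F. density (U n) x) \<le> 1" by blast
  qed
  have s: "density u summable_on UNIV" and N1: "norm_sq u \<le> 1"
    using summable_on_bounded_sums[of UNIV "density u" 1] ensum density_nonneg unfolding norm_sq_def by auto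
  have u: "u \<in> Efun" by (rule Efun_if_summable[OF s])
  note ul = Efun_l2[OF u]
  define \<theta> where "\<theta> = norm_sq u"
  have \<theta>: "0 \<le> \<theta>" "\<theta> \<le> 1" using N1 norm_sq_nonneg by (auto simp: \<theta>_def)
  have main: "best \<le> form (pow u) (pow u) + \<kappa> * (1 - \<theta> + \<epsilon>) + 2 * (\<epsilon> + form_const * \<epsilon> powr (p/2))" if \<epsilon>: "\<epsilon> > 0" for \<epsilon>
  proof -
    obtain F1 where F1: "finite F1" "\<And>F'. finite F' \<Longrightarrow> F1 \<subseteq> F' \<Longrightarrow> norm_sq u - sum (density u) F' \<le> \<epsilon>"
      using infsum_tail[OF s density_nonneg \<epsilon>] unfolding norm_sq_def by blast
    \<comment> \<open>Three nested scales. \<open>F'\<close> carries \<open>u\<close> up to \<open>\<epsilon>\<close> and contains the sublevel set of \<open>a\<close>; the interaction of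
\<open>F'\<close> with the complement of \<open>F0\<close> is at most \<open>\<epsilon>\<close>; the annulus \<open>F - F'\<close> carries little of \<open>u\<close>, hence in the limit little of \<open>U n\<close>.\<close>
    define F' where "F' = F1 \<union> {x. a x \<le> M}"
    have F': "finite F'" using F1(1) M(2) by (simp add: F'_def)
    obtain F0 where F0: "finite F0" "\<And>u v. u \<in> l2 \<and> ip u u \<le> 1 \<and> v \<in> l2 \<and> ip v v \<le> 1 \<and> (\<forall>x\<in>F0. v x = 0)
       \<Longrightarrow> form (pow (restr F' u)) (pow v) \<le> \<epsilon>"
      using form_cross_tail[OF F' \<epsilon>] by blast
    define F where "F = F' \<union> F0"
    have F: "finite F" "F' \<subseteq> F" "F0 \<subseteq> F" "F1 \<subseteq> F" "{x. a x \<le> M} \<subseteq> F" using F' F0(1) by (auto simp: F_def F'_def)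
    let ?rhs = "\<lambda>v. form (pow (restr F v)) (pow (restr F v)) + \<kappa> * (1 - (\<Sum>x\<in>F. density v x))
        + 2 * (\<epsilon> + form_const * (\<Sum>x\<in>F - F'. (v x)\<^sup>2) powr (p/2))"
    have le: "form (pow (U n)) (pow (U n)) \<le> ?rhs (U n)" for n
    proof -
      let ?v = "U n" and ?w = "restr (- F) (U n)"
      have w: "?w \<in> l2" "ip ?w ?w \<le> 1"
        using restr_l2[OF Ul] ip_restr_compl[OF Ul[of n] F(1)] U(3)[of n] sum_nonneg[of F "\<lambda>x. (U n x)\<^sup>2"] by auto
      have 1: "form (pow ?w) (pow ?w) \<le> \<kappa> * (1 - (\<Sum>x\<in>F. density ?v x))"
        unfolding \<kappa>_def by (rule form_restr_compl_le[OF U(1,2) F(1,5) M(1)])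
      have FF: "F = F' \<union> (F - F')" using F(2) by auto
      have 2: "form (pow (restr F ?v)) (pow ?w) = form (pow (restr F' ?v)) (pow ?w) + form (pow (restr (F - F') ?v)) (pow ?w)"
        using form_split_left[OF Ul[of n] w(1), of F' "F - F'"] FF by simp
      have 3: "form (pow (restr F' ?v)) (pow ?w) \<le> \<epsilon>"
        using F(3) by (intro F0(2) conjI Ul U(3) w) (auto simp: restr_def)
      have "form (pow (restr (F - F') ?v)) (pow ?w)
          \<le> form_const * (ip (restr (F - F') ?v) (restr (F - F') ?v) powr (p/2) * ip ?w ?w powr (p/2))"
        by (rule form_le[OF restr_l2[OF Ul] w(1)])
      also have "ip (restr (F - F') ?v) (restr (F - F') ?v) = (\<Sum>x\<in>F - F'. (?v x)\<^sup>2)"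
        using F(1) by (intro ip_restr_finite) simp
      also have "form_const * ((\<Sum>x\<in>F - F'. (?v x)\<^sup>2) powr (p/2) * ip ?w ?w powr (p/2))
          \<le> form_const * ((\<Sum>x\<in>F - F'. (?v x)\<^sup>2) powr (p/2) * 1)"
        using form_const(1) w(2) ip_nonneg[of ?w] p_gt_1 by (intro mult_left_mono powr_le1) auto
      finally have 4: "form (pow (restr (F - F') ?v)) (pow ?w) \<le> form_const * (\<Sum>x\<in>F - F'. (?v x)\<^sup>2) powr (p/2)" by simp
      show ?thesis using form_split[OF Ul[of n], of F] 1 2 3 4 by argo
    qed
    have "(\<lambda>n. ?rhs (U n)) \<longlonglongrightarrow> ?rhs u"
      using p_gt_1 F(1)
      by (intro tendsto_intros form_restr_tendsto density_tendsto tendsto_powr2 lim) (auto intro!: always_eventually sum_nonneg)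
    from LIMSEQ_le[OF Dlim this] le have "best \<le> ?rhs u" by blast
    moreover have "form (pow (restr F u)) (pow (restr F u)) \<le> form (pow u) (pow u)"
      by (rule form_mono[OF ul ul]) (auto simp: restr_def)
    moreover have "\<kappa> * (1 - (\<Sum>x\<in>F. density u x)) \<le> \<kappa> * (1 - \<theta> + \<epsilon>)"
      using F1(2)[OF F(1,4)] k0 by (intro mult_left_mono) (auto simp: \<theta>_def)
    moreover have "form_const * (\<Sum>x\<in>F - F'. (u x)\<^sup>2) powr (p/2) \<le> form_const * \<epsilon> powr (p/2)"
    proof (intro mult_left_mono powr_mono2)
      have "(\<Sum>x\<in>F - F'. (u x)\<^sup>2) \<le> (\<Sum>x\<in>F - F'. density u x)" by (intro sum_mono sq_le_density)
      also have "\<dots> = sum (density u) F - sum (density u) F'" using F by (intro sum_diff) auto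
      also have "sum (density u) F \<le> norm_sq u" unfolding norm_sq_def using density_nonneg by (intro finite_sum_le_infsum s F) auto
      finally show "(\<Sum>x\<in>F - F'. (u x)\<^sup>2) \<le> \<epsilon>" using F1(2)[OF F'] by (simp add: F'_def)
    qed (use form_const(1) p_gt_1 in \<open>auto intro!: sum_nonneg\<close>)
    ultimately show ?thesis by argo
  qed
  have b1: "best \<le> form (pow u) (pow u) + \<kappa> * (1 - \<theta>)"
  proof (rule LIMSEQ_le_const)
    have e: "(\<lambda>n. inverse (real (Suc n))) \<longlonglongrightarrow> 0" by (rule LIMSEQ_inverse_real_of_nat)
    have "(\<lambda>n. inverse (real (Suc n)) powr (p/2)) \<longlonglongrightarrow> 0"
      using p_gt_1 by (intro tendsto_zero_powrI[OF e tendsto_const]) auto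
    from tendsto_add[OF tendsto_add[OF tendsto_const tendsto_mult[OF tendsto_const tendsto_add[OF tendsto_const e]]]
        tendsto_mult[OF tendsto_const tendsto_add[OF e tendsto_mult[OF tendsto_const this]]],
        of "form (pow u) (pow u)" \<kappa> "1 - \<theta>" 2 form_const]
    show "(\<lambda>n. form (pow u) (pow u) + \<kappa> * (1 - \<theta> + inverse (real (Suc n)))
        + 2 * (inverse (real (Suc n)) + form_const * inverse (real (Suc n)) powr (p/2))) \<longlonglongrightarrow> form (pow u) (pow u) + \<kappa> * (1 - \<theta>)" by simp
    show "\<exists>N. \<forall>n\<ge>N. best \<le> form (pow u) (pow u) + \<kappa> * (1 - \<theta> + inverse (real (Suc n)))
        + 2 * (inverse (real (Suc n)) + form_const * inverse (real (Suc n)) powr (p/2))"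
      by (intro exI[of _ 0] allI impI main) simp
  qed
  have bpos: "0 < best" "\<kappa> < best" using small k0 unfolding \<kappa>_def by linarith+
  have "form (pow u) (pow u) \<le> best * \<theta> powr p" unfolding \<theta>_def by (rule form_le_best_norm_sq[OF u])
  also have "\<dots> \<le> best * \<theta>"
  proof (rule mult_left_mono)
    show "\<theta> powr p \<le> \<theta>"
    proof (cases "\<theta> = 0")
      case False
      then have "\<theta> powr p \<le> \<theta> powr 1" using \<theta> p_gt_1 by (intro powr_mono') auto
      then show ?thesis using \<theta> by simp
    qed simp
  qed (use bpos in simp)
  finally have "best \<le> best * \<theta> + \<kappa> * (1 - \<theta>)" using b1 by linarith
  then have "(best - \<kappa>) * (1 - \<theta>) \<le> 0" by (simp add: algebra_simps)
  then have "\<theta> = 1" using bpos \<theta> by (simp add: mult_le_0_iff)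
  then show ?thesis using b1 form_le_best[OF u N1] u unfolding \<theta>_def by (intro bexI[of _ u]) auto
qed

end

section \<open>The Euler-Lagrange equation and the ground state\<close>

lemma DERIV_abs_powr:
  fixes p y :: real
  assumes "1 < p"
  shows "((\<lambda>y. \<bar>y\<bar> powr p) has_real_derivative p * \<bar>y\<bar> powr (p - 2) * y) (at y)"
proof -
  consider "y > 0" | "y < 0" | "y = 0" by linarith
  then show ?thesis
  proof cases
    case 1
    have "((\<lambda>y. y powr p) has_real_derivative p * y powr (p - 1)) (at y)"
      by (rule has_real_derivative_powr[OF 1])
    moreover have "y powr (p - 1) = \<bar>y\<bar> powr (p - 2) * y"
      using 1 powr_add[of y "p - 2" 1] by simp
    ultimately have d: "((\<lambda>y. y powr p) has_real_derivative p * \<bar>y\<bar> powr (p - 2) * y) (at y)" by (simp add: mult.assoc)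
    show ?thesis
      by (rule DERIV_cong_ev[THEN iffD1, OF refl _ refl d])
         (use 1 in \<open>auto intro!: eventually_nhds_in_open[of "{0<..}", THEN eventually_mono] simp: abs_of_pos\<close>)
  next
    case 2
    have "((\<lambda>y. (- y) powr p) has_real_derivative p * (- y) powr (p - 1) * (- 1)) (at y)"
      by (rule DERIV_chain2[OF has_real_derivative_powr]) (use 2 in \<open>auto intro!: derivative_eq_intros\<close>)
    moreover have "(- y) powr (p - 1) * (- 1) = \<bar>y\<bar> powr (p - 2) * y"
      using 2 powr_add[of "- y" "p - 2" 1] by simp
    ultimately have d: "((\<lambda>y. (- y) powr p) has_real_derivative p * \<bar>y\<bar> powr (p - 2) * y) (at y)"
      by (simp only: mult.assoc)
    show ?thesis
      by (rule DERIV_cong_ev[THEN iffD1, OF refl _ refl d])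
         (use 2 in \<open>auto intro!: eventually_nhds_in_open[of "{..<0}", THEN eventually_mono] simp: abs_of_neg\<close>)
  next
    case 3
    have "(\<lambda>h::real. \<bar>h\<bar> powr (p - 1)) \<midarrow>0\<rightarrow> 0"
      using assms by (intro tendsto_zero_powrI[of _ _ _ "p - 1"] tendsto_rabs_zero tendsto_ident_at tendsto_const) auto
    then have "(\<lambda>h::real. (\<bar>0 + h\<bar> powr p - \<bar>0\<bar> powr p) / h) \<midarrow>0\<rightarrow> 0"
    proof (rule Lim_null_comparison[rotated], intro always_eventually allI)
      fix h :: real
      show "norm ((\<bar>0 + h\<bar> powr p - \<bar>0\<bar> powr p) / h) \<le> \<bar>h\<bar> powr (p - 1)"
      proof (cases "h = 0")
        case False
        then have "\<bar>h\<bar> powr p = \<bar>h\<bar> powr (p - 1) * \<bar>h\<bar>" using powr_add[of "\<bar>h\<bar>" "p - 1" 1] by simp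
        then show ?thesis using False by (simp add: abs_mult)
      qed simp
    qed
    then show ?thesis unfolding 3 DERIV_def by simp
  qed
qed

context cayley
begin

text \<open>The distributional definition determines \<open>\<Delta>\<^sup>2u\<close> pointwise, by testing with unit masses.\<close>

lemma bilap_eq:
  assumes "u \<in> l2"
  shows "bilap S u = lap S (lap S u)"
  unfolding bilap_def
proof (rule the_equality)
  have "(\<Sum>\<^sub>\<infinity>x. lap S (lap S u) x * \<phi> x) = (\<Sum>\<^sub>\<infinity>x. lap S u x * lap S \<phi> x)" if "\<phi> \<in> Cc" for \<phi>
    using ip_lap_sym[OF lap_l2[OF assms] l2_finite_support[of \<phi>]] that by (simp add: Cc_def ip_def)
  then show "\<forall>\<phi>\<in>Cc. (\<Sum>\<^sub>\<infinity>x. lap S (lap S u) x * \<phi> x) = (\<Sum>\<^sub>\<infinity>x. lap S u x * lap S \<phi> x)" by blast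
  fix f assume f: "\<forall>\<phi>\<in>Cc. (\<Sum>\<^sub>\<infinity>x. f x * \<phi> x) = (\<Sum>\<^sub>\<infinity>x. lap S u x * lap S \<phi> x)"
  show "f = lap S (lap S u)"
  proof
    fix z :: 'a
    have "single z \<in> Cc" by (simp add: Cc_def single_def)
    then have "ip f (single z) = ip (lap S u) (lap S (single z))" using f by (simp add: ip_def)
    also have "\<dots> = ip (lap S (lap S u)) (single z)" by (rule ip_lap_sym[symmetric]) (auto intro: lap_l2 assms)
    finally show "f z = lap S (lap S u) z" by simp
  qed
qed

lemma W22_energy_le:
  assumes "w \<in> l2"
  shows "(\<Sum>\<^sub>\<infinity>x. (lap S w x)\<^sup>2 + grad_prod S w w x + (w x)\<^sup>2) \<le> (3/2 * (2 * real (card S))\<^sup>2 + 3/2) * ip w w"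
proof -
  have "(\<Sum>\<^sub>\<infinity>x. (lap S w x)\<^sup>2 + grad_prod S w w x + (w x)\<^sup>2) = ip (lap S w) (lap S w) - ip (lap S w) w + ip w w"
    using assms infsum_grad[OF assms assms]
    by (simp add: infsum_add summable_on_add l2_square_summable lap_l2 summable_grad ip_self[symmetric])
  also have "- ip (lap S w) w \<le> (1 * ip (lap S w) (lap S w) + ip w w / 1) / 2"
    using ip_scaled_bound[OF lap_l2[OF assms] assms, of 1] by linarith
  then have "ip (lap S w) (lap S w) - ip (lap S w) w + ip w w \<le> 3/2 * ip (lap S w) (lap S w) + 3/2 * ip w w" by simp
  also have "\<dots> \<le> 3/2 * ((2 * real (card S))\<^sup>2 * ip w w) + 3/2 * ip w w"
    by (intro add_right_mono mult_left_mono ip_lap_lap_le assms) simp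
  finally show ?thesis by (simp add: algebra_simps)
qed

end

context potential_well
begin

text \<open>\<open>\<Delta>\<close> is bounded on \<open>\<ell>\<^sup>2\<close>, so the norm of \<open>W\<^bsup>2,2\<^esup>\<close> is equivalent to that of \<open>\<ell>\<^sup>2\<close>, in which finitely
supported functions are dense.\<close>

lemma W22_eq: "W22 S = l2"
proof
  show "W22 S \<subseteq> l2"
  proof
    fix u assume "u \<in> W22 S"
    then have "(\<lambda>x. (lap S u x)\<^sup>2 + grad_prod S u u x + (u x)\<^sup>2) summable_on UNIV" by (simp add: W22_def)
    then have "(\<lambda>x. (u x)\<^sup>2) summable_on UNIV"
      by (rule summable_on_comparison_test) (use grad_prod_nonneg in auto)
    then show "u \<in> l2" by (simp add: l2_def)
  qed
  show "l2 \<subseteq> W22 S"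
  proof
    fix u :: "'a \<Rightarrow> real" assume u: "u \<in> l2"
    have "\<exists>F. finite F \<and> ip u u - (\<Sum>x\<in>F. (u x)\<^sup>2) \<le> inverse (real (Suc n))" for n
      using infsum_tail[OF l2_square_summable[OF u], of "inverse (real (Suc n))"] unfolding ip_self by auto
    then obtain F where F: "\<And>n. finite (F n)" "\<And>n. ip u u - (\<Sum>x\<in>F n. (u x)\<^sup>2) \<le> inverse (real (Suc n))" by metis
    define K where "K = 3/2 * (2 * real (card S))\<^sup>2 + 3/2"
    have "(\<lambda>n. W22_norm S (\<lambda>x. u x - restr (F n) u x)) \<longlonglongrightarrow> 0"
    proof (rule tendsto_sandwich[OF _ _ tendsto_const])
      show "\<forall>\<^sub>F n in sequentially. 0 \<le> W22_norm S (\<lambda>x. u x - restr (F n) u x)"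
        by (intro always_eventually allI) (auto simp: W22_norm_def grad_prod_nonneg intro!: infsum_nonneg add_nonneg_nonneg)
      show "\<forall>\<^sub>F n in sequentially. W22_norm S (\<lambda>x. u x - restr (F n) u x) \<le> sqrt (K * inverse (real (Suc n)))"
      proof (intro always_eventually allI)
        fix n
        have e: "(\<lambda>x. u x - restr (F n) u x) = restr (- F n) u" by (auto simp: restr_def)
        have "(3/2 * (2 * real (card S))\<^sup>2 + 3/2) * ip (restr (- F n) u) (restr (- F n) u) \<le> K * inverse (real (Suc n))"
          unfolding K_def using F ip_restr_compl[OF u F(1)] by (intro mult_left_mono) auto
        then show "W22_norm S (\<lambda>x. u x - restr (F n) u x) \<le> sqrt (K * inverse (real (Suc n)))"
          unfolding e W22_norm_def using W22_energy_le[OF restr_l2[OF u], of "- F n"] by (intro real_sqrt_le_mono) linarith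
      qed
      have "(\<lambda>n. sqrt (K * inverse (real (Suc n)))) \<longlonglongrightarrow> sqrt (K * 0)"
        by (intro tendsto_intros LIMSEQ_inverse_real_of_nat)
      then show "(\<lambda>n. sqrt (K * inverse (real (Suc n)))) \<longlonglongrightarrow> 0" by simp
    qed
    moreover have "restr (F n) u \<in> Cc" for n
      using F(1)[of n] by (auto simp: Cc_def restr_def elim!: finite_subset[rotated])
    ultimately show "u \<in> W22 S" using W22_summable[OF u] unfolding W22_def
      by (intro CollectI conjI exI[of _ "\<lambda>n. restr (F n) u"] allI)
  qed
qed

lemma E_space_eq: "E_space S a l = Efun"
  by (auto simp: E_space_def Efun_def W22_eq)

lemma E_norm_sq: "(E_norm S a l u)\<^sup>2 = norm_sq u"
  using norm_sq_nonneg[of u] by (simp add: E_norm_def norm_sq_def density_def)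

text \<open>The left side of the equation; pairing it with \<open>v\<close> gives the inner product of \<open>E\<close>, whose summand is \<open>energy_form\<close>.\<close>

definition euler_op :: "('a \<Rightarrow> real) \<Rightarrow> 'a \<Rightarrow> real" where
  "euler_op u x = lap S (lap S u) x - lap S u x + (1 + l * a x) * u x"

definition energy_form :: "('a \<Rightarrow> real) \<Rightarrow> ('a \<Rightarrow> real) \<Rightarrow> 'a \<Rightarrow> real" where
  "energy_form u v x = lap S u x * lap S v x + grad_prod S u v x + (1 + l * a x) * u x * v x"

lemma weighted_summable:
  assumes "u \<in> Efun" "v \<in> Efun"
  shows "(\<lambda>x. (1 + l * a x) * u x * v x) summable_on UNIV"
proof (rule summable_on_abs_comparison)
  have "(\<lambda>x. (u x)\<^sup>2 + l * a x * (u x)\<^sup>2 + ((v x)\<^sup>2 + l * a x * (v x)\<^sup>2)) summable_on UNIV"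
    using assms by (intro summable_on_add) (auto simp: Efun_def l2_def)
  then show "(\<lambda>x. (1 + l * a x) * ((u x)\<^sup>2 + (v x)\<^sup>2)) summable_on UNIV"
    by (simp add: algebra_simps)
  fix x
  have "2 * \<bar>u x\<bar> * \<bar>v x\<bar> \<le> \<bar>u x\<bar>\<^sup>2 + \<bar>v x\<bar>\<^sup>2" by (rule sum_squares_bound)
  moreover have "0 \<le> \<bar>u x\<bar> * \<bar>v x\<bar>" by simp
  ultimately have "\<bar>u x\<bar> * \<bar>v x\<bar> \<le> (u x)\<^sup>2 + (v x)\<^sup>2" unfolding power2_abs mult.assoc by linarith
  then have "(1 + l * a x) * (\<bar>u x\<bar> * \<bar>v x\<bar>) \<le> (1 + l * a x) * ((u x)\<^sup>2 + (v x)\<^sup>2)"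
    using potential_nonneg[of x] by (intro mult_left_mono) auto
  then show "\<bar>(1 + l * a x) * u x * v x\<bar> \<le> (1 + l * a x) * ((u x)\<^sup>2 + (v x)\<^sup>2)"
    using potential_nonneg[of x] by (simp add: abs_mult mult.assoc)
qed

lemma energy_form_summable: "u \<in> Efun \<Longrightarrow> v \<in> Efun \<Longrightarrow> energy_form u v summable_on UNIV"
  unfolding energy_form_def[abs_def]
  by (intro summable_on_add weighted_summable l2_mult_summable summable_grad lap_l2 Efun_l2)

lemma energy_form_by_parts:
  assumes "u \<in> Efun" "v \<in> Efun"
  shows "(\<Sum>\<^sub>\<infinity>x. energy_form u v x) = (\<Sum>\<^sub>\<infinity>x. euler_op u x * v x)"
proof -
  note ul = Efun_l2[OF assms(1)] and vl = Efun_l2[OF assms(2)]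
  note w = weighted_summable[OF assms]
  have s1: "(\<lambda>x. lap S u x * lap S v x) summable_on UNIV" "(\<lambda>x. lap S (lap S u) x * v x) summable_on UNIV"
    "(\<lambda>x. - lap S u x * v x) summable_on UNIV"
    by (intro l2_mult_summable lap_l2 l2_minus ul vl)+
  have "(\<Sum>\<^sub>\<infinity>x. energy_form u v x) = ip (lap S u) (lap S v) + (\<Sum>\<^sub>\<infinity>x. grad_prod S u v x) + (\<Sum>\<^sub>\<infinity>x. (1 + l * a x) * u x * v x)"
    unfolding energy_form_def ip_def
    by (simp only: infsum_add summable_on_add s1 summable_grad ul vl w)
  also have "\<dots> = ip (lap S (lap S u)) v + ip (\<lambda>x. - lap S u x) v + (\<Sum>\<^sub>\<infinity>x. (1 + l * a x) * u x * v x)"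
    by (simp add: infsum_grad[OF ul vl] ip_minus ip_lap_sym[OF lap_l2[OF ul] vl])
  also have "\<dots> = (\<Sum>\<^sub>\<infinity>x. lap S (lap S u) x * v x + - lap S u x * v x + (1 + l * a x) * u x * v x)"
    unfolding ip_def by (simp only: infsum_add summable_on_add s1 w)
  also have "\<dots> = (\<Sum>\<^sub>\<infinity>x. euler_op u x * v x)"
    by (intro infsum_cong) (simp add: euler_op_def algebra_simps)
  finally show ?thesis .
qed

lemma single_Efun: "single z \<in> Efun"
proof -
  have "(\<lambda>x. l * a x * (single z x)\<^sup>2) summable_on UNIV"
    by (rule finite_nonzero_values_imp_summable_on) (simp add: single_def)
  then show ?thesis by (simp add: Efun_def)
qed

lemma density_add: "density (\<lambda>x. u x + s * v x) x = density u x + (2 * s) * energy_form u v x + s\<^sup>2 * density v x"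
proof -
  have g: "grad_prod S (\<lambda>x. u x + s * v x) (\<lambda>x. u x + s * v x) x
     = grad_prod S u u x + (2 * s) * grad_prod S u v x + s\<^sup>2 * grad_prod S v v x"
    unfolding grad_prod_eq by (simp add: sum_distrib_left sum.distrib[symmetric] power2_eq_square algebra_simps)
  have "lap S (\<lambda>x. u x + s * v x) x = lap S u x + s * lap S v x"
    by (simp add: lap_add lap_cmult)
  then show ?thesis unfolding density_def energy_form_def g by (simp add: power2_eq_square algebra_simps)
qed

lemma norm_sq_change_one_site:
  assumes "u \<in> Efun"
  shows "(\<lambda>x. u x + s * single z x) \<in> Efun"
    "norm_sq (\<lambda>x. u x + s * single z x) = norm_sq u + 2 * s * euler_op u z + s\<^sup>2 * norm_sq (single z)"
proof -
  note S1 = density_summable[OF assms] and S2 = energy_form_summable[OF assms single_Efun[of z]] and S3 = density_summable[OF single_Efun[of z]]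
  have e: "density (\<lambda>x. u x + s * single z x) = (\<lambda>x. density u x + (2 * s) * energy_form u (single z) x + s\<^sup>2 * density (single z) x)"
    by (rule ext) (rule density_add)
  show "(\<lambda>x. u x + s * single z x) \<in> Efun"
    by (rule Efun_if_summable) (unfold e, intro summable_on_add summable_on_cmult_right S1 S2 S3)
  have "norm_sq (\<lambda>x. u x + s * single z x) = norm_sq u + (2 * s) * (\<Sum>\<^sub>\<infinity>x. energy_form u (single z) x) + s\<^sup>2 * norm_sq (single z)"
    unfolding norm_sq_def e
    by (simp only: infsum_add summable_on_add summable_on_cmult_right S1 S2 S3 infsum_cmult_right')
  also have "(\<Sum>\<^sub>\<infinity>x. energy_form u (single z) x) = euler_op u z"
    unfolding energy_form_by_parts[OF assms single_Efun] ip_def[symmetric] by simp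
  finally show "norm_sq (\<lambda>x. u x + s * single z x) = norm_sq u + 2 * s * euler_op u z + s\<^sup>2 * norm_sq (single z)" .
qed

text \<open>Change the maximiser at the single site \<open>z\<close> by \<open>s\<close>. Then \<open>best \<parallel>w\<^sub>s\<parallel>\<^bsup>2p\<^esup> - D(w\<^sub>s)\<close> is an explicit
differentiable function of \<open>s\<close> that is nonnegative and vanishes at \<open>s = 0\<close>. Varying one site at a time
suffices and keeps \<open>D\<close> exact.\<close>

lemma maximizer_euler_lagrange:
  assumes u: "u \<in> Efun" "norm_sq u = 1" "form (pow u) (pow u) = best"
  shows "best * euler_op u z = green_conv S \<alpha> (pow u) z * \<bar>u z\<bar> powr (p - 2) * u z"
proof -
  define G where "G = green_conv S \<alpha> (pow u) z"
  define w where "w s = (\<lambda>x. u x + s * single z x)" for s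
  define g where "g s = best * (1 + 2 * s * euler_op u z + s\<^sup>2 * norm_sq (single z)) powr p
      - best - 2 * (\<bar>u z + s\<bar> powr p - \<bar>u z\<bar> powr p) * G" for s
  have g0: "0 \<le> g s" for s
  proof -
    have w: "w s \<in> Efun" "norm_sq (w s) = 1 + 2 * s * euler_op u z + s\<^sup>2 * norm_sq (single z)"
      using norm_sq_change_one_site[OF u(1), of s z] u(2) by (simp_all add: w_def)
    have "form (pow (w s)) (pow (w s)) = best + 2 * (\<bar>u z + s\<bar> powr p - \<bar>u z\<bar> powr p) * G"
      using form_change_one_site[OF Efun_l2[OF u(1)], of z "w s"] u(3) by (simp add: w_def G_def single_def)
    then show ?thesis using form_le_best_norm_sq[OF w(1)] unfolding g_def w(2) by simp
  qed
  have gz: "g 0 = 0" by (simp add: g_def)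
  have d1: "((\<lambda>s. (1 + 2 * s * euler_op u z + s\<^sup>2 * norm_sq (single z)) powr p) has_real_derivative p * (2 * euler_op u z)) (at 0)"
  proof -
    have "((\<lambda>s. 1 + 2 * s * euler_op u z + s\<^sup>2 * norm_sq (single z)) has_real_derivative 2 * euler_op u z) (at 0)"
      by (auto intro!: derivative_eq_intros)
    from DERIV_chain2[of "\<lambda>y. y powr p", OF has_real_derivative_powr this] show ?thesis by simp
  qed
  have d2: "((\<lambda>s. \<bar>u z + s\<bar> powr p) has_real_derivative p * \<bar>u z\<bar> powr (p - 2) * u z) (at 0)"
  proof -
    have "((\<lambda>s. u z + s) has_real_derivative 1) (at 0)" by (auto intro!: derivative_eq_intros)
    from DERIV_chain2[of "\<lambda>y. \<bar>y\<bar> powr p", OF DERIV_abs_powr[OF p_gt_1] this] show ?thesis by simp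
  qed
  have "(g has_real_derivative best * (p * (2 * euler_op u z)) - 2 * (p * \<bar>u z\<bar> powr (p - 2) * u z) * G) (at 0)"
    unfolding g_def by (rule derivative_eq_intros d1 d2 refl | simp)+
  from DERIV_local_min[OF this, of 1] have "best * (p * (2 * euler_op u z)) - 2 * (p * \<bar>u z\<bar> powr (p - 2) * u z) * G = 0"
    using g0 gz by simp
  then have "(2 * p) * (best * euler_op u z - G * \<bar>u z\<bar> powr (p - 2) * u z) = 0" by (simp add: algebra_simps)
  then show ?thesis using p_gt_1 by (simp add: G_def)
qed

lemma green_conv_scale: "green_conv S \<alpha> (pow (\<lambda>x. c * u x)) x = \<bar>c\<bar> powr p * green_conv S \<alpha> (pow u) x"
  unfolding green_conv_R0 by (simp add: abs_mult powr_mult mult.left_commute infsum_cmult_right')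

lemma abs_powr_minus_2: "\<bar>c::real\<bar> powr (p - 2) * (c * c) = \<bar>c\<bar> powr p"
proof (cases "c = 0")
  case False
  have "c * c = \<bar>c\<bar> powr 2" using False by (simp add: power2_eq_square)
  then show ?thesis by (simp only: powr_add[symmetric]) simp
qed simp

lemma dJ_self: "u \<in> Efun \<Longrightarrow> dJ S a \<alpha> p l u u = norm_sq u - form (pow u) (pow u)"
proof -
  assume u: "u \<in> Efun"
  have "(\<Sum>\<^sub>\<infinity>x. green_conv S \<alpha> (pow u) x * \<bar>u x\<bar> powr (p - 2) * u x * u x)
     = form (pow u) (pow u)"
    unfolding form_iterated[OF Efun_l2[OF u] Efun_l2[OF u]]
    by (intro infsum_cong) (simp add: mult.assoc abs_powr_minus_2)
  moreover have "(\<Sum>\<^sub>\<infinity>x. lap S u x * lap S u x + grad_prod S u u x + (1 + l * a x) * u x * u x) = norm_sq u"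
    unfolding norm_sq_def density_def by (simp add: power2_eq_square mult.assoc)
  ultimately show ?thesis by (simp add: dJ_def)
qed

lemma J_eq: "u \<in> Efun \<Longrightarrow> J S a \<alpha> p l u = 1/2 * norm_sq u - 1 / (2 * p) * form (pow u) (pow u)"
  unfolding J_def E_norm_sq using form_iterated[of u u] Efun_l2[of u] by simp

text \<open>The factor \<open>\<tau>\<close> is chosen so that \<open>\<tau>u\<close> lies on the Nehari manifold. There \<open>J\<close> is a positive multiple of the
squared norm, and \<open>\<parallel>w\<parallel>\<^sup>2 = D(w) \<le> best \<parallel>w\<parallel>\<^bsup>2p\<^esup>\<close> shows that no element has smaller norm than \<open>\<tau>u\<close>.\<close>

proposition ground_state_from_maximizer:
  assumes u: "u \<in> Efun" "norm_sq u = 1" "form (pow u) (pow u) = best" and b: "0 < best"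
  shows "\<exists>U\<in>Efun. ground_state S a \<alpha> p l U \<and> 0 < form (pow U) (pow U) \<and>
     (\<forall>x. euler_op U x = green_conv S \<alpha> (pow U) x * \<bar>U x\<bar> powr (p - 2) * U x)"
proof -
  define \<tau> where "\<tau> = best powr (- 1 / (2 * (p - 1)))"
  have p1: "p - 1 > 0" using p_gt_1 by simp
  have t: "\<tau> > 0" using b by (simp add: \<tau>_def)
  have tp: "best * \<tau> powr (2 * (p - 1)) = 1"
  proof -
    have "(- 1 / (2 * (p - 1))) * (2 * (p - 1)) = - 1" using p1 by simp
    then show ?thesis unfolding \<tau>_def powr_powr using b by (simp add: powr_minus)
  qed
  define U where "U = (\<lambda>x. \<tau> * u x)"
  have UE: "U \<in> Efun" unfolding U_def by (rule Efun_cmult[OF u(1)])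
  have NU: "norm_sq U = \<tau>\<^sup>2" unfolding U_def norm_sq_cmult u(2) by simp
  have t2p: "(\<tau> powr p)\<^sup>2 * best = \<tau>\<^sup>2"
  proof -
    have "(\<tau> powr p)\<^sup>2 = \<tau> powr (2 * (p - 1)) * \<tau> powr 2"
      unfolding power2_eq_square powr_add[symmetric] by (simp add: algebra_simps)
    also have "\<tau> powr 2 = \<tau>\<^sup>2" using t by simp
    finally show ?thesis using tp by (simp add: mult_ac)
  qed
  have FU: "form (pow U) (pow U) = \<tau>\<^sup>2"
    unfolding U_def form_scale u(3) using t t2p by simp
  have EL: "euler_op U x = green_conv S \<alpha> (pow U) x * \<bar>U x\<bar> powr (p - 2) * U x" for x
  proof -
    have "euler_op U x = \<tau> * euler_op u x"
      by (simp add: euler_op_def U_def lap_cmult algebra_simps)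
    moreover have "\<bar>U x\<bar> powr (p - 2) * U x = (\<tau> powr (p - 2) * \<tau>) * (\<bar>u x\<bar> powr (p - 2) * u x)"
      using t by (simp add: U_def abs_mult powr_mult)
    moreover have "\<tau> powr (p - 2) * \<tau> = \<tau> powr (p - 1)" using t powr_add[of \<tau> "p - 2" 1] by simp
    moreover have "green_conv S \<alpha> (pow U) x = \<tau> powr p * green_conv S \<alpha> (pow u) x"
      unfolding U_def green_conv_scale using t by simp
    ultimately have "green_conv S \<alpha> (pow U) x * \<bar>U x\<bar> powr (p - 2) * U x
       = (\<tau> powr p * \<tau> powr (p - 1)) * (green_conv S \<alpha> (pow u) x * \<bar>u x\<bar> powr (p - 2) * u x)"
      by (simp add: mult_ac)
    also have "\<dots> = (\<tau> powr p * \<tau> powr (p - 1)) * (best * euler_op u x)"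
      using maximizer_euler_lagrange[OF u, of x] by simp
    also have "\<tau> powr p * \<tau> powr (p - 1) = \<tau> powr (2 * (p - 1)) * \<tau>"
    proof -
      have "\<tau> powr p * \<tau> powr (p - 1) = \<tau> powr (2 * (p - 1) + 1)" unfolding powr_add[symmetric] by (simp add: algebra_simps)
      then show ?thesis using t by (simp only: powr_add powr_one)
    qed
    also have "\<tau> powr (2 * (p - 1)) * \<tau> * (best * euler_op u x) = (best * \<tau> powr (2 * (p - 1))) * (\<tau> * euler_op u x)"
      by (simp only: mult_ac)
    finally show ?thesis using tp \<open>euler_op U x = \<tau> * euler_op u x\<close> by simp
  qed
  have crit: "critical_point S a \<alpha> p l U"
    unfolding critical_point_def E_space_eq
  proof (intro conjI ballI UE)
    fix v assume v: "v \<in> Efun"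
    have "(\<Sum>\<^sub>\<infinity>x. green_conv S \<alpha> (pow U) x * \<bar>U x\<bar> powr (p - 2) * U x * v x) = (\<Sum>\<^sub>\<infinity>x. euler_op U x * v x)"
      by (simp add: EL)
    then show "dJ S a \<alpha> p l U v = 0"
      using energy_form_by_parts[OF UE v] by (simp add: dJ_def energy_form_def)
  qed
  have Une: "U \<noteq> (\<lambda>_. 0)"
  proof
    assume U0: "U = (\<lambda>_. 0)"
    have "form (pow U) (pow U) = 0" unfolding form_def by (rule infsum_0) (auto simp: U0)
    then show False using FU t by simp
  qed
  have c: "1/2 - 1/(2 * p) > 0" using p_gt_1 by (simp add: field_simps)
  have JU: "J S a \<alpha> p l U = (1/2 - 1/(2 * p)) * \<tau>\<^sup>2"
    unfolding J_eq[OF UE] NU FU by (simp add: algebra_simps)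
  have low: "(1/2 - 1/(2 * p)) * \<tau>\<^sup>2 \<le> J S a \<alpha> p l w" if "w \<in> Nehari S a \<alpha> p l" for w
  proof -
    have w: "w \<in> Efun" "w \<noteq> (\<lambda>_. 0)" "norm_sq w = form (pow w) (pow w)"
      using that dJ_self[of w] by (auto simp: Nehari_def E_space_eq)
    have N0: "norm_sq w > 0"
    proof -
      have "norm_sq w \<noteq> 0"
      proof
        assume "norm_sq w = 0"
        then have "ip w w = 0" using ip_le_norm_sq[OF w(1)] ip_nonneg[of w] by linarith
        then show False using l2_eq_0[OF Efun_l2[OF w(1)]] w(2) by blast
      qed
      then show ?thesis using norm_sq_nonneg[of w] by simp
    qed
    have "norm_sq w \<le> best * norm_sq w powr p" using form_le_best_norm_sq[OF w(1)] w(3) by simp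
    also have "norm_sq w powr p = norm_sq w powr (p - 1) * norm_sq w" using N0 powr_add[of "norm_sq w" "p - 1" 1] by simp
    finally have "1 \<le> best * norm_sq w powr (p - 1)" using N0 by simp
    then have "best * \<tau> powr (2 * (p - 1)) \<le> best * norm_sq w powr (p - 1)" using tp by simp
    then have "\<tau> powr (2 * (p - 1)) \<le> norm_sq w powr (p - 1)" using b by simp
    moreover have "\<tau> powr (2 * (p - 1)) = (\<tau>\<^sup>2) powr (p - 1)"
      using t powr_powr[of \<tau> 2 "p - 1"] by simp
    ultimately have "(\<tau>\<^sup>2) powr (p - 1) \<le> norm_sq w powr (p - 1)" by simp
    then have "\<tau>\<^sup>2 \<le> norm_sq w"
      using powr_less_mono2[OF p1, of "norm_sq w" "\<tau>\<^sup>2"] N0 by (meson less_imp_le not_le)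
    then have "(1/2 - 1/(2 * p)) * \<tau>\<^sup>2 \<le> (1/2 - 1/(2 * p)) * norm_sq w" using c by (intro mult_left_mono) auto
    also have "\<dots> = J S a \<alpha> p l w" unfolding J_eq[OF w(1)] w(3)[symmetric] by (simp add: algebra_simps)
    finally show ?thesis .
  qed
  have UN: "U \<in> Nehari S a \<alpha> p l"
    using UE Une dJ_self[OF UE] NU FU by (simp add: Nehari_def E_space_eq)
  have gl: "ground_level S a \<alpha> p l = J S a \<alpha> p l U"
    unfolding ground_level_def
    by (rule cInf_eq_minimum[OF imageI[OF UN]]) (use low in \<open>auto simp: JU\<close>)
  have "0 < J S a \<alpha> p l U" unfolding JU using c t by simp
  then have "ground_state S a \<alpha> p l U"
    using crit Une gl by (simp add: ground_state_def)
  then show ?thesis using UE EL FU t by (intro bexI[of _ U]) auto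
qed

text \<open>Test with value \<open>1\<close> at the zero \<open>x0\<close> of \<open>a\<close> and \<open>l\<^bsup>-1/2\<^esup>\<close> at a neighbour. The potential term of the norm is then \<open>a\<close> at the neighbour,
independent of \<open>l\<close>, while the energy only loses the factor \<open>l\<^bsup>-p/2\<^esup>\<close>.\<close>

lemma best_lower_bound:
  assumes x0: "a x0 = 0" and s: "s \<in> S" "s \<noteq> 0" and l1: "1 \<le> l"
  shows "R x0 (x0 + s) * l powr (- p / 2)
    \<le> best * (2 * (3/2 * (2 * real (card S))\<^sup>2 + 3/2) + a (x0 + s)) powr p"
proof -
  let ?y = "x0 + s"
  let ?r = "l powr (- 1/2)"
  let ?K = "3/2 * (2 * real (card S))\<^sup>2 + 3/2"
  have ne: "x0 \<noteq> ?y" using s(2) add_left_imp_eq[of x0 0 s] by auto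
  define w where "w = (\<lambda>x. single x0 x + ?r * single ?y x)"
  have r2: "?r\<^sup>2 = 1 / l"
    using l_pos by (simp add: power2_eq_square powr_add[symmetric] powr_minus_divide)
  have wE: "w \<in> Efun" unfolding w_def by (rule norm_sq_change_one_site(1)[OF single_Efun])
  note wl = Efun_l2[OF wE]
  have wv: "w x0 = 1" "w ?y = ?r" "\<And>x. x \<noteq> x0 \<Longrightarrow> x \<noteq> ?y \<Longrightarrow> w x = 0"
    using ne by (auto simp: w_def single_def)
  have sum2: "(\<Sum>\<^sub>\<infinity>x. f x * (w x)\<^sup>2) = f x0 + f ?y * (1 / l)" for f
  proof -
    have "(\<Sum>\<^sub>\<infinity>x. f x * (w x)\<^sup>2) = (\<Sum>\<^sub>\<infinity>x\<in>{x0, ?y}. f x * (w x)\<^sup>2)"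
      by (rule infsum_cong_neutral) (use wv in auto)
    also have "\<dots> = f x0 * (w x0)\<^sup>2 + f ?y * (w ?y)\<^sup>2" using ne by (subst infsum_finite) auto
    finally show ?thesis unfolding wv(1,2) r2 by simp
  qed
  have "ip w w = 1 + 1 / l" using sum2[of "\<lambda>_. 1"] by (simp add: ip_self)
  then have ipw: "ip w w \<le> 2" using l1 by simp
  have "norm_sq w = (\<Sum>\<^sub>\<infinity>x. ((lap S w x)\<^sup>2 + grad_prod S w w x + (w x)\<^sup>2) + l * a x * (w x)\<^sup>2)"
    unfolding norm_sq_def density_def by (intro infsum_cong) (simp add: algebra_simps)
  also have "\<dots> = (\<Sum>\<^sub>\<infinity>x. (lap S w x)\<^sup>2 + grad_prod S w w x + (w x)\<^sup>2) + (\<Sum>\<^sub>\<infinity>x. l * a x * (w x)\<^sup>2)"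
    using wE W22_summable[OF wl] by (intro infsum_add) (auto simp: Efun_def)
  also have "(\<Sum>\<^sub>\<infinity>x. l * a x * (w x)\<^sup>2) = a ?y" using sum2[of "\<lambda>x. l * a x"] x0 l_pos by simp
  also have "(\<Sum>\<^sub>\<infinity>x. (lap S w x)\<^sup>2 + grad_prod S w w x + (w x)\<^sup>2) \<le> ?K * 2"
    by (rule order_trans[OF W22_energy_le[OF wl] mult_left_mono[OF ipw]]) simp
  finally have Nw: "norm_sq w \<le> 2 * ?K + a ?y" by simp
  have "R x0 ?y * l powr (- p / 2) = (\<Sum>(x, y)\<in>{(x0, ?y)}. R0 x y * pow w y * pow w x)"
    using ne by (simp add: wv R0_def powr_powr)
  also have "\<dots> \<le> form (pow w) (pow w)"
    unfolding form_def by (rule finite_sum_le_infsum[OF form_summable[OF wl wl]]) (auto simp: R0_nonneg)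
  also have "\<dots> \<le> best * norm_sq w powr p" by (rule form_le_best_norm_sq[OF wE])
  also have "\<dots> \<le> best * (2 * ?K + a ?y) powr p"
  proof (rule mult_left_mono)
    show "norm_sq w powr p \<le> (2 * ?K + a ?y) powr p" using Nw norm_sq_nonneg p_gt_1 by (intro powr_mono2) auto
    have "form (pow (\<lambda>_. 0)) (pow (\<lambda>_. 0)) \<le> best"
      using norm_sq_cmult[of 0 w] Efun_cmult[OF wE, of 0] by (intro form_le_best) auto
    then show "0 \<le> best" using form_nonneg[of "\<lambda>_. 0" "\<lambda>_. 0"] by linarith
  qed
  finally show ?thesis .
qed

end

context choquard
begin

text \<open>The lower bound for \<open>best\<close> is of order \<open>l\<^bsup>-p/2\<^esup>\<close> and the contribution of escaping mass of order \<open>l\<^bsup>-p\<^esup>\<close>, so the maximum is attained once \<open>l\<close>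
is large.\<close>

proposition ground_state_exists:
  assumes a: "\<And>x. 0 \<le> a x" and x0: "a x0 = 0" and M: "0 < M" "finite {x. a x \<le> M}"
  shows "\<exists>l0>0. \<forall>l\<ge>l0. \<exists>U. U \<in> l2 \<and> ground_state S a \<alpha> p l U \<and> 0 < form (pow U) (pow U) \<and>
     (\<forall>x. lap S (lap S U) x - lap S U x + (1 + l * a x) * U x
        = green_conv S \<alpha> (pow U) x * \<bar>U x\<bar> powr (p - 2) * U x)"
proof -
  obtain s where s: "s \<in> S" "s \<noteq> 0" using nonzero_generator by blast
  define r where "r = R x0 (x0 + s)"
  have r: "r > 0" unfolding r_def by (rule green_pos_neighbour[OF s])
  define K where "K = (2 * (3/2 * (2 * real (card S))\<^sup>2 + 3/2) + a (x0 + s)) powr p"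
  have K: "K > 0"
  proof -
    have "0 < 2 * (3/2 * (2 * real (card S))\<^sup>2 + 3/2) + a (x0 + s)"
      using a[of "x0 + s"] by (intro add_pos_nonneg) (auto intro!: add_nonneg_pos)
    then show ?thesis by (simp add: K_def)
  qed
  \<comment> \<open>For \<open>l\<^bsup>p/2\<^esup> > T\<close> the lower bound beats the contribution of escaping mass.\<close>
  define T where "T = form_const * M powr (- p) * K / r"
  have T: "T > 0" using form_const(1) M K r by (simp add: T_def)
  define l0 where "l0 = max 1 (T powr (2 / p) + 1)"
  have "\<exists>U. U \<in> l2 \<and> ground_state S a \<alpha> p l U \<and> 0 < form (pow U) (pow U) \<and>
     (\<forall>x. lap S (lap S U) x - lap S U x + (1 + l * a x) * U x
        = green_conv S \<alpha> (pow U) x * \<bar>U x\<bar> powr (p - 2) * U x)" if l: "l0 \<le> l" for l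
  proof -
    have l1: "1 \<le> l" "T powr (2 / p) < l"
      using l max.cobounded1[of 1 "T powr (2 / p) + 1"] max.cobounded2[of "T powr (2 / p) + 1" 1]
      unfolding l0_def by linarith+
    interpret potential_well S N \<alpha> q p a l
      by unfold_locales (use a l1 in auto)
    have low: "r * l powr (- p / 2) \<le> best * K"
      unfolding r_def K_def by (rule best_lower_bound[OF x0 s l1(1)])
    have "T = (T powr (2 / p)) powr (p / 2)" unfolding powr_powr using T p_gt_1 by simp
    also have "\<dots> < l powr (p / 2)" using l1 p_gt_1 by (intro powr_less_mono2) auto
    finally have Tl: "T < l powr (p / 2)" .
    have "(1 + l * M) powr (- p) \<le> (l * M) powr (- p)"
      using l1 M p_gt_1 by (intro powr_mono2') auto
    also have "\<dots> = l powr (- p) * M powr (- p)" using l1 M by (simp add: powr_mult)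
    finally have "form_const * (1 + l * M) powr (- p) * K \<le> form_const * (l powr (- p) * M powr (- p)) * K"
      using form_const(1) K by (intro mult_right_mono mult_left_mono) auto
    also have "\<dots> = T * r * l powr (- p)" using r by (simp add: T_def)
    also have "\<dots> < l powr (p / 2) * r * l powr (- p)"
      using Tl r l1 by (intro mult_strict_right_mono) auto
    also have "\<dots> = r * l powr (- p / 2)"
    proof -
      have "l powr (p / 2) * l powr (- p) = l powr (- p / 2)" unfolding powr_add[symmetric] by simp
      then show ?thesis by (metis mult.assoc mult.commute)
    qed
    finally have "form_const * (1 + l * M) powr (- p) * K < best * K" using low by linarith
    then have small: "form_const * (1 + l * M) powr (- p) < best" using K by simp
    have "0 \<le> form_const * (1 + l * M) powr (- p)" using form_const(1) by simp
    then have bpos: "0 < best" using small by linarith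
    obtain u where u: "u \<in> Efun" "norm_sq u = 1" "form (pow u) (pow u) = best"
      using best_attained[OF M small] by blast
    obtain U where "U \<in> Efun" "ground_state S a \<alpha> p l U" "0 < form (pow U) (pow U)"
       "\<forall>x. euler_op U x = green_conv S \<alpha> (pow U) x * \<bar>U x\<bar> powr (p - 2) * U x"
      using ground_state_from_maximizer[OF u bpos] by blast
    then show ?thesis unfolding euler_op_def using Efun_l2 by blast
  qed
  moreover have "0 < l0"
    using max.cobounded1[of 1 "T powr (2 / p) + 1"] unfolding l0_def by linarith
  ultimately show ?thesis by blast
qed

end

section \<open>Mellin transforms of decreasing profiles\<close>

lemma set_integral_from_nn:
  fixes f :: "real \<Rightarrow> real"
  assumes [measurable]: "f \<in> borel_measurable borel"
    and nn: "\<And>t. t > 0 \<Longrightarrow> 0 \<le> f t" and c: "0 \<le> c"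
    and eq: "(\<integral>\<^sup>+t. ennreal (if 0 < t then f t else 0) \<partial>lborel) = ennreal c"
  shows "set_integrable lborel {0<..} f" "(LINT t:{0<..}|lborel. f t) = c"
proof -
  have i: "(\<lambda>t. indicator {0<..} t *\<^sub>R f t) = (\<lambda>t. if 0 < t then f t else 0)" by (auto simp: indicator_def)
  have "has_bochner_integral lborel (\<lambda>t. if 0 < t then f t else 0) c"
    using nn by (intro has_bochner_integral_nn_integral[OF _ _ c eq]) auto
  then show "set_integrable lborel {0<..} f" "(LINT t:{0<..}|lborel. f t) = c"
    unfolding set_integrable_def set_lebesgue_integral_def i
    by (auto simp: has_bochner_integral_iff)
qed

lemma nn_from_set_integral:
  fixes f :: "real \<Rightarrow> real"
  assumes "set_integrable lborel {0<..} f" and nn: "\<And>t. t > 0 \<Longrightarrow> 0 \<le> f t"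
  shows "(\<integral>\<^sup>+t. ennreal (if 0 < t then f t else 0) \<partial>lborel) = ennreal (LINT t:{0<..}|lborel. f t)"
proof -
  have i: "(\<lambda>t. indicator {0<..} t *\<^sub>R f t) = (\<lambda>t. if 0 < t then f t else 0)" by (auto simp: indicator_def)
  show ?thesis
    using assms unfolding set_integrable_def set_lebesgue_integral_def i
    by (intro nn_integral_eq_integral) auto
qed

lemma nn_powr_0_to:
  assumes "0 < c" "0 \<le> z"
  shows "(\<integral>\<^sup>+r. ennreal (if 0 < r \<and> r \<le> z then r powr (- 1 + c) else 0) \<partial>lborel) = ennreal (z powr c / c)"
proof -
  have "((\<lambda>r. r powr (- 1 + c)) has_integral (z powr (- 1 + c + 1) / (- 1 + c + 1))) {0..z}"
    using assms by (intro has_integral_powr_from_0) auto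
  then have "((\<lambda>r. r powr (- 1 + c)) has_integral (z powr c / c)) {0..z}" by simp
  then have "((\<lambda>r. if r \<in> {0..z} then r powr (- 1 + c) else 0) has_integral (z powr c / c)) UNIV"
    by (subst has_integral_restrict_UNIV)
  moreover have "(\<lambda>r. if r \<in> {0..z} then r powr (- 1 + c) else 0) = (\<lambda>r. if 0 < r \<and> r \<le> z then r powr (- 1 + c) else 0)"
    by auto
  ultimately show ?thesis by (intro nn_integral_has_integral_lborel) auto
qed

lemma nn_powr_to_inf:
  assumes "0 < \<sigma>" "0 < c"
  shows "(\<integral>\<^sup>+t. ennreal (if c < t then t powr (- 1 - \<sigma>) else 0) \<partial>lborel) = ennreal (c powr (- \<sigma>) / \<sigma>)"
proof -
  have "((\<lambda>t. t powr (- 1 - \<sigma>)) has_integral - (c powr ((- 1 - \<sigma>) + 1)) / ((- 1 - \<sigma>) + 1)) {c..}"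
    using assms by (intro has_integral_powr_to_inf) auto
  then have "((\<lambda>t. t powr (- 1 - \<sigma>)) has_integral c powr (- \<sigma>) / \<sigma>) {c..}" by simp
  then have "((\<lambda>t. if t \<in> {c..} then t powr (- 1 - \<sigma>) else 0) has_integral c powr (- \<sigma>) / \<sigma>) UNIV"
    by (subst has_integral_restrict_UNIV)
  then have "(\<integral>\<^sup>+t. ennreal (if t \<in> {c..} then t powr (- 1 - \<sigma>) else 0) \<partial>lborel) = ennreal (c powr (- \<sigma>) / \<sigma>)"
    by (intro nn_integral_has_integral_lborel) auto
  moreover have "(\<integral>\<^sup>+t. ennreal (if t \<in> {c..} then t powr (- 1 - \<sigma>) else 0) \<partial>lborel)
     = (\<integral>\<^sup>+t. ennreal (if c < t then t powr (- 1 - \<sigma>) else 0) \<partial>lborel)"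
  proof (rule nn_integral_cong_AE)
    show "AE t in lborel. ennreal (if t \<in> {c..} then t powr (- 1 - \<sigma>) else 0) = ennreal (if c < t then t powr (- 1 - \<sigma>) else 0)"
      using AE_lborel_singleton[of c] by eventually_elim auto
  qed
  ultimately show ?thesis by simp
qed

text \<open>Euler's Beta integral, rescaled to an interval of length \<open>z\<close>; with these exponents the power of \<open>z\<close> cancels.\<close>

lemma nn_beta:
  assumes "0 < \<sigma>" "\<sigma> < 1" "0 < z"
  shows "(\<integral>\<^sup>+r. ennreal (if 0 < r \<and> r < z then r powr (- 1 + \<sigma>) * (z - r) powr (- \<sigma>) else 0) \<partial>lborel)
     = ennreal (Gamma \<sigma> * Gamma (1 - \<sigma>))"
proof -
  have "((\<lambda>t. t powr (\<sigma> - 1) * (1 - t) powr ((1 - \<sigma>) - 1)) has_integral Beta \<sigma> (1 - \<sigma>)) {0..1}"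
    using assms by (intro has_integral_Beta_real) auto
  then have "((\<lambda>t. if t \<in> {0..1} then t powr (\<sigma> - 1) * (1 - t) powr ((1 - \<sigma>) - 1) else 0) has_integral Beta \<sigma> (1 - \<sigma>)) UNIV"
    by (subst has_integral_restrict_UNIV)
  moreover have "(\<lambda>t. if t \<in> {0..1} then t powr (\<sigma> - 1) * (1 - t) powr ((1 - \<sigma>) - 1) else 0)
     = (\<lambda>t. if 0 < t \<and> t < 1 then t powr (- 1 + \<sigma>) * (1 - t) powr (- \<sigma>) else (0::real))"
    by (rule ext) (auto simp: less_le)
  moreover have "Beta \<sigma> (1 - \<sigma>) = Gamma \<sigma> * Gamma (1 - \<sigma>)" by (simp add: Beta_def)
  ultimately have 1: "(\<integral>\<^sup>+t. ennreal (if 0 < t \<and> t < 1 then t powr (- 1 + \<sigma>) * (1 - t) powr (- \<sigma>) else 0) \<partial>lborel)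
     = ennreal (Gamma \<sigma> * Gamma (1 - \<sigma>))"
    by (intro nn_integral_has_integral_lborel) auto
  have "(\<integral>\<^sup>+r. ennreal (if 0 < r \<and> r < z then r powr (- 1 + \<sigma>) * (z - r) powr (- \<sigma>) else 0) \<partial>lborel)
    = ennreal \<bar>z\<bar> * (\<integral>\<^sup>+t. ennreal (if 0 < 0 + z * t \<and> 0 + z * t < z then (0 + z * t) powr (- 1 + \<sigma>) * (z - (0 + z * t)) powr (- \<sigma>) else 0) \<partial>lborel)"
    using assms by (intro nn_integral_real_affine) auto
  also have "\<dots> = (\<integral>\<^sup>+t. ennreal z * ennreal (if 0 < 0 + z * t \<and> 0 + z * t < z then (0 + z * t) powr (- 1 + \<sigma>) * (z - (0 + z * t)) powr (- \<sigma>) else 0) \<partial>lborel)"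
    using assms by (subst nn_integral_cmult) auto
  also have "\<dots> = (\<integral>\<^sup>+t. ennreal (if 0 < t \<and> t < 1 then t powr (- 1 + \<sigma>) * (1 - t) powr (- \<sigma>) else 0) \<partial>lborel)"
  proof (rule nn_integral_cong)
    fix t :: real
    have c: "(0 < 0 + z * t \<and> 0 + z * t < z) = (0 < t \<and> t < 1)"
      using assms(3) by (auto simp: zero_less_mult_iff)
    have "z * ((z * t) powr (- 1 + \<sigma>) * (z - z * t) powr (- \<sigma>)) = t powr (- 1 + \<sigma>) * (1 - t) powr (- \<sigma>)" if t: "0 < t" "t < 1"
    proof -
      have "z - z * t = z * (1 - t)" by (simp add: algebra_simps)
      then have "(z - z * t) powr (- \<sigma>) = z powr (- \<sigma>) * (1 - t) powr (- \<sigma>)" using t assms by (simp only: powr_mult)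
      moreover have "(z * t) powr (- 1 + \<sigma>) = z powr (- 1 + \<sigma>) * t powr (- 1 + \<sigma>)" using t assms by (simp only: powr_mult)
      moreover have "z * (z powr (- 1 + \<sigma>) * z powr (- \<sigma>)) = 1"
        unfolding powr_add[symmetric] using assms by (simp add: powr_minus)
      ultimately show ?thesis by (simp only: mult_ac) (metis mult.assoc mult.commute mult_1)
    qed
    then show "ennreal z * ennreal (if 0 < 0 + z * t \<and> 0 + z * t < z then (0 + z * t) powr (- 1 + \<sigma>) * (z - (0 + z * t)) powr (- \<sigma>) else 0)
      = ennreal (if 0 < t \<and> t < 1 then t powr (- 1 + \<sigma>) * (1 - t) powr (- \<sigma>) else 0)"
      unfolding c using assms(3) by (simp add: ennreal_mult[symmetric])
  qed
  finally show ?thesis unfolding 1 .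
qed

text \<open>The functions of time \<open>\<langle>e\<^bsup>t\<Delta>\<^esup>g, g\<rangle>\<close> have this form. As \<open>\<phi>\<close> is the integral of \<open>-\<phi>' \<ge> 0\<close> over a
half-line, its Mellin transforms become integrals of nonnegative functions, whose order of
integration may be exchanged freely.\<close>

locale decreasing_profile =
  fixes \<phi> \<phi>' :: "real \<Rightarrow> real" and b C :: real
  assumes der: "\<And>t. (\<phi> has_real_derivative \<phi>' t) (at t)"
    and cont: "continuous_on UNIV \<phi>'"
    and dec: "\<And>t. 0 \<le> t \<Longrightarrow> \<phi>' t \<le> 0"
    and nn: "\<And>t. 0 \<le> t \<Longrightarrow> 0 \<le> \<phi> t"
    and bound: "\<And>t. 0 < t \<Longrightarrow> \<phi> t \<le> C * envelope b t"
    and b_pos: "0 < b"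
begin

lemma phi_meas [measurable]: "\<phi> \<in> borel_measurable borel"
  by (intro borel_measurable_continuous_onI DERIV_continuous_on) (auto intro: has_field_derivative_at_within der)

lemma phi'_meas [measurable]: "\<phi>' \<in> borel_measurable borel"
  by (rule borel_measurable_continuous_onI[OF cont])

lemma phi_lim: "(\<phi> \<longlongrightarrow> 0) at_top"
proof (rule tendsto_sandwich[OF _ _ tendsto_const])
  have "((\<lambda>t. C * t powr (- b)) \<longlongrightarrow> C * 0) at_top"
    by (intro tendsto_intros tendsto_neg_powr) (use b_pos filterlim_ident in auto)
  then show "((\<lambda>t. C * t powr (- b)) \<longlongrightarrow> 0) at_top" by simp
  show "\<forall>\<^sub>F t in at_top. 0 \<le> \<phi> t" using eventually_ge_at_top[of 0] by eventually_elim (rule nn)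
  show "\<forall>\<^sub>F t in at_top. \<phi> t \<le> C * t powr (- b)"
    using eventually_gt_at_top[of 1]
  proof eventually_elim
    case (elim t)
    then show ?case using bound[of t] by (simp add: envelope_def)
  qed
qed

lemma phi_decreasing: "0 \<le> r \<Longrightarrow> r \<le> t \<Longrightarrow> \<phi> t \<le> \<phi> r"
proof -
  assume r: "0 \<le> r" "r \<le> t"
  show ?thesis
  proof (rule DERIV_nonpos_imp_nonincreasing[OF r(2)])
  fix x assume "r \<le> x" "x \<le> t"
  then show "\<exists>y. (\<phi> has_real_derivative y) (at x) \<and> y \<le> 0"
    using dec[of x] r by (intro exI[of _ "\<phi>' x"] conjI der) simp
  qed
qed

lemma phi_eq_nn: "0 \<le> r \<Longrightarrow> (\<integral>\<^sup>+z. ennreal (if r \<le> z then - \<phi>' z else 0) \<partial>lborel) = ennreal (\<phi> r)"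
proof -
  assume r: "0 \<le> r"
  have "(\<integral>\<^sup>+z. ennreal (- \<phi>' z) * indicator {r..} z \<partial>lborel) = ennreal (- 0 - (- \<phi> r))"
  proof (rule nn_integral_FTC_atLeast)
    show "((\<lambda>x. - \<phi> x) \<longlongrightarrow> - 0) at_top" by (intro tendsto_minus phi_lim)
    show "((\<lambda>x. - \<phi> x) has_real_derivative - \<phi>' x) (at x)" for x by (rule DERIV_minus[OF der])
    show "0 \<le> - \<phi>' x" if "r \<le> x" for x using dec[of x] r that by simp
  qed simp
  moreover have "ennreal (- \<phi>' z) * indicator {r..} z = ennreal (if r \<le> z then - \<phi>' z else 0)" for z
    by (auto simp: indicator_def)
  ultimately show ?thesis by simp
qed

lemma phi_diff_nn: "0 \<le> r \<Longrightarrow> 0 \<le> t \<Longrightarrow>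
   (\<integral>\<^sup>+z. ennreal (if r \<le> z \<and> z \<le> r + t then - \<phi>' z else 0) \<partial>lborel) = ennreal (\<phi> r - \<phi> (r + t))"
proof -
  assume r: "0 \<le> r" "0 \<le> t"
  have "(\<integral>\<^sup>+z. ennreal (- \<phi>' z) * indicator {r..r+t} z \<partial>lborel) = ennreal (- \<phi> (r + t) - (- \<phi> r))"
  proof (rule nn_integral_FTC_Icc)
    show "((\<lambda>x. - \<phi> x) has_real_derivative - \<phi>' x) (at x)" for x by (rule DERIV_minus[OF der])
    show "0 \<le> - \<phi>' x" if "x \<in> {r..r+t}" for x using dec[of x] r that by simp
  qed (use r in auto)
  moreover have "ennreal (- \<phi>' z) * indicator {r..r+t} z = ennreal (if r \<le> z \<and> z \<le> r + t then - \<phi>' z else 0)" for z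
    by (auto simp: indicator_def)
  ultimately show ?thesis by simp
qed

lemma phi_mellin_ok: "0 < \<sigma> \<Longrightarrow> \<sigma> < b \<Longrightarrow> mellin_ok \<sigma> \<phi>"
proof (rule mellin_ok_bound(1)[of _ _ b C])
  fix t :: real assume "0 < t"
  then show "\<bar>\<phi> t\<bar> \<le> C * envelope b t" using bound[of t] nn[of t] by simp
qed auto

lemma phi_shift_mellin_ok: "0 \<le> t \<Longrightarrow> 0 < \<sigma> \<Longrightarrow> \<sigma> < b \<Longrightarrow> mellin_ok \<sigma> (\<lambda>r. \<phi> (t + r))"
proof (rule mellin_ok_bound(1)[of _ _ b C])
  fix r :: real assume t: "0 \<le> t" "0 < r"
  then have "\<phi> (t + r) \<le> \<phi> r" by (intro phi_decreasing) auto
  then show "\<bar>\<phi> (t + r)\<bar> \<le> C * envelope b r" using bound[of r] nn[of "t + r"] t by simp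
qed auto

text \<open>Insert \<open>\<phi>(r) = \<integral>\<^sub>r\<^sup>\<infinity> -\<phi>'(z) dz\<close> and integrate over \<open>r \<in> (0, z]\<close> first. Integrability of \<open>\<phi>'\<close> is part of the conclusion.\<close>

lemma mellin_derivative:
  assumes "0 < \<sigma>" "\<sigma> < b"
  shows "mellin_ok (\<sigma> + 1) (\<lambda>t. - \<phi>' t)" "mellin (\<sigma> + 1) (\<lambda>t. - \<phi>' t) = \<sigma> * mellin \<sigma> \<phi>"
proof -
  let ?G = "\<lambda>r z. ennreal (if 0 < r \<and> r \<le> z then - \<phi>' z * r powr (- 1 + \<sigma>) else 0)"
  have "ennreal (mellin \<sigma> \<phi>) = (\<integral>\<^sup>+r. ennreal (if 0 < r then \<phi> r * r powr (- 1 + \<sigma>) else 0) \<partial>lborel)"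
    unfolding mellin_def using phi_mellin_ok[OF assms] nn
    by (intro nn_from_set_integral[symmetric]) (auto simp: mellin_ok_def)
  also have "\<dots> = (\<integral>\<^sup>+r. \<integral>\<^sup>+z. ?G r z \<partial>lborel \<partial>lborel)"
  proof (rule nn_integral_cong)
    fix r :: real
    show "ennreal (if 0 < r then \<phi> r * r powr (- 1 + \<sigma>) else 0) = (\<integral>\<^sup>+z. ?G r z \<partial>lborel)"
    proof (cases "0 < r")
      case True
      have "(\<integral>\<^sup>+z. ?G r z \<partial>lborel) = (\<integral>\<^sup>+z. ennreal (r powr (- 1 + \<sigma>)) * ennreal (if r \<le> z then - \<phi>' z else 0) \<partial>lborel)"
        using True dec by (intro nn_integral_cong) (auto simp: ennreal_mult[symmetric] mult.commute)
      also have "\<dots> = ennreal (r powr (- 1 + \<sigma>)) * ennreal (\<phi> r)"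
        using True by (subst nn_integral_cmult) (auto simp: phi_eq_nn)
      finally show ?thesis using True nn[of r] by (simp add: ennreal_mult[symmetric] mult.commute)
    qed simp
  qed
  also have "\<dots> = (\<integral>\<^sup>+z. \<integral>\<^sup>+r. ?G r z \<partial>lborel \<partial>lborel)"
    by (rule lborel_pair.Fubini'[symmetric]) measurable
  also have "\<dots> = (\<integral>\<^sup>+z. ennreal (1 / \<sigma>) * ennreal (if 0 < z then - \<phi>' z * z powr (- 1 + (\<sigma> + 1)) else 0) \<partial>lborel)"
  proof (rule nn_integral_cong)
    fix z :: real
    show "(\<integral>\<^sup>+r. ?G r z \<partial>lborel) = ennreal (1 / \<sigma>) * ennreal (if 0 < z then - \<phi>' z * z powr (- 1 + (\<sigma> + 1)) else 0)"
    proof (cases "0 < z")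
      case True
      have "(\<integral>\<^sup>+r. ?G r z \<partial>lborel) = (\<integral>\<^sup>+r. ennreal (- \<phi>' z) * ennreal (if 0 < r \<and> r \<le> z then r powr (- 1 + \<sigma>) else 0) \<partial>lborel)"
        using True dec[of z] by (intro nn_integral_cong) (auto simp: ennreal_mult[symmetric])
      also have "\<dots> = ennreal (- \<phi>' z) * ennreal (z powr \<sigma> / \<sigma>)"
        using True assms by (subst nn_integral_cmult) (auto simp: nn_powr_0_to)
      also have "\<dots> = ennreal (- \<phi>' z * (z powr \<sigma> / \<sigma>))"
        using True dec[of z] assms by (intro ennreal_mult[symmetric]) auto
      also have "- \<phi>' z * (z powr \<sigma> / \<sigma>) = 1 / \<sigma> * (- \<phi>' z * z powr (- 1 + (\<sigma> + 1)))" by simp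
      also have "ennreal \<dots> = ennreal (1 / \<sigma>) * ennreal (- \<phi>' z * z powr (- 1 + (\<sigma> + 1)))"
        using True dec[of z] assms by (intro ennreal_mult mult_nonneg_nonneg) auto
      finally show ?thesis using True by simp
    next
      case False
      then have "?G r z = 0" for r by auto
      then show ?thesis using False by simp
    qed
  qed
  also have "\<dots> = ennreal (1 / \<sigma>) * (\<integral>\<^sup>+z. ennreal (if 0 < z then - \<phi>' z * z powr (- 1 + (\<sigma> + 1)) else 0) \<partial>lborel)"
    by (rule nn_integral_cmult) measurable
  finally have e: "ennreal (mellin \<sigma> \<phi>) = ennreal (1 / \<sigma>) * (\<integral>\<^sup>+z. ennreal (if 0 < z then - \<phi>' z * z powr (- 1 + (\<sigma> + 1)) else 0) \<partial>lborel)" .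
  have m0: "0 \<le> mellin \<sigma> \<phi>" using nn by (intro mellin_nonneg) auto
  have "ennreal \<sigma> * ennreal (mellin \<sigma> \<phi>) = (\<integral>\<^sup>+z. ennreal (if 0 < z then - \<phi>' z * z powr (- 1 + (\<sigma> + 1)) else 0) \<partial>lborel)"
    unfolding e mult.assoc[symmetric] using assms by (simp add: ennreal_mult[symmetric])
  then have e2: "(\<integral>\<^sup>+z. ennreal (if 0 < z then - \<phi>' z * z powr (- 1 + (\<sigma> + 1)) else 0) \<partial>lborel) = ennreal (\<sigma> * mellin \<sigma> \<phi>)"
    using assms m0 by (simp add: ennreal_mult)
  have *: "0 \<le> - \<phi>' t * t powr (- 1 + (\<sigma> + 1))" if "t > 0" for t using dec[of t] that by (simp add: mult_nonpos_nonneg)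
  have **: "0 \<le> \<sigma> * mellin \<sigma> \<phi>" using assms m0 by simp
  show "mellin_ok (\<sigma> + 1) (\<lambda>t. - \<phi>' t)" "mellin (\<sigma> + 1) (\<lambda>t. - \<phi>' t) = \<sigma> * mellin \<sigma> \<phi>"
    unfolding mellin_ok_def mellin_def
    using set_integral_from_nn[OF _ * ** e2] by (simp_all add: mellin_def)
qed

text \<open>The limiting case of order zero, in which the Mellin transform on the right is replaced by the value at \<open>0\<close>.\<close>

lemma mellin_derivative_1: "mellin_ok 1 (\<lambda>t. - \<phi>' t)" "mellin 1 (\<lambda>t. - \<phi>' t) = \<phi> 0"
proof -
  have e: "(\<integral>\<^sup>+z. ennreal (if 0 < z then - \<phi>' z * z powr (- 1 + 1) else 0) \<partial>lborel) = ennreal (\<phi> 0)"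
  proof -
    have "(\<integral>\<^sup>+z. ennreal (if 0 < z then - \<phi>' z * z powr (- 1 + 1) else 0) \<partial>lborel)
       = (\<integral>\<^sup>+z. ennreal (if 0 \<le> z then - \<phi>' z else 0) \<partial>lborel)"
    proof (rule nn_integral_cong_AE)
      show "AE z in lborel. ennreal (if 0 < z then - \<phi>' z * z powr (- 1 + 1) else 0) = ennreal (if 0 \<le> z then - \<phi>' z else 0)"
        using AE_lborel_singleton[of "0::real"] by eventually_elim auto
    qed
    then show ?thesis using phi_eq_nn[of 0] by simp
  qed
  have *: "0 \<le> - \<phi>' t * t powr (- 1 + 1)" if "t > 0" for t using dec[of t] that by (simp add: mult_nonpos_nonneg)
  show "mellin_ok 1 (\<lambda>t. - \<phi>' t)" "mellin 1 (\<lambda>t. - \<phi>' t) = \<phi> 0"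
    unfolding mellin_ok_def mellin_def
    using set_integral_from_nn[OF _ * nn[of 0] e] by simp_all
qed

text \<open>Write \<open>\<phi>(r) - \<phi>(r + t)\<close> as the integral of \<open>-\<phi>'(z)\<close> over \<open>r \<le> z \<le> r + t\<close> and integrate over \<open>t\<close>, then \<open>r\<close>, then \<open>z\<close>. The
\<open>t\<close>-integral over \<open>t > z - r\<close> is \<open>(z - r)\<^bsup>-\<sigma>\<^esup>/\<sigma>\<close>, the \<open>r\<close>-integral over \<open>(0, z)\<close> is a Beta integral that does not depend on \<open>z\<close>, and the total mass of
\<open>-\<phi>'\<close> is \<open>\<phi>(0)\<close>.\<close>

lemma fractional_inversion:
  assumes s: "0 < \<sigma>" "\<sigma> < 1" "\<sigma> < b"
  defines "W \<equiv> \<lambda>t. mellin \<sigma> (\<lambda>r. \<phi> (t + r))"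
  shows "set_integrable lborel {0<..} (\<lambda>t. (W 0 - W t) * t powr (- 1 - \<sigma>))"
    "(LINT t:{0<..}|lborel. (W 0 - W t) * t powr (- 1 - \<sigma>)) = Gamma \<sigma> * Gamma (1 - \<sigma>) / \<sigma> * \<phi> 0"
proof -
  have diff: "W 0 - W t = mellin \<sigma> (\<lambda>r. \<phi> r - \<phi> (t + r)) \<and> mellin_ok \<sigma> (\<lambda>r. \<phi> r - \<phi> (t + r))" if "0 \<le> t" for t
    using phi_mellin_ok[OF s(1,3)] phi_shift_mellin_ok[OF that s(1,3)]
    unfolding W_def mellin_def mellin_ok_def by (simp add: left_diff_distrib)
  have dpos: "0 \<le> \<phi> r - \<phi> (t + r)" if "0 < r" "0 \<le> t" for r t using phi_decreasing[of r "t + r"] that by simp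
  let ?G = "\<lambda>z r t. ennreal (if 0 < r \<and> 0 < t \<and> r \<le> z \<and> z \<le> r + t then - \<phi>' z * r powr (- 1 + \<sigma>) * t powr (- 1 - \<sigma>) else 0)"
  have step1: "ennreal (if 0 < t then (W 0 - W t) * t powr (- 1 - \<sigma>) else 0) = (\<integral>\<^sup>+r. \<integral>\<^sup>+z. ?G z r t \<partial>lborel \<partial>lborel)" for t
  proof (cases "0 < t")
    case True
    have "ennreal (W 0 - W t) = (\<integral>\<^sup>+r. ennreal (if 0 < r then (\<phi> r - \<phi> (t + r)) * r powr (- 1 + \<sigma>) else 0) \<partial>lborel)"
      using diff[of t] True dpos unfolding mellin_def mellin_ok_def
      by (subst nn_from_set_integral) auto
    moreover have "0 \<le> W 0 - W t" using diff[of t] True dpos by (auto intro!: mellin_nonneg)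
    ultimately have "ennreal (if 0 < t then (W 0 - W t) * t powr (- 1 - \<sigma>) else 0)
       = ennreal (t powr (- 1 - \<sigma>)) * (\<integral>\<^sup>+r. ennreal (if 0 < r then (\<phi> r - \<phi> (t + r)) * r powr (- 1 + \<sigma>) else 0) \<partial>lborel)"
      using True by (simp add: ennreal_mult mult.commute)
    also have "\<dots> = (\<integral>\<^sup>+r. ennreal (t powr (- 1 - \<sigma>)) * ennreal (if 0 < r then (\<phi> r - \<phi> (t + r)) * r powr (- 1 + \<sigma>) else 0) \<partial>lborel)"
      by (rule nn_integral_cmult[symmetric]) measurable
    also have "\<dots> = (\<integral>\<^sup>+r. \<integral>\<^sup>+z. ?G z r t \<partial>lborel \<partial>lborel)"
    proof (rule nn_integral_cong)
      fix r :: real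
      show "ennreal (t powr (- 1 - \<sigma>)) * ennreal (if 0 < r then (\<phi> r - \<phi> (t + r)) * r powr (- 1 + \<sigma>) else 0) = (\<integral>\<^sup>+z. ?G z r t \<partial>lborel)"
      proof (cases "0 < r")
        case r: True
        have "(\<integral>\<^sup>+z. ?G z r t \<partial>lborel) = (\<integral>\<^sup>+z. ennreal (r powr (- 1 + \<sigma>) * t powr (- 1 - \<sigma>)) * ennreal (if r \<le> z \<and> z \<le> r + t then - \<phi>' z else 0) \<partial>lborel)"
          using True r dec by (intro nn_integral_cong) (auto simp: ennreal_mult[symmetric] mult_ac)
        also have "\<dots> = ennreal (r powr (- 1 + \<sigma>) * t powr (- 1 - \<sigma>)) * ennreal (\<phi> r - \<phi> (r + t))"
          using True r by (subst nn_integral_cmult) (auto simp: phi_diff_nn)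
        finally show ?thesis using True r dpos[of r t] by (simp add: ennreal_mult[symmetric] mult_ac add.commute)
      qed simp
    qed
    finally show ?thesis .
  next
    case False
    then have "?G z r t = 0" for z r by auto
    then show ?thesis using False by simp
  qed
  have "(\<integral>\<^sup>+t. ennreal (if 0 < t then (W 0 - W t) * t powr (- 1 - \<sigma>) else 0) \<partial>lborel)
     = (\<integral>\<^sup>+t. \<integral>\<^sup>+r. \<integral>\<^sup>+z. ?G z r t \<partial>lborel \<partial>lborel \<partial>lborel)"
    by (intro nn_integral_cong step1)
  also have "\<dots> = (\<integral>\<^sup>+t. \<integral>\<^sup>+z. \<integral>\<^sup>+r. ?G z r t \<partial>lborel \<partial>lborel \<partial>lborel)"
    by (intro nn_integral_cong lborel_pair.Fubini'[symmetric]) measurable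
  also have "\<dots> = (\<integral>\<^sup>+z. \<integral>\<^sup>+t. \<integral>\<^sup>+r. ?G z r t \<partial>lborel \<partial>lborel \<partial>lborel)"
    by (rule lborel_pair.Fubini'[symmetric]) measurable
  also have "\<dots> = (\<integral>\<^sup>+z. \<integral>\<^sup>+r. \<integral>\<^sup>+t. ?G z r t \<partial>lborel \<partial>lborel \<partial>lborel)"
    by (intro nn_integral_cong lborel_pair.Fubini'[symmetric]) measurable
  also have "\<dots> = (\<integral>\<^sup>+z. ennreal (Gamma \<sigma> * Gamma (1 - \<sigma>) / \<sigma>) * ennreal (if 0 \<le> z then - \<phi>' z else 0) \<partial>lborel)"
  proof (rule nn_integral_cong_AE)
    have "(\<integral>\<^sup>+r. \<integral>\<^sup>+t. ?G z r t \<partial>lborel \<partial>lborel) = ennreal (Gamma \<sigma> * Gamma (1 - \<sigma>) / \<sigma>) * ennreal (if 0 \<le> z then - \<phi>' z else 0)"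
      if z: "z \<noteq> 0" for z
    proof (cases "0 < z")
      case True
      have "(\<integral>\<^sup>+r. \<integral>\<^sup>+t. ?G z r t \<partial>lborel \<partial>lborel)
        = (\<integral>\<^sup>+r. ennreal (- \<phi>' z / \<sigma>) * ennreal (if 0 < r \<and> r < z then r powr (- 1 + \<sigma>) * (z - r) powr (- \<sigma>) else 0) \<partial>lborel)"
      proof (rule nn_integral_cong_AE)
        have "(\<integral>\<^sup>+t. ?G z r t \<partial>lborel) = ennreal (- \<phi>' z / \<sigma>) * ennreal (if 0 < r \<and> r < z then r powr (- 1 + \<sigma>) * (z - r) powr (- \<sigma>) else 0)"
          if rz: "r \<noteq> z" for r
        proof (cases "0 < r \<and> r < z")
          case r: True
          have "(\<integral>\<^sup>+t. ?G z r t \<partial>lborel) = (\<integral>\<^sup>+t. ennreal (- \<phi>' z * r powr (- 1 + \<sigma>)) * ennreal (if z - r < t then t powr (- 1 - \<sigma>) else 0) \<partial>lborel)"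
          proof (rule nn_integral_cong_AE)
            show "AE t in lborel. ?G z r t = ennreal (- \<phi>' z * r powr (- 1 + \<sigma>)) * ennreal (if z - r < t then t powr (- 1 - \<sigma>) else 0)"
              using AE_lborel_singleton[of "z - r"]
            proof eventually_elim
              case (elim t)
              have "0 \<le> - \<phi>' z * r powr (- 1 + \<sigma>)" using dec[of z] True by (simp add: mult_nonpos_nonneg)
              moreover have "(0 < r \<and> 0 < t \<and> r \<le> z \<and> z \<le> r + t) = (z - r < t)" using r elim by auto
              ultimately show ?case by (simp add: ennreal_mult[symmetric])
            qed
          qed
          also have "\<dots> = ennreal (- \<phi>' z * r powr (- 1 + \<sigma>)) * ennreal ((z - r) powr (- \<sigma>) / \<sigma>)"
            using r s by (subst nn_integral_cmult) (auto simp: nn_powr_to_inf)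
          also have "\<dots> = ennreal (- \<phi>' z / \<sigma>) * ennreal (r powr (- 1 + \<sigma>) * (z - r) powr (- \<sigma>))"
            using dec[of z] True s by (simp add: ennreal_mult[symmetric] mult_nonpos_nonneg divide_nonpos_pos mult_ac)
          finally show ?thesis using r by simp
        next
          case False
          then have "?G z r t = 0" for t using rz by auto
          then have g0: "(\<integral>\<^sup>+t. ?G z r t \<partial>lborel) = 0" by simp
          have i0: "(if 0 < r \<and> r < z then r powr (- 1 + \<sigma>) * (z - r) powr (- \<sigma>) else 0) = 0"
            using False by (rule if_not_P)
          show ?thesis unfolding g0 i0 by simp
        qed
        note inner = this
        show "AE r in lborel. (\<integral>\<^sup>+t. ?G z r t \<partial>lborel) = ennreal (- \<phi>' z / \<sigma>) * ennreal (if 0 < r \<and> r < z then r powr (- 1 + \<sigma>) * (z - r) powr (- \<sigma>) else 0)"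
          using AE_lborel_singleton[of z] by eventually_elim (rule inner)
      qed
      also have "\<dots> = ennreal (- \<phi>' z / \<sigma>) * ennreal (Gamma \<sigma> * Gamma (1 - \<sigma>))"
        using True s by (subst nn_integral_cmult) (auto simp: nn_beta)
      also have "\<dots> = ennreal (Gamma \<sigma> * Gamma (1 - \<sigma>) / \<sigma>) * ennreal (- \<phi>' z)"
        using dec[of z] True s Gamma_real_pos[of \<sigma>] Gamma_real_pos[of "1 - \<sigma>"]
        by (simp add: ennreal_mult[symmetric] divide_nonpos_pos mult_ac)
      finally show ?thesis using True by simp
    next
      case False
      then have "?G z r t = 0" for r t by auto
      then show ?thesis using False z by simp
    qed
    note outer = this
    show "AE z in lborel. (\<integral>\<^sup>+r. \<integral>\<^sup>+t. ?G z r t \<partial>lborel \<partial>lborel) = ennreal (Gamma \<sigma> * Gamma (1 - \<sigma>) / \<sigma>) * ennreal (if 0 \<le> z then - \<phi>' z else 0)"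
      using AE_lborel_singleton[of "0::real"] by eventually_elim (rule outer)
  qed
  also have "\<dots> = ennreal (Gamma \<sigma> * Gamma (1 - \<sigma>) / \<sigma>) * ennreal (\<phi> 0)"
    by (subst nn_integral_cmult) (auto simp: phi_eq_nn)
  also have "\<dots> = ennreal (Gamma \<sigma> * Gamma (1 - \<sigma>) / \<sigma> * \<phi> 0)"
    using s nn[of 0] Gamma_real_pos[of \<sigma>] Gamma_real_pos[of "1 - \<sigma>"] by (intro ennreal_mult[symmetric]) auto
  finally have e: "(\<integral>\<^sup>+t. ennreal (if 0 < t then (W 0 - W t) * t powr (- 1 - \<sigma>) else 0) \<partial>lborel)
     = ennreal (Gamma \<sigma> * Gamma (1 - \<sigma>) / \<sigma> * \<phi> 0)" .
  have pos: "0 \<le> (W 0 - W t) * t powr (- 1 - \<sigma>)" if "0 < t" for t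
    using diff[of t] that dpos by (auto intro!: mult_nonneg_nonneg mellin_nonneg)
  have c0: "0 \<le> Gamma \<sigma> * Gamma (1 - \<sigma>) / \<sigma> * \<phi> 0"
    using s nn[of 0] Gamma_real_pos[of \<sigma>] Gamma_real_pos[of "1 - \<sigma>"] by auto
  have [measurable]: "W \<in> borel_measurable borel"
    unfolding W_def mellin_def set_lebesgue_integral_def by measurable
  have meas: "(\<lambda>t. (W 0 - W t) * t powr (- 1 - \<sigma>)) \<in> borel_measurable borel" by measurable
  show "set_integrable lborel {0<..} (\<lambda>t. (W 0 - W t) * t powr (- 1 - \<sigma>))"
    "(LINT t:{0<..}|lborel. (W 0 - W t) * t powr (- 1 - \<sigma>)) = Gamma \<sigma> * Gamma (1 - \<sigma>) / \<sigma> * \<phi> 0"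
    using set_integral_from_nn[OF meas pos c0 e] by auto
qed

end

lemma mellin_lin:
  assumes "mellin_ok s f" "mellin_ok s g"
  shows "mellin_ok s (\<lambda>t. c * f t + d * g t)" "mellin s (\<lambda>t. c * f t + d * g t) = c * mellin s f + d * mellin s g"
proof -
  have e: "(\<lambda>t. (c * f t + d * g t) * t powr (- 1 + s)) = (\<lambda>t. c * (f t * t powr (- 1 + s)) + d * (g t * t powr (- 1 + s)))"
    by (simp add: algebra_simps)
  have i: "set_integrable lborel {0<..} (\<lambda>t. c * (f t * t powr (- 1 + s)))"
    "set_integrable lborel {0<..} (\<lambda>t. d * (g t * t powr (- 1 + s)))"
    using assms by (simp_all add: mellin_ok_def)
  show "mellin_ok s (\<lambda>t. c * f t + d * g t)"
    unfolding mellin_ok_def e by (rule set_integral_add(1)[OF i])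
  show "mellin s (\<lambda>t. c * f t + d * g t) = c * mellin s f + d * mellin s g"
    unfolding mellin_def e set_integral_add(2)[OF i] by simp
qed

lemma mellin_uminus: "mellin s (\<lambda>t. - f t) = - mellin s f"
  unfolding mellin_def set_lebesgue_integral_def by simp

lemma nn_count_space_infsum:
  fixes h :: "'b \<Rightarrow> real"
  assumes nn: "\<And>y. 0 \<le> h y" and c: "0 \<le> c" and e: "(\<integral>\<^sup>+y. ennreal (h y) \<partial>count_space UNIV) = ennreal c"
  shows "h summable_on UNIV" "infsum h UNIV = c"
proof -
  have "has_bochner_integral (count_space UNIV) h c"
    using nn by (intro has_bochner_integral_nn_integral[OF _ _ c e]) auto
  then have i: "integrable (count_space UNIV) h" "integral\<^sup>L (count_space UNIV) h = c"
    by (auto simp: has_bochner_integral_iff)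
  then have a: "Infinite_Set_Sum.abs_summable_on h UNIV" by (simp add: Infinite_Set_Sum.abs_summable_on_def)
  then show "h summable_on UNIV" using abs_summable_equivalent abs_summable_summable by blast
  show "infsum h UNIV = c" using infsetsum_infsum[OF a] i by (simp add: infsetsum_def)
qed

lemma nn_count_space_real:
  fixes h :: "'b \<Rightarrow> real"
  assumes nn: "\<And>y. 0 \<le> h y" and s: "h summable_on UNIV"
  shows "(\<integral>\<^sup>+y. ennreal (h y) \<partial>count_space UNIV) = ennreal (infsum h UNIV)"
proof -
  have "(\<lambda>y. norm (h y)) summable_on UNIV" using nn s by simp
  then have a: "Infinite_Set_Sum.abs_summable_on h UNIV" using abs_summable_equivalent[of h UNIV] by simp
  then have "integrable (count_space UNIV) h" by (simp add: Infinite_Set_Sum.abs_summable_on_def)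
  then have "(\<integral>\<^sup>+y. ennreal (h y) \<partial>count_space UNIV) = ennreal (integral\<^sup>L (count_space UNIV) h)"
    using nn by (intro nn_integral_eq_integral) auto
  then show ?thesis using infsetsum_infsum[OF a] by (simp add: infsetsum_def)
qed

section \<open>Inverting the fractional Laplacian\<close>

context green_cayley
begin

lemma beta_pos: "0 < \<beta>" using alpha_half_pos alpha_lt by linarith

text \<open>For \<open>0 < \<sigma> < \<beta>\<close> this is \<open>(-\<Delta>)\<^bsup>-\<sigma>\<^esup>u\<close>; for \<open>\<sigma> = \<alpha>/2\<close> it is the Green potential of \<open>u\<close>.\<close>

definition pot :: "real \<Rightarrow> ('a \<Rightarrow> real) \<Rightarrow> 'a \<Rightarrow> real" where
  "pot \<sigma> u x = mellin \<sigma> (\<lambda>t. heat S t u x) / Gamma \<sigma>"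

text \<open>Everything that the interchange of \<open>\<Delta>\<close>, of \<open>e\<^bsup>t\<Delta>\<^esup>\<close> and of the time integral needs to know about \<open>u\<close>. It
passes to \<open>\<Delta>u\<close> at the cost of a factor \<open>2 deg\<close>, because \<open>\<Delta>\<close> commutes with \<open>e\<^bsup>t\<Delta>\<^esup>\<close>.\<close>

definition tame :: "('a \<Rightarrow> real) \<Rightarrow> real \<Rightarrow> bool" where
  "tame u C \<longleftrightarrow> u \<in> l2 \<and> (\<forall>t>0. \<forall>x. \<bar>heat S t u x\<bar> \<le> C * envelope \<beta> t)"

lemma tame_l2: "tame u C \<Longrightarrow> u \<in> l2" by (simp add: tame_def)

lemma heat_abs_le: "u \<in> l2 \<Longrightarrow> 0 \<le> t \<Longrightarrow> \<bar>heat S t u x\<bar> \<le> heat S t (\<lambda>y. \<bar>u y\<bar>) x"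
proof -
  assume u: "u \<in> l2" and t: "0 \<le> t"
  have b: "bdd_fun u" "bdd_fun (\<lambda>y. \<bar>u y\<bar>)" using l2_bdd[OF u] l2_bdd[OF l2_abs[OF u]] by simp_all
  have m: "bdd_fun (\<lambda>y. -1 * \<bar>u y\<bar>)" using l2_bdd[OF l2_cmult[OF l2_abs[OF u], of "-1"]] .
  have "heat S t u x \<le> heat S t (\<lambda>y. \<bar>u y\<bar>) x" by (rule heat_mono[OF b _ t]) simp
  moreover have "heat S t (\<lambda>y. -1 * \<bar>u y\<bar>) x \<le> heat S t u x" by (rule heat_mono[OF m b(1) _ t]) simp
  ultimately show ?thesis using heat_cmult[OF b(2), of t "-1" x] by linarith
qed

lemma lq_abs: "f \<in> lq \<Longrightarrow> (\<lambda>x. \<bar>f x\<bar>) \<in> lq" by (simp add: lq_def)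

lemma tame_if_lq:
  assumes f: "f \<in> l2" "f \<in> lq"
  shows "\<exists>C. tame f C"
proof -
  obtain C where C: "C > 0" "\<And>f g t. f \<in> l2 \<and> f \<in> lq \<and> (\<forall>x. 0 \<le> f x) \<and> g \<in> l2 \<and> g \<in> lq \<and> (\<forall>x. 0 \<le> g x) \<and> 0 < t \<Longrightarrow>
     ip (heat S t f) g \<le> C * (qsum f * qsum g + qsum f + qsum g) * envelope \<beta> t"
    using heat_pairing_decay by blast
  let ?f = "\<lambda>y. \<bar>f y\<bar>"
  have "\<bar>heat S t f x\<bar> \<le> C * (qsum ?f * 1 + qsum ?f + 1) * envelope \<beta> t" if "t > 0" for t x
  proof -
    have "\<bar>heat S t f x\<bar> \<le> ip (heat S t ?f) (single x)" using heat_abs_le[OF f(1)] that by simp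
    also have "\<dots> \<le> C * (qsum ?f * qsum (single x) + qsum ?f + qsum (single x)) * envelope \<beta> t"
      using that f by (intro C(2)) (auto simp: l2_abs lq_abs single_lq, simp add: single_def)
    finally show ?thesis by (simp add: qsum_single)
  qed
  then show ?thesis using f(1) unfolding tame_def by blast
qed

lemma tame_lap:
  assumes "tame u C"
  shows "tame (lap S u) (2 * deg * C)"
  unfolding tame_def
proof (intro conjI allI impI)
  show "lap S u \<in> l2" using assms by (simp add: tame_def lap_l2)
  fix t :: real and x assume t: "0 < t"
  have "\<bar>(lap S ^^ 1) (heat S t u) x\<bar> \<le> (C * envelope \<beta> t) * (2 * deg) ^ 1"
    by (rule lap_pow_bound) (use assms t in \<open>simp add: tame_def\<close>)
  then show "\<bar>heat S t (lap S u) x\<bar> \<le> 2 * deg * C * envelope \<beta> t"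
    using lap_heat[OF l2_bdd[OF tame_l2[OF assms]], of t] by (simp add: mult_ac)
qed

lemma tame_lap_pow: "tame u C \<Longrightarrow> tame ((lap S ^^ n) u) ((2 * deg) ^ n * C)"
proof (induction n)
  case (Suc n)
  then show ?case using tame_lap[of "(lap S ^^ n) u" "(2 * deg) ^ n * C"] by (simp add: mult.assoc)
qed simp

lemma heat_time_measurable [measurable]:
  assumes "u \<in> l2"
  shows "(\<lambda>t. heat S t u x) \<in> borel_measurable borel"
  by (intro borel_measurable_continuous_onI DERIV_continuous_on)
     (auto intro: has_field_derivative_at_within heat_deriv l2_bdd assms)

lemma tame_mellin:
  assumes "tame u C" "0 < \<sigma>" "\<sigma> < \<beta>"
  shows "mellin_ok \<sigma> (\<lambda>t. heat S t u x)" "\<bar>mellin \<sigma> (\<lambda>t. heat S t u x)\<bar> \<le> C * mellin \<sigma> (envelope \<beta>)"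
    "mellin \<sigma> (\<lambda>t. \<bar>heat S t u x\<bar>) \<le> C * mellin \<sigma> (envelope \<beta>)"
proof -
  have b: "\<bar>heat S t u x\<bar> \<le> C * envelope \<beta> t" if "t > 0" for t using assms(1) that by (simp add: tame_def)
  have m: "(\<lambda>t. heat S t u x) \<in> borel_measurable borel" by (rule heat_time_measurable[OF tame_l2[OF assms(1)]])
  show "mellin_ok \<sigma> (\<lambda>t. heat S t u x)" "\<bar>mellin \<sigma> (\<lambda>t. heat S t u x)\<bar> \<le> C * mellin \<sigma> (envelope \<beta>)"
    using mellin_ok_bound[OF m assms(2,3) b] by auto
  have m': "(\<lambda>t. \<bar>heat S t u x\<bar>) \<in> borel_measurable borel" using m by measurable
  have "\<bar>mellin \<sigma> (\<lambda>t. \<bar>heat S t u x\<bar>)\<bar> \<le> C * mellin \<sigma> (envelope \<beta>)"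
    by (rule mellin_ok_bound(2)[OF m' assms(2,3)]) (simp add: b)
  then show "mellin \<sigma> (\<lambda>t. \<bar>heat S t u x\<bar>) \<le> C * mellin \<sigma> (envelope \<beta>)" by linarith
qed

lemma lap_pot:
  assumes "tame u C" "0 < \<sigma>" "\<sigma> < \<beta>"
  shows "lap S (pot \<sigma> u) = pot \<sigma> (lap S u)"
proof
  fix x
  note ok = tame_mellin(1)[OF assms]
  have ms: "mellin_ok \<sigma> (\<lambda>t. \<Sum>s\<in>S. 1 * heat S t u (x + s))"
    by (rule mellin_sum(1)[OF finite_S]) (rule ok)
  have mv: "mellin \<sigma> (\<lambda>t. \<Sum>s\<in>S. 1 * heat S t u (x + s)) = (\<Sum>s\<in>S. 1 * mellin \<sigma> (\<lambda>t. heat S t u (x + s)))"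
    by (rule mellin_sum(2)[OF finite_S]) (rule ok)
  have "(\<lambda>t. heat S t (lap S u) x) = (\<lambda>t. 1 * (\<Sum>s\<in>S. 1 * heat S t u (x + s)) + (- deg) * heat S t u x)"
    unfolding lap_heat[OF l2_bdd[OF tame_l2[OF assms(1)]], symmetric] by (simp add: lap_eq' deg_def)
  then have "mellin \<sigma> (\<lambda>t. heat S t (lap S u) x)
     = (\<Sum>s\<in>S. mellin \<sigma> (\<lambda>t. heat S t u (x + s))) - deg * mellin \<sigma> (\<lambda>t. heat S t u x)"
    using mellin_lin(2)[OF ms ok[of x], of 1 "- deg"] mv by simp
  then show "lap S (pot \<sigma> u) x = pot \<sigma> (lap S u) x"
    by (simp add: pot_def lap_eq' deg_def diff_divide_distrib sum_divide_distrib)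
qed

lemma lap_pow_pot:
  assumes "tame u C" "0 < \<sigma>" "\<sigma> < \<beta>"
  shows "(lap S ^^ n) (pot \<sigma> u) = pot \<sigma> ((lap S ^^ n) u)"
  by (induction n) (simp_all add: lap_pot[OF tame_lap_pow[OF assms(1)] assms(2,3)])

text \<open>The exponential series of \<open>e\<^bsup>t\<Delta>\<^esup>\<close> and the time integral commute by dominated convergence, as the tame bounds of
\<open>\<Delta>\<^sup>n u\<close> grow geometrically in \<open>n\<close>.\<close>

lemma heat_pot:
  assumes u: "tame u C" and s: "0 < \<sigma>" "\<sigma> < \<beta>"
  shows "heat S t (pot \<sigma> u) x = mellin \<sigma> (\<lambda>r. heat S (t + r) u x) / Gamma \<sigma>"
proof -
  let ?h = "\<lambda>n r. t ^ n / fact n * heat S r ((lap S ^^ n) u) x"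
  let ?f = "\<lambda>n r. indicator {0<..} r *\<^sub>R (?h n r * r powr (- 1 + \<sigma>))"
  define L where "L = mellin \<sigma> (envelope \<beta>)"
  have ok: "mellin_ok \<sigma> (?h n)" and val: "mellin \<sigma> (?h n) = t ^ n / fact n * mellin \<sigma> (\<lambda>r. heat S r ((lap S ^^ n) u) x)" for n
    using mellin_lin[OF tame_mellin(1)[OF tame_lap_pow[OF u] s] tame_mellin(1)[OF tame_lap_pow[OF u] s], of "t ^ n / fact n" n x 0 n x]
    by simp_all
  have i: "integrable lborel (?f n)" for n using ok[of n] by (simp add: mellin_ok_def set_integrable_def)
  have nrm: "(\<integral>r. norm (?f n r) \<partial>lborel) \<le> C * L * ((\<bar>t\<bar> * (2 * deg)) ^ n / fact n)" for n
  proof -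
    have "(\<integral>r. norm (?f n r) \<partial>lborel) = (LINT r:{0<..}|lborel. \<bar>t\<bar> ^ n / fact n * (\<bar>heat S r ((lap S ^^ n) u) x\<bar> * r powr (- 1 + \<sigma>)))"
      unfolding set_lebesgue_integral_def
      by (intro Bochner_Integration.integral_cong) (auto simp: abs_mult power_abs)
    also have "\<dots> = \<bar>t\<bar> ^ n / fact n * mellin \<sigma> (\<lambda>r. \<bar>heat S r ((lap S ^^ n) u) x\<bar>)"
      unfolding mellin_def by (rule set_integral_mult_right)
    also have "\<dots> \<le> \<bar>t\<bar> ^ n / fact n * ((2 * deg) ^ n * C * L)"
      unfolding L_def by (intro mult_left_mono tame_mellin(3) tame_lap_pow u s) auto
    finally show ?thesis by (simp add: power_mult_distrib mult_ac)
  qed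
  have sumnrm: "summable (\<lambda>n. \<integral>r. norm (?f n r) \<partial>lborel)"
    by (rule summable_comparison_test'[OF sums_summable[OF egf_majorant_sums[of "C * L" "\<bar>t\<bar>" "2 * deg"]], of 0])
       (use nrm in auto)
  have geom: "\<exists>M. geom_bounded (\<lambda>n. heat S r ((lap S ^^ n) u) x) M (2 * deg)" for r
    using lap_pow_geom'[OF bdd_heat[OF l2_bdd[OF tame_l2[OF u]]], of r]
    unfolding lap_pow_heat[OF l2_bdd[OF tame_l2[OF u]]] by blast
  have ae: "AE r in lborel. summable (\<lambda>n. norm (?f n r))"
  proof (rule AE_I2)
    fix r
    obtain M where M: "geom_bounded (\<lambda>n. heat S r ((lap S ^^ n) u) x) M (2 * deg)" using geom by blast
    have "summable (\<lambda>n. \<bar>?h n r\<bar> * (indicator {0<..} r * r powr (- 1 + \<sigma>)))"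
      by (rule summable_mult2[OF egf_abs_summable[OF M]])
    moreover have "norm (?f n r) = \<bar>?h n r\<bar> * (indicator {0<..} r * r powr (- 1 + \<sigma>))" for n
      by (simp add: abs_mult indicator_def)
    ultimately show "summable (\<lambda>n. norm (?f n r))" by simp
  qed
  have "heat S t (pot \<sigma> u) x = (\<Sum>n. t ^ n / fact n * (mellin \<sigma> (\<lambda>r. heat S r ((lap S ^^ n) u) x) / Gamma \<sigma>))"
    by (simp add: heat_def lap_pow_pot[OF u s] pot_def)
  also have "\<dots> = (\<Sum>n. mellin \<sigma> (?h n) / Gamma \<sigma>)" unfolding val by simp
  also have "\<dots> = (\<Sum>n. mellin \<sigma> (?h n)) / Gamma \<sigma>"
  proof (rule suminf_divide)
    have "summable (\<lambda>n. integral\<^sup>L lborel (?f n))"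
      by (rule summable_comparison_test'[OF sumnrm, of 0]) (rule integral_norm_bound)
    then show "summable (\<lambda>n. mellin \<sigma> (?h n))" by (simp add: mellin_def set_lebesgue_integral_def)
  qed
  also have "(\<Sum>n. mellin \<sigma> (?h n)) = (\<Sum>n. integral\<^sup>L lborel (?f n))" by (simp add: mellin_def set_lebesgue_integral_def)
  also have "\<dots> = (\<integral>r. (\<Sum>n. ?f n r) \<partial>lborel)" by (rule integral_suminf[OF i ae sumnrm, symmetric])
  also have "\<dots> = mellin \<sigma> (\<lambda>r. heat S (t + r) u x)"
    unfolding mellin_def set_lebesgue_integral_def
  proof (intro Bochner_Integration.integral_cong refl)
    fix r
    obtain M where M: "geom_bounded (\<lambda>n. heat S r ((lap S ^^ n) u) x) M (2 * deg)" using geom by blast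
    have "heat S (t + r) u x = (\<Sum>n. ?h n r)"
      unfolding heat_semigroup[OF l2_bdd[OF tame_l2[OF u]], symmetric]
      unfolding heat_def[of S t] lap_pow_heat[OF l2_bdd[OF tame_l2[OF u]]] ..
    then have "indicator {0<..} r *\<^sub>R (heat S (t + r) u x * r powr (- 1 + \<sigma>)) = (\<Sum>n. ?h n r) * (indicator {0<..} r * r powr (- 1 + \<sigma>))"
      by simp
    also have "\<dots> = (\<Sum>n. ?h n r * (indicator {0<..} r * r powr (- 1 + \<sigma>)))"
      by (rule suminf_mult2[OF egf_summable[OF M]])
    also have "\<dots> = (\<Sum>n. ?f n r)" by (simp add: mult.left_commute mult.assoc)
    finally show "(\<Sum>n. ?f n r) = indicator {0<..} r *\<^sub>R (heat S (t + r) u x * r powr (- 1 + \<sigma>))" by simp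
  qed
  finally show ?thesis .
qed

abbreviation pert :: "('a \<Rightarrow> real) \<Rightarrow> 'a \<Rightarrow> real \<Rightarrow> 'a \<Rightarrow> real" where
  "pert f x c \<equiv> (\<lambda>y. f y + c * single x y)"

abbreviation quad :: "('a \<Rightarrow> real) \<Rightarrow> real \<Rightarrow> real" where
  "quad g t \<equiv> ip (heat S t g) g"

abbreviation quad' :: "('a \<Rightarrow> real) \<Rightarrow> real \<Rightarrow> real" where
  "quad' g t \<equiv> ip (heat S t (lap S g)) g"

lemma quad_pert:
  assumes f: "f \<in> l2"
  shows "quad (pert f x c) t = quad f t + 2 * c * heat S t f x + c\<^sup>2 * heat_kernel S t x x"
proof -
  have d: "(\<lambda>y. c * single x y) \<in> l2" by (intro l2_cmult) simp
  have h: "heat S t (pert f x c) = (\<lambda>y. heat S t f y + c * heat S t (single x) y)"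
    by (rule ext) (simp add: heat_add[OF l2_bdd[OF f] l2_bdd[OF d]] heat_cmult)
  have hl: "heat S t f \<in> l2" "heat S t (single x) \<in> l2" "(\<lambda>y. c * heat S t (single x) y) \<in> l2"
    by (intro heat_l2 f l2_cmult l2_single)+
  have s: "ip (heat S t (single x)) f = heat S t f x"
    using ip_heat_sym[of "single x" f t] f by (simp add: ip_sym[of "single x"])
  show ?thesis unfolding h
    using f d hl by (simp add: ip_add ip_add2 l2_add ip_cmult ip_cmult2 s heat_kernel_eq power2_eq_square algebra_simps)
qed

text \<open>Polarisation of the quadratic form of \<open>e\<^bsup>t\<Delta>\<^esup>\<close> with the unit mass at \<open>x\<close>. The function \<open>t \<mapsto> e\<^bsup>t\<Delta>\<^esup>f(x)\<close> need not be monotone,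
but the two forms are.\<close>

lemma heat_polar:
  assumes "f \<in> l2"
  shows "heat S t f x = (1/4) * quad (pert f x 1) t + (- 1/4) * quad (pert f x (- 1)) t"
  unfolding quad_pert[OF assms] by (simp add: add_divide_distrib diff_divide_distrib)

lemma pert_l2: "f \<in> l2 \<Longrightarrow> pert f x c \<in> l2" by (intro l2_add l2_cmult l2_single)

lemma pert_lq: "f \<in> lq \<Longrightarrow> pert f x c \<in> lq"
proof -
  assume "f \<in> lq"
  then have "(\<lambda>y. \<bar>f y\<bar> powr q + \<bar>f x + c\<bar> powr q * single x y) summable_on UNIV"
    unfolding lq_def mem_Collect_eq
    by (intro summable_on_add summable_on_cmult_right) (auto intro!: finite_nonzero_values_imp_summable_on simp: single_def)
  then have "(\<lambda>y. \<bar>pert f x c y\<bar> powr q) summable_on UNIV"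
    by (rule summable_on_comparison_test) (auto simp: single_def)
  then show ?thesis by (simp add: lq_def)
qed

lemma heat_lap_polar:
  assumes "f \<in> l2"
  shows "heat S t (lap S f) x = (1/4) * quad' (pert f x 1) t + (- 1/4) * quad' (pert f x (- 1)) t"
proof (rule DERIV_unique)
  show "((\<lambda>t. heat S t f x) has_real_derivative heat S t (lap S f) x) (at t)"
    by (rule heat_deriv[OF l2_bdd[OF assms]])
  show "((\<lambda>t. heat S t f x) has_real_derivative (1/4) * quad' (pert f x 1) t + (- 1/4) * quad' (pert f x (- 1)) t) (at t)"
    unfolding heat_polar[OF assms] by (intro DERIV_add DERIV_cmult ip_heat_deriv pert_l2 assms)
qed

lemma quad_profile:
  assumes g: "g \<in> l2" "g \<in> lq"
  shows "\<exists>C. decreasing_profile (quad g) (quad' g) \<beta> C"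
proof -
  obtain C where C: "C > 0" "\<And>f g t. f \<in> l2 \<and> f \<in> lq \<and> (\<forall>x. 0 \<le> f x) \<and> g \<in> l2 \<and> g \<in> lq \<and> (\<forall>x. 0 \<le> g x) \<and> 0 < t \<Longrightarrow>
     ip (heat S t f) g \<le> C * (qsum f * qsum g + qsum f + qsum g) * envelope \<beta> t"
    using heat_pairing_decay by blast
  let ?a = "\<lambda>y. \<bar>g y\<bar>"
  have "decreasing_profile (quad g) (quad' g) \<beta> (C * (qsum ?a * qsum ?a + qsum ?a + qsum ?a))"
  proof
    show "(quad g has_real_derivative quad' g t) (at t)" for t by (rule ip_heat_deriv[OF g(1) g(1)])
    show "continuous_on UNIV (quad' g)"
      by (rule DERIV_continuous_on) (rule has_field_derivative_at_within[OF ip_heat_deriv[OF lap_l2[OF g(1)] g(1)]])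
    show "quad' g t \<le> 0" for t by (rule ip_heat_lap_self_nonpos[OF g(1)])
    show "0 \<le> quad g t" for t by (rule ip_heat_self_nonneg[OF g(1)])
    show "0 < \<beta>" by (rule beta_pos)
    fix t :: real assume t: "0 < t"
    have "quad g t \<le> ip (heat S t ?a) ?a"
      unfolding ip_def
    proof (rule infsum_mono)
      show "(\<lambda>x. heat S t g x * g x) summable_on UNIV" by (intro l2_mult_summable heat_l2 g)
      show "(\<lambda>x. heat S t ?a x * ?a x) summable_on UNIV" by (intro l2_mult_summable heat_l2 l2_abs g)
      fix x
      have "heat S t g x * g x \<le> \<bar>heat S t g x\<bar> * \<bar>g x\<bar>" by (metis abs_ge_self abs_mult)
      also have "\<dots> \<le> heat S t ?a x * ?a x" using t by (intro mult_right_mono heat_abs_le g) auto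
      finally show "heat S t g x * g x \<le> heat S t ?a x * ?a x" .
    qed
    also have "\<dots> \<le> C * (qsum ?a * qsum ?a + qsum ?a + qsum ?a) * envelope \<beta> t"
      using t by (intro C(2)) (auto simp: l2_abs lq_abs g)
    finally show "quad g t \<le> C * (qsum ?a * qsum ?a + qsum ?a + qsum ?a) * envelope \<beta> t" .
  qed
  then show ?thesis by blast
qed

lemma heat_difference_of_profiles:
  assumes f: "f \<in> l2" "f \<in> lq"
  obtains P P' C1 M M' C2 where
    "decreasing_profile P P' \<beta> C1" "decreasing_profile M M' \<beta> C2"
    "\<And>t. heat S t f x = (1/4) * P t + (- 1/4) * M t"
    "\<And>t. heat S t (lap S f) x = (1/4) * P' t + (- 1/4) * M' t"
proof -
  obtain C1 C2 where C: "decreasing_profile (quad (pert f x 1)) (quad' (pert f x 1)) \<beta> C1"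
    "decreasing_profile (quad (pert f x (- 1))) (quad' (pert f x (- 1))) \<beta> C2"
    using quad_profile[OF pert_l2[OF f(1), where x = x and c = 1] pert_lq[OF f(2), where x = x and c = 1]]
      quad_profile[OF pert_l2[OF f(1), where x = x and c = "- 1"] pert_lq[OF f(2), where x = x and c = "- 1"]] by blast
  show thesis by (rule that[OF C heat_polar[OF f(1)] heat_lap_polar[OF f(1)]])
qed

text \<open>One application of \<open>-\<Delta>\<close> is minus the time derivative, which lowers the order of the Mellin transform by one; \<open>\<Gamma>(\<sigma>) = (\<sigma> - 1)\<Gamma>(\<sigma> - 1)\<close> matches
the constants.\<close>

lemma pot_step:
  assumes f: "f \<in> l2" "f \<in> lq" and s: "1 < \<sigma>" "\<sigma> < \<beta>"
  shows "(\<lambda>x. - lap S (pot \<sigma> f) x) = pot (\<sigma> - 1) f"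
proof
  fix x
  obtain C where C: "tame f C" using tame_if_lq[OF f] by blast
  obtain P P' C1 M M' C2 where PM: "decreasing_profile P P' \<beta> C1" "decreasing_profile M M' \<beta> C2"
    and h: "\<And>t. heat S t f x = (1/4) * P t + (- 1/4) * M t"
    and h': "\<And>t. heat S t (lap S f) x = (1/4) * P' t + (- 1/4) * M' t"
    by (rule heat_difference_of_profiles[OF f, where x = x]) (rule that, assumption+)
  have s': "0 < \<sigma> - 1" "\<sigma> - 1 < \<beta>" using s by auto
  note m1 = decreasing_profile.mellin_derivative[OF PM(1) s'] and m2 = decreasing_profile.mellin_derivative[OF PM(2) s']
  have "mellin \<sigma> (\<lambda>t. - heat S t (lap S f) x) = mellin \<sigma> (\<lambda>t. (1/4) * (- P' t) + (- 1/4) * (- M' t))"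
    unfolding h' by simp
  also have "\<dots> = (1/4) * ((\<sigma> - 1) * mellin (\<sigma> - 1) P) + (- 1/4) * ((\<sigma> - 1) * mellin (\<sigma> - 1) M)"
    using mellin_lin(2)[of \<sigma> "\<lambda>t. - P' t" "\<lambda>t. - M' t" "1/4" "- 1/4"] m1 m2 by simp
  also have "\<dots> = (\<sigma> - 1) * ((1/4) * mellin (\<sigma> - 1) P + (- 1/4) * mellin (\<sigma> - 1) M)"
    by (simp only: distrib_left mult.left_commute)
  also have "(1/4) * mellin (\<sigma> - 1) P + (- 1/4) * mellin (\<sigma> - 1) M = mellin (\<sigma> - 1) (\<lambda>t. heat S t f x)"
    unfolding h
    by (rule mellin_lin(2)[symmetric])
       (rule decreasing_profile.phi_mellin_ok[OF PM(1) s'], rule decreasing_profile.phi_mellin_ok[OF PM(2) s'])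
  finally have e: "mellin \<sigma> (\<lambda>t. - heat S t (lap S f) x) = (\<sigma> - 1) * mellin (\<sigma> - 1) (\<lambda>t. heat S t f x)" .
  have "\<sigma> - 1 \<notin> \<int>\<^sub>\<le>\<^sub>0" using s' by (auto elim!: nonpos_Ints_cases)
  then have G: "Gamma \<sigma> = (\<sigma> - 1) * Gamma (\<sigma> - 1)" using Gamma_plus1[of "\<sigma> - 1"] by simp
  have "- lap S (pot \<sigma> f) x = - (mellin \<sigma> (\<lambda>t. heat S t (lap S f) x) / Gamma \<sigma>)"
    using lap_pot[OF C _ s(2)] s by (simp add: pot_def)
  also have "\<dots> = mellin \<sigma> (\<lambda>t. - heat S t (lap S f) x) / Gamma \<sigma>"
    by (simp add: mellin_uminus)
  also have "\<dots> = pot (\<sigma> - 1) f x" unfolding e G pot_def using s' by simp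
  finally show "- lap S (pot \<sigma> f) x = pot (\<sigma> - 1) f x" .
qed

lemma pot_last_step:
  assumes f: "f \<in> l2" "f \<in> lq" and s: "1 < \<beta>"
  shows "(\<lambda>x. - lap S (pot 1 f) x) = f"
proof
  fix x
  obtain C where C: "tame f C" using tame_if_lq[OF f] by blast
  obtain P P' C1 M M' C2 where PM: "decreasing_profile P P' \<beta> C1" "decreasing_profile M M' \<beta> C2"
    and h: "\<And>t. heat S t f x = (1/4) * P t + (- 1/4) * M t"
    and h': "\<And>t. heat S t (lap S f) x = (1/4) * P' t + (- 1/4) * M' t"
    by (rule heat_difference_of_profiles[OF f, where x = x]) (rule that, assumption+)
  note m1 = decreasing_profile.mellin_derivative_1[OF PM(1)] and m2 = decreasing_profile.mellin_derivative_1[OF PM(2)]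
  have "mellin 1 (\<lambda>t. - heat S t (lap S f) x) = mellin 1 (\<lambda>t. (1/4) * (- P' t) + (- 1/4) * (- M' t))"
    unfolding h' by simp
  also have "\<dots> = (1/4) * P 0 + (- 1/4) * M 0"
    using mellin_lin(2)[OF m1(1) m2(1), of "1/4" "- 1/4"] m1(2) m2(2) by simp
  also have "\<dots> = f x" using h[of 0] by simp
  finally have e: "mellin 1 (\<lambda>t. - heat S t (lap S f) x) = f x" .
  have "- lap S (pot 1 f) x = - mellin 1 (\<lambda>t. heat S t (lap S f) x)"
    using lap_pot[OF C _ s] by (simp add: pot_def)
  also have "\<dots> = mellin 1 (\<lambda>t. - heat S t (lap S f) x)" by (rule mellin_uminus[symmetric])
  finally show "- lap S (pot 1 f) x = f x" using e by simp
qed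

lemma frac_lap_pot:
  assumes f: "f \<in> l2" "f \<in> lq" and s: "0 < \<sigma>" "\<sigma> < 1" "\<sigma> < \<beta>"
  shows "frac_lap_below_one S \<sigma> (pot \<sigma> f) x = f x"
proof -
  obtain C where C: "tame f C" using tame_if_lq[OF f] by blast
  obtain P P' C1 M M' C2 where PM: "decreasing_profile P P' \<beta> C1" "decreasing_profile M M' \<beta> C2"
    and h: "\<And>t. heat S t f x = (1/4) * P t + (- 1/4) * M t"
    and "\<And>t. heat S t (lap S f) x = (1/4) * P' t + (- 1/4) * M' t"
    by (rule heat_difference_of_profiles[OF f, where x = x]) (rule that, assumption+)
  define W1 where "W1 t = mellin \<sigma> (\<lambda>r. P (t + r))" for t
  define W2 where "W2 t = mellin \<sigma> (\<lambda>r. M (t + r))" for t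
  have G: "Gamma \<sigma> > 0" using s by (simp add: Gamma_real_pos)
  have hp: "heat S t (pot \<sigma> f) x = (1/4 * W1 t - 1/4 * W2 t) / Gamma \<sigma>" if "0 \<le> t" for t
  proof -
    have "mellin \<sigma> (\<lambda>r. heat S (t + r) f x) = (1/4) * W1 t + (- 1/4) * W2 t"
      unfolding h W1_def W2_def
      by (rule mellin_lin(2)) (rule decreasing_profile.phi_shift_mellin_ok[OF PM(1) that s(1,3)],
        rule decreasing_profile.phi_shift_mellin_ok[OF PM(2) that s(1,3)])
    then show ?thesis unfolding heat_pot[OF C s(1,3)] by simp
  qed
  note F1 = decreasing_profile.fractional_inversion[OF PM(1) s, folded W1_def]
  note F2 = decreasing_profile.fractional_inversion[OF PM(2) s, folded W2_def]
  let ?c = "1 / (4 * Gamma \<sigma>)"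
  have "(LINT t:{0<..}|lborel. (heat S t (pot \<sigma> f) x - pot \<sigma> f x) * t powr (- 1 - \<sigma>))
     = (LINT t:{0<..}|lborel. ?c * ((W2 0 - W2 t) * t powr (- 1 - \<sigma>)) - ?c * ((W1 0 - W1 t) * t powr (- 1 - \<sigma>)))"
  proof (rule set_lebesgue_integral_cong, simp, intro allI impI)
    fix t :: real assume "t \<in> {0<..}"
    then have t: "0 \<le> t" by simp
    have lin: "(1/4 * w1 - 1/4 * w2) / Gamma \<sigma> = ?c * w1 - ?c * w2" for w1 w2
      by (simp add: diff_divide_distrib)
    have "heat S t (pot \<sigma> f) x - heat S 0 (pot \<sigma> f) x = ?c * (W2 0 - W2 t) - ?c * (W1 0 - W1 t)"
      unfolding hp[OF t] hp[OF order_refl] lin right_diff_distrib by linarith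
    then have "heat S t (pot \<sigma> f) x - pot \<sigma> f x = ?c * (W2 0 - W2 t) - ?c * (W1 0 - W1 t)" by simp
    then show "(heat S t (pot \<sigma> f) x - pot \<sigma> f x) * t powr (- 1 - \<sigma>)
       = ?c * ((W2 0 - W2 t) * t powr (- 1 - \<sigma>)) - ?c * ((W1 0 - W1 t) * t powr (- 1 - \<sigma>))"
      by (simp add: left_diff_distrib mult.assoc)
  qed
  also have "\<dots> = ?c * (Gamma \<sigma> * Gamma (1 - \<sigma>) / \<sigma> * M 0) - ?c * (Gamma \<sigma> * Gamma (1 - \<sigma>) / \<sigma> * P 0)"
    using F1 F2 by (subst set_integral_diff(2)) auto
  also have "\<dots> = - (Gamma (1 - \<sigma>) / \<sigma>) * ((1/4) * P 0 + (- 1/4) * M 0)"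
  proof -
    have cG: "?c * (Gamma \<sigma> * g / \<sigma> * m) = g / \<sigma> * (1/4 * m)" for g m using G by simp
    have "k * (1/4 * m) - k * (1/4 * n) = - k * ((1/4) * n + (- 1/4) * m)" for k m n :: real
      by (simp add: algebra_simps)
    then show ?thesis unfolding cG .
  qed
  also have "(1/4) * P 0 + (- 1/4) * M 0 = f x" using h[of 0] by simp
  finally have I: "(LINT t:{0<..}|lborel. (heat S t (pot \<sigma> f) x - pot \<sigma> f x) * t powr (- 1 - \<sigma>))
      = - (Gamma (1 - \<sigma>) / \<sigma>) * f x" .
  have ni: "- \<sigma> \<notin> \<int>\<^sub>\<le>\<^sub>0"
  proof
    assume "- \<sigma> \<in> \<int>\<^sub>\<le>\<^sub>0"
    then obtain n where "- \<sigma> = of_int n" by (auto elim!: nonpos_Ints_cases)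
    then have "-1 < real_of_int n" "real_of_int n < 0" using s by linarith+
    then have "-1 < n" "n < 0" using of_int_less_iff[of "-1" n, where 'a = real] by simp_all
    then show False by simp
  qed
  have "Gamma (1 - \<sigma>) = - \<sigma> * Gamma (- \<sigma>)" using Gamma_plus1[OF ni] by (simp add: add.commute)
  moreover have "Gamma (- \<sigma>) \<noteq> 0" using ni by (simp add: Gamma_eq_zero_iff)
  ultimately show ?thesis unfolding frac_lap_below_one_def I using s by simp
qed

text \<open>The integer part of \<open>\<alpha>/2\<close> is removed by steps of size one, ending either at order \<open>1\<close>, where a last step returns \<open>f\<close>, or at the
fractional part, where the semigroup formula does.\<close>

proposition frac_lap_inverts_pot:
  assumes f: "f \<in> l2" "f \<in> lq"
  shows "frac_lap S \<alpha> (pot (\<alpha>/2) f) x = f x"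
proof -
  define s where "s = \<alpha> / 2"
  have s: "0 < s" "s < \<beta>" using alpha_half_pos alpha_lt by (simp_all add: s_def)
  let ?T = "\<lambda>(f :: 'a \<Rightarrow> real) x. - lap S f x"
  have iter: "(?T ^^ k) (pot s f) = pot (s - real k) f" if "real k < s" for k
    using that
  proof (induction k)
    case (Suc k)
    have "(?T ^^ Suc k) (pot s f) = ?T (pot (s - real k) f)" using Suc by simp
    also have "\<dots> = pot (s - real k - 1) f" using Suc.prems s by (intro pot_step f) auto
    finally show ?case by (simp add: algebra_simps)
  qed simp
  define n where "n = nat \<lfloor>s\<rfloor>"
  have n: "real n = of_int \<lfloor>s\<rfloor>" using s by (simp add: n_def)
  show ?thesis
  proof (cases "frac s = 0")
    case True
    then have sn: "s = real n" using n by (simp add: frac_def)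
    then obtain k where k: "n = Suc k" using s by (cases n) auto
    have "(?T ^^ n) (pot s f) = ?T (pot (s - real k) f)" using iter[of k] sn k by simp
    also have "s - real k = 1" using sn k by simp
    also have "?T (pot 1 f) = f" using s sn k by (intro pot_last_step f) auto
    finally show ?thesis using True unfolding frac_lap_def s_def[symmetric] n_def[symmetric] by (simp add: Let_def)
  next
    case False
    then have fr: "0 < frac s" "frac s < 1" using frac_ge_0[of s] frac_lt_1[of s] by auto
    have fs: "frac s = s - real n" using n by (simp add: frac_def)
    have "(?T ^^ n) (pot s f) = pot (frac s) f" unfolding fs by (rule iter) (use fs fr in linarith)
    moreover have "frac_lap_below_one S (frac s) (pot (frac s) f) x = f x"
      by (rule frac_lap_pot[OF f fr]) (use fs s in linarith)
    ultimately show ?thesis using False unfolding frac_lap_def s_def[symmetric] n_def[symmetric] by (simp add: Let_def)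
  qed
qed

text \<open>Tonelli's theorem for the sum over the countable group and the time integral; it yields the summability of the potential as well.\<close>

lemma green_potential:
  assumes f: "f \<in> l2" "f \<in> lq" "\<And>x. 0 \<le> f x"
  shows "(\<lambda>y. R x y * f y) summable_on UNIV" "(\<Sum>\<^sub>\<infinity>y. R x y * f y) = pot (\<alpha>/2) f x"
proof -
  obtain C where C: "tame f C" using tame_if_lq[OF f(1,2)] by blast
  let ?s = "\<alpha>/2"
  have hpos: "0 \<le> heat S t f x" if "0 < t" for t using that f by (intro heat_nonneg l2_bdd) auto
  have kf: "(\<lambda>y. heat_kernel S t x y * f y) summable_on UNIV" for t by (intro l2_mult_summable heat_kernel_l2 f)
  have P0: "0 \<le> pot ?s f x" unfolding pot_def using Gamma_half_pos hpos by (intro divide_nonneg_pos mellin_nonneg) auto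
  have cnt: "countable (UNIV :: 'a set)" by (rule countable_vertices)
  have "ennreal (mellin ?s (\<lambda>t. heat S t f x)) = (\<integral>\<^sup>+t. ennreal (if 0 < t then heat S t f x * t powr (- 1 + ?s) else 0) \<partial>lborel)"
    unfolding mellin_def using tame_mellin(1)[OF C alpha_half_pos alpha_lt] hpos
    by (intro nn_from_set_integral[symmetric]) (auto simp: mellin_ok_def)
  also have "\<dots> = (\<integral>\<^sup>+t. \<integral>\<^sup>+y. ennreal (if 0 < t then heat_kernel S t x y * f y * t powr (- 1 + ?s) else 0) \<partial>count_space UNIV \<partial>lborel)"
  proof (rule nn_integral_cong)
    fix t :: real
    show "ennreal (if 0 < t then heat S t f x * t powr (- 1 + ?s) else 0)
      = (\<integral>\<^sup>+y. ennreal (if 0 < t then heat_kernel S t x y * f y * t powr (- 1 + ?s) else 0) \<partial>count_space UNIV)"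
    proof (cases "0 < t")
      case True
      have "(\<integral>\<^sup>+y. ennreal (heat_kernel S t x y * f y * t powr (- 1 + ?s)) \<partial>count_space UNIV)
         = ennreal (\<Sum>\<^sub>\<infinity>y. heat_kernel S t x y * f y * t powr (- 1 + ?s))"
        using True f by (intro nn_count_space_real summable_on_cmult_left kf) (auto simp: heat_kernel_nonneg)
      also have "(\<Sum>\<^sub>\<infinity>y. heat_kernel S t x y * f y * t powr (- 1 + ?s)) = heat S t f x * t powr (- 1 + ?s)"
        unfolding heat_eq_ip_kernel[OF f(1)] ip_def infsum_cmult_left' by (simp add: mult.commute)
      finally show ?thesis using True by simp
    qed simp
  qed
  also have "\<dots> = (\<integral>\<^sup>+y. \<integral>\<^sup>+t. ennreal (if 0 < t then heat_kernel S t x y * f y * t powr (- 1 + ?s) else 0) \<partial>lborel \<partial>count_space UNIV)"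
    by (rule nn_integral_count_space_nn_integral[OF cnt]) measurable
  also have "\<dots> = (\<integral>\<^sup>+y. ennreal (Gamma ?s) * ennreal (R x y * f y) \<partial>count_space UNIV)"
  proof (rule nn_integral_cong)
    fix y
    have "(\<integral>\<^sup>+t. ennreal (if 0 < t then heat_kernel S t x y * f y * t powr (- 1 + ?s) else 0) \<partial>lborel)
      = (\<integral>\<^sup>+t. ennreal (f y) * ennreal (if 0 < t then heat_kernel S t x y * t powr (- 1 + ?s) else 0) \<partial>lborel)"
      using f(3)[of y] by (intro nn_integral_cong) (auto simp: ennreal_mult[symmetric] heat_kernel_nonneg mult_ac)
    also have "\<dots> = ennreal (f y) * (\<integral>\<^sup>+t. ennreal (if 0 < t then heat_kernel S t x y * t powr (- 1 + ?s) else 0) \<partial>lborel)"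
      by (rule nn_integral_cmult) measurable
    also have "(\<integral>\<^sup>+t. ennreal (if 0 < t then heat_kernel S t x y * t powr (- 1 + ?s) else 0) \<partial>lborel)
       = ennreal (mellin ?s (\<lambda>t. heat_kernel S t x y))"
      unfolding mellin_def using heat_kernel_mellin_ok[of x y] heat_kernel_nonneg
      by (intro nn_from_set_integral) (auto simp: mellin_ok_def)
    also have "mellin ?s (\<lambda>t. heat_kernel S t x y) = Gamma ?s * R x y" using Gamma_half_pos by (simp add: green_mellin)
    finally show "(\<integral>\<^sup>+t. ennreal (if 0 < t then heat_kernel S t x y * f y * t powr (- 1 + ?s) else 0) \<partial>lborel)
       = ennreal (Gamma ?s) * ennreal (R x y * f y)"
      using f(3)[of y] green_nonneg[of x y] Gamma_half_pos by (simp add: ennreal_mult[symmetric] mult_ac)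
  qed
  also have "\<dots> = ennreal (Gamma ?s) * (\<integral>\<^sup>+y. ennreal (R x y * f y) \<partial>count_space UNIV)"
    by (rule nn_integral_cmult) simp
  finally have e: "ennreal (mellin ?s (\<lambda>t. heat S t f x)) = ennreal (Gamma ?s) * (\<integral>\<^sup>+y. ennreal (R x y * f y) \<partial>count_space UNIV)" .
  have "ennreal (pot ?s f x) = ennreal (1 / Gamma ?s) * ennreal (mellin ?s (\<lambda>t. heat S t f x))"
    unfolding pot_def using Gamma_half_pos hpos
    by (subst ennreal_mult[symmetric]) (auto intro!: mellin_nonneg)
  also have "\<dots> = (\<integral>\<^sup>+y. ennreal (R x y * f y) \<partial>count_space UNIV)"
    unfolding e mult.assoc[symmetric] using Gamma_half_pos by (subst ennreal_mult[symmetric]) auto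
  finally have e2: "(\<integral>\<^sup>+y. ennreal (R x y * f y) \<partial>count_space UNIV) = ennreal (pot ?s f x)" ..
  show "(\<lambda>y. R x y * f y) summable_on UNIV" "(\<Sum>\<^sub>\<infinity>y. R x y * f y) = pot ?s f x"
    using nn_count_space_infsum[OF _ P0 e2] f green_nonneg by auto
qed

proposition frac_lap_green:
  assumes f: "f \<in> l2" "f \<in> lq" "\<And>x. 0 \<le> f x"
  shows "frac_lap S \<alpha> (\<lambda>y. green_conv S \<alpha> f y + R y y * f y) x = f x"
proof -
  have "green_conv S \<alpha> f y + R y y * f y = pot (\<alpha>/2) f y" for y
  proof -
    have "infsum (\<lambda>z. R y z * f z) (insert y (- {y})) = R y y * f y + infsum (\<lambda>z. R y z * f z) (- {y})"
      by (rule infsum_insert) (auto intro: summable_on_subset[OF green_potential(1)[OF f]])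
    moreover have "insert y (- {y}) = UNIV" by auto
    ultimately show ?thesis using green_potential(2)[OF f, of y] by (simp add: green_conv_def)
  qed
  then have "(\<lambda>y. green_conv S \<alpha> f y + R y y * f y) = pot (\<alpha>/2) f" by (rule ext)
  then show ?thesis using frac_lap_inverts_pot[OF f(1,2)] by simp
qed

end

context choquard
begin

lemma pow_lq: "u \<in> l2 \<Longrightarrow> pow u \<in> lq" and pow_l2: "u \<in> l2 \<Longrightarrow> pow u \<in> l2"
proof -
  assume u: "u \<in> l2"
  obtain M where M: "\<And>x. \<bar>u x\<bar> \<le> M" using l2_bdd[OF u] unfolding bdd_fun_def by blast
  have low: "(\<lambda>x. \<bar>u x\<bar> powr r) summable_on UNIV" if r: "2 < r" for r
  proof (rule summable_on_comparison_test)
    show "(\<lambda>x. M powr (r - 2) * (u x)\<^sup>2) summable_on UNIV"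
      by (intro summable_on_cmult_right l2_square_summable u)
    fix x
    have "\<bar>u x\<bar> powr r = \<bar>u x\<bar> powr (r - 2) * \<bar>u x\<bar> powr 2" by (simp only: powr_add[symmetric]) simp
    also have "\<bar>u x\<bar> powr 2 = (u x)\<^sup>2" by (cases "u x = 0") auto
    also have "\<bar>u x\<bar> powr (r - 2) * (u x)\<^sup>2 \<le> M powr (r - 2) * (u x)\<^sup>2"
      using M[of x] r by (intro mult_right_mono powr_mono2) auto
    finally show "\<bar>u x\<bar> powr r \<le> M powr (r - 2) * (u x)\<^sup>2" .
  qed simp
  show "pow u \<in> lq" using low[OF pq] by (simp add: lq_def powr_powr)
  have "p * q < p * 2" using q_lt_2 p_gt_1 by (intro mult_strict_left_mono) auto
  then have "2 < p * 2" using pq by linarith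
  from low[OF this] have "(\<lambda>x. (pow u x) powr 2) summable_on UNIV" by (simp only: powr_powr)
  moreover have "(pow u x) powr 2 = (pow u x)\<^sup>2" for x by simp
  ultimately show "pow u \<in> l2" unfolding l2_def by simp
qed

lemma solves_system_if_euler_lagrange:
  assumes U: "U \<in> l2"
    and EL: "\<And>x. lap S (lap S U) x - lap S U x + (1 + l * a x) * U x
        = green_conv S \<alpha> (pow U) x * \<bar>U x\<bar> powr (p - 2) * U x"
  shows "solves_system S a \<alpha> p l U (green_conv S \<alpha> (pow U))"
  unfolding solves_system_def using EL frac_lap_green[OF pow_l2[OF U] pow_lq[OF U]]
  by (simp add: bilap_eq[OF U])

end

section \<open>Existence of ground states\<close>

text \<open>Put \<open>q = 2/r\<close>: the conditions become \<open>(N + \<alpha>)/N < r < p\<close> and \<open>1 < r < 2\<close>. They are compatible because \<open>(N + \<alpha>)/N\<close> is below both \<open>p\<close> and \<open>2\<close>.\<close>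

lemma exponent_exists:
  fixes N :: nat and \<alpha> p :: real
  assumes N: "N \<ge> 2" and \<alpha>: "0 < \<alpha>" "\<alpha> < real N" and p: "p > (real N + \<alpha>) / real N"
  shows "\<exists>q. 1 < q \<and> q < 2 \<and> \<alpha> / 2 < real N / q - real N / 2 \<and> 2 < p * q"
proof -
  have n: "real N > 0" using N by simp
  let ?c = "(real N + \<alpha>) / real N"
  have c: "1 < ?c" "?c < 2" using n \<alpha> by (simp_all add: field_simps)
  obtain r where r: "?c < r" "r < min p 2" using dense[of ?c "min p 2"] p c by auto
  have r1: "1 < r" "r < 2" "r < p" using r c by auto
  have "\<alpha> / 2 < real N * r / 2 - real N / 2"
  proof -
    have "real N * ?c < real N * r" using r n by (intro mult_strict_left_mono) auto
    moreover have "real N * ?c = real N + \<alpha>" using n by simp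
    ultimately show ?thesis by linarith
  qed
  moreover have "2 < p * (2 / r)" using r1 by (simp add: field_simps)
  ultimately show ?thesis using r1 by (intro exI[of _ "2 / r"]) (auto simp: field_simps)
qed

theorem theorem1p1:
  fixes S :: "'a::group_add set" and a :: "'a \<Rightarrow> real" and N :: nat and \<alpha> p :: real
  assumes "generating_set S"
    and "homogeneous_dim S N"
    and "N \<ge> 2"
    and "0 < \<alpha>" and "\<alpha> < real N"
    and "p > (real N + \<alpha>) / real N"
    and "\<forall>x. a x \<ge> 0"
    and "{x. a x = 0} \<noteq> {}" and "connected_in S {x. a x = 0}" and "bounded_in S {x. a x = 0}"
    and "\<exists>M>0. finite {x. a x \<le> M} \<and> {x. a x \<le> M} \<noteq> {}"
  shows "\<exists>l\<^sub>0>0. \<forall>l\<ge>l\<^sub>0. \<exists>u.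
    ground_state S a \<alpha> p l u \<and>
    (\<exists>v. v = green_conv S \<alpha> (\<lambda>x. \<bar>u x\<bar> powr p) \<and> u \<noteq> (\<lambda>_. 0) \<and> v \<noteq> (\<lambda>_. 0) \<and>
      solves_system S a \<alpha> p l u v)"
proof -
  obtain q where q: "1 < q" "q < 2" "\<alpha> / 2 < real N / q - real N / 2" "2 < p * q"
    using exponent_exists[OF assms(3-6)] by blast
  interpret choquard S N \<alpha> q p
    by unfold_locales (use assms(1-4) q in \<open>auto simp: generating_set_def\<close>)
  obtain x0 where x0: "a x0 = 0" using assms(8) by blast
  obtain M where M: "0 < M" "finite {x. a x \<le> M}" using assms(11) by blast
  have a: "0 \<le> a x" for x using assms(7) by blast
  obtain l0 where l0: "0 < l0" "\<And>l. l \<ge> l0 \<Longrightarrow> \<exists>U. U \<in> l2 \<and> ground_state S a \<alpha> p l U \<and> 0 < form (pow U) (pow U) \<and>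
     (\<forall>x. lap S (lap S U) x - lap S U x + (1 + l * a x) * U x
        = green_conv S \<alpha> (pow U) x * \<bar>U x\<bar> powr (p - 2) * U x)"
    using ground_state_exists[of a x0 M, OF a x0 M] by blast
  show ?thesis
  proof (intro exI[of _ l0] conjI allI impI l0(1))
    fix l assume "l0 \<le> l"
    then obtain U where U: "U \<in> l2" "ground_state S a \<alpha> p l U" "0 < form (pow U) (pow U)"
      "\<And>x. lap S (lap S U) x - lap S U x + (1 + l * a x) * U x
        = green_conv S \<alpha> (pow U) x * \<bar>U x\<bar> powr (p - 2) * U x"
      using l0(2)[of l] by blast
    have "green_conv S \<alpha> (pow U) \<noteq> (\<lambda>_. 0)"
    proof
      assume "green_conv S \<alpha> (pow U) = (\<lambda>_. 0)"
      then have "form (pow U) (pow U) = 0" unfolding form_iterated[OF U(1) U(1)] by simp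
      then show False using U(3) by simp
    qed
    moreover have "U \<noteq> (\<lambda>_. 0)" using U(2) by (simp add: ground_state_def)
    ultimately show "\<exists>u. ground_state S a \<alpha> p l u \<and>
      (\<exists>v. v = green_conv S \<alpha> (\<lambda>x. \<bar>u x\<bar> powr p) \<and> u \<noteq> (\<lambda>_. 0) \<and> v \<noteq> (\<lambda>_. 0) \<and> solves_system S a \<alpha> p l u v)"
      using U(2) solves_system_if_euler_lagrange[OF U(1,4)] by blast
  qed
qed

end
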